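(* Let $a,b\in\mathbb{R}$ with $4a\neq b^2$ and let $M^2$ be a non-totally geodesic surface in the Bianchi-Cartan-Vranceanu space $N(a,b)$. If $M^2$ is a totally biharmonic surface, then $a>0$ and $M^2$ is a rotational Hopf cylinder.
   Context: BCV spaces: for $a,b\in\mathbb{R}$, $N(a,b)$ is the set $\{(x,y,z)\in\mathbb{R}^3:\lambda_a:=1+a(x^2+y^2)>0\}$ with the Riemannian metric $$h_{a,b}=\frac{dx^2+dy^2}{[1+a(x^2+y^2)]^2}+\left(dz+\frac b2\,\frac{y\,dx-x\,dy}{1+a(x^2+y^2)}\right)^2.$$ The vector field $E_3=\partial/\partial z$ is a unit Killing vector field. When $4a\ne b^2$ the Lie algebra of Killing vector fields of $N(a,b)$ is 4-dimensional. An invariant surface is one that stays invariant under the action of (the flow of) a Killing vector field. A Hopf cylinder is a surface invariant under the flow of $E_3$; equivalently it is locally parametrized as $\mathbf x(s,t)=\psi_t(\widetilde\alpha(s))$, with $\{\psi_t\}$ the one-parameter group of isometries generated by $E_3$ and $\widetilde\alpha$ an arc-length parametrized curve orthogonal to $E_3$. A rotational surface is a surface invariant under the action of a one-parameter group of isometries isomorphic to $SO(2)$, such as the rotations about the $z$-axis, generated by the Killing field $-y\,\partial_x+x\,\partial_y$. A rotational Hopf cylinder is a Hopf cylinder that is also a rotational surface. All these notions of invariance are understood locally (the corresponding Killing field is tangent to the surface) and up to (local) isometries of the ambient space. A surface is a connected 2-manifold $M$ with a smooth isometric immersion $\varphi:M\to N(a,b)$ and unit normal vector field. A unit-speed curve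 $\gamma$ in a Riemannian manifold $N$, with $\mathbf t=\gamma'$, is biharmonic if $\nabla_{\mathbf t}^3\mathbf t+R^N(\nabla_{\mathbf t}\mathbf t,\mathbf t)\mathbf t=0$, where $R^N(X,Y)=\nabla_X\nabla_Y-\nabla_Y\nabla_X-\nabla_{[X,Y]}$. The surface is totally biharmonic if every unit-speed geodesic $\gamma$ of $M$ is such that $\varphi\circ\gamma$ is a biharmonic curve of the ambient space. *)

theory Defs
  imports "HOL-Analysis.Analysis"
begin

section \<open>Smooth maps\<close>

(* Meant for open S only: all derivatives are two-sided Frechet derivatives, and the
   derivatives of order Suc n are those of order n of the directional derivatives. *)
primrec C_k_on ::
  "nat \<Rightarrow> 'a::real_normed_vector set \<Rightarrow> ('a \<Rightarrow> 'b::real_normed_vector) \<Rightarrow> bool" where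
  "C_k_on 0 S f \<longleftrightarrow> continuous_on S f"
| "C_k_on (Suc n) S f \<longleftrightarrow> (\<forall>p\<in>S. f differentiable at p) \<and>
     (\<forall>v. C_k_on n S (\<lambda>p. frechet_derivative f (at p) v))"

definition smooth_on ::
  "'a::real_normed_vector set \<Rightarrow> ('a \<Rightarrow> 'b::real_normed_vector) \<Rightarrow> bool" where
  "smooth_on S f \<longleftrightarrow> (\<forall>n. C_k_on n S f)"


section \<open>Riemannian metrics on open subsets of a Euclidean space\<close>

type_synonym 'a metric_tensor = "'a \<Rightarrow> 'a \<Rightarrow> 'a \<Rightarrow> real"

(* The derivative at p, in direction u, of the metric coefficient g(v,w), with v and w
   regarded as constant vector fields. *)
definition metric_deriv ::
  "'a::euclidean_space metric_tensor \<Rightarrow> 'a \<Rightarrow> 'a \<Rightarrow> 'a \<Rightarrow> 'a \<Rightarrow> real" where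
  "metric_deriv g p u v w = frechet_derivative (\<lambda>q. g q v w) (at p) u"

(* The Levi-Civita derivative at p of the constant field v in direction u, i.e. the vector
   with components Gamma^k_ij u^i v^j, characterised by the Koszul formula. *)
definition christoffel ::
  "'a::euclidean_space metric_tensor \<Rightarrow> 'a \<Rightarrow> 'a \<Rightarrow> 'a \<Rightarrow> 'a" where
  "christoffel g p u v = (THE w. \<forall>z. 2 * g p w z =
     metric_deriv g p u v z + metric_deriv g p v u z - metric_deriv g p z u v)"

definition nabla ::
  "'a::euclidean_space metric_tensor \<Rightarrow> ('a \<Rightarrow> 'a) \<Rightarrow> ('a \<Rightarrow> 'a) \<Rightarrow> 'a \<Rightarrow> 'a" where
  "nabla g X Y = (\<lambda>p. frechet_derivative Y (at p) (X p) + christoffel g p (X p) (Y p))"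

definition lie_bracket ::
  "('a::euclidean_space \<Rightarrow> 'a) \<Rightarrow> ('a \<Rightarrow> 'a) \<Rightarrow> 'a \<Rightarrow> 'a" where
  "lie_bracket X Y = (\<lambda>p. frechet_derivative Y (at p) (X p) - frechet_derivative X (at p) (Y p))"

definition curvature_op ::
  "'a::euclidean_space metric_tensor \<Rightarrow> ('a \<Rightarrow> 'a) \<Rightarrow> ('a \<Rightarrow> 'a) \<Rightarrow> ('a \<Rightarrow> 'a) \<Rightarrow> 'a \<Rightarrow> 'a" where
  "curvature_op g X Y Z = (\<lambda>p. nabla g X (nabla g Y Z) p - nabla g Y (nabla g X Z) p
     - nabla g (lie_bracket X Y) Z p)"

(* R is tensorial, so tangent vectors may be extended to constant fields. *)
definition curvature ::
  "'a::euclidean_space metric_tensor \<Rightarrow> 'a \<Rightarrow> 'a \<Rightarrow> 'a \<Rightarrow> 'a \<Rightarrow> 'a" where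
  "curvature g p u v w = curvature_op g (\<lambda>_. u) (\<lambda>_. v) (\<lambda>_. w) p"

definition velocity :: "(real \<Rightarrow> 'a::euclidean_space) \<Rightarrow> real \<Rightarrow> 'a" where
  "velocity c = (\<lambda>t. vector_derivative c (at t))"

(* Covariant derivative of a vector field V along the curve c. *)
definition cov_along ::
  "'a::euclidean_space metric_tensor \<Rightarrow> (real \<Rightarrow> 'a) \<Rightarrow> (real \<Rightarrow> 'a) \<Rightarrow> real \<Rightarrow> 'a" where
  "cov_along g c V = (\<lambda>t. vector_derivative V (at t) + christoffel g (c t) (velocity c t) (V t))"

definition pullback ::
  "('a::euclidean_space \<Rightarrow> 'b::euclidean_space) \<Rightarrow> 'b metric_tensor \<Rightarrow> 'a metric_tensor" where
  "pullback f g = (\<lambda>p u v.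
     g (f p) (frechet_derivative f (at p) u) (frechet_derivative f (at p) v))"

(* N is the domain of g; its members are the points of the Riemannian manifold. *)
definition biharmonic_curve ::
  "'a::euclidean_space set \<Rightarrow> 'a metric_tensor \<Rightarrow> real set \<Rightarrow> (real \<Rightarrow> 'a) \<Rightarrow> bool" where
  "biharmonic_curve N g I c \<longleftrightarrow>
     smooth_on I c \<and> c ` I \<subseteq> N \<and>
     (\<forall>t\<in>I. g (c t) (velocity c t) (velocity c t) = 1) \<and>
     (\<forall>t\<in>I. (cov_along g c ^^ 3) (velocity c) t
        + curvature g (c t) (cov_along g c (velocity c) t) (velocity c t) (velocity c t) = 0)"

definition killing_field ::
  "'a::euclidean_space set \<Rightarrow> 'a metric_tensor \<Rightarrow> ('a \<Rightarrow> 'a) \<Rightarrow> bool" where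
  "killing_field N g X \<longleftrightarrow> smooth_on N X \<and>
     (\<forall>p\<in>N. \<forall>u v. metric_deriv g p (X p) u v
        + g p (frechet_derivative X (at p) u) v + g p u (frechet_derivative X (at p) v) = 0)"

(* In equal dimensions such a map is automatically a local diffeomorphism. *)
definition local_isometry ::
  "'a::euclidean_space set \<Rightarrow> 'a metric_tensor \<Rightarrow> 'a set \<Rightarrow> ('a \<Rightarrow> 'a) \<Rightarrow> bool" where
  "local_isometry N g U F \<longleftrightarrow> open U \<and> U \<subseteq> N \<and> smooth_on U F \<and> F ` U \<subseteq> N \<and>
     (\<forall>p\<in>U. \<forall>u v. pullback F g p u v = g p u v)"

(* Y generates a one-parameter group psi of isometries of N whose kernel is the lattice of
   integer multiples of some T > 0; thus the group is isomorphic to R / TZ, i.e. to SO(2). *)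
definition generates_SO2_action ::
  "'a::euclidean_space set \<Rightarrow> 'a metric_tensor \<Rightarrow> ('a \<Rightarrow> 'a) \<Rightarrow> bool" where
  "generates_SO2_action N g Y \<longleftrightarrow> (\<exists>(\<psi> :: real \<Rightarrow> 'a \<Rightarrow> 'a) T. T > 0 \<and>
     (\<forall>t. bij_betw (\<psi> t) N N \<and> local_isometry N g N (\<psi> t)) \<and>
     (\<forall>s t. \<forall>p\<in>N. \<psi> (s + t) p = \<psi> s (\<psi> t p)) \<and>
     (\<forall>t. (\<forall>p\<in>N. \<psi> t p = p) \<longleftrightarrow> (\<exists>k::int. t = of_int k * T)) \<and>
     (\<forall>t. \<forall>p\<in>N. ((\<lambda>s. \<psi> s p) has_vector_derivative Y (\<psi> t p)) (at t)))"


section \<open>Bianchi-Cartan-Vranceanu spaces\<close>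

definition bcv_lambda :: "real \<Rightarrow> real^3 \<Rightarrow> real" where
  "bcv_lambda a p = 1 + a * ((p $ 1)\<^sup>2 + (p $ 2)\<^sup>2)"

definition bcv_space :: "real \<Rightarrow> real \<Rightarrow> (real^3) set" where
  "bcv_space a b = {p. bcv_lambda a p > 0}"

definition bcv_form :: "real \<Rightarrow> real \<Rightarrow> real^3 \<Rightarrow> real^3 \<Rightarrow> real" where
  "bcv_form a b p v = v $ 3 + b / 2 * ((p $ 2 * v $ 1 - p $ 1 * v $ 2) / bcv_lambda a p)"

definition bcv_metric :: "real \<Rightarrow> real \<Rightarrow> (real^3) metric_tensor" where
  "bcv_metric a b p v w = (v $ 1 * w $ 1 + v $ 2 * w $ 2) / (bcv_lambda a p)\<^sup>2
     + bcv_form a b p v * bcv_form a b p w"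

definition E3 :: "real^3 \<Rightarrow> real^3" where
  "E3 = (\<lambda>p. axis 3 1)"


section \<open>Surfaces\<close>

(* The underlying set of the surface is the whole type; a chart is a pair (U, x). *)
type_synonym 'm atlas = "('m set \<times> ('m \<Rightarrow> real^2)) set"

definition smooth_atlas :: "'m::topological_space atlas \<Rightarrow> bool" where
  "smooth_atlas A \<longleftrightarrow>
     (\<Union>(U, x)\<in>A. U) = UNIV \<and>
     (\<forall>(U, x)\<in>A. open U \<and> open (x ` U) \<and> homeomorphism U (x ` U) x (inv_into U x)) \<and>
     (\<forall>(U, x)\<in>A. \<forall>(V, y)\<in>A. smooth_on (x ` (U \<inter> V)) (y \<circ> inv_into U x))"

definition loc_rep :: "('m \<Rightarrow> 'b) \<Rightarrow> 'm set \<Rightarrow> ('m \<Rightarrow> real^2) \<Rightarrow> real^2 \<Rightarrow> 'b" where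
  "loc_rep f U x = f \<circ> inv_into U x"

definition smooth_map ::
  "'m::topological_space atlas \<Rightarrow> ('m \<Rightarrow> real^3) \<Rightarrow> bool" where
  "smooth_map A f \<longleftrightarrow> (\<forall>(U, x)\<in>A. smooth_on (x ` U) (loc_rep f U x))"

(* dphi_p in the coordinates of the chart (U, x) *)
definition loc_diff ::
  "('m \<Rightarrow> real^3) \<Rightarrow> 'm set \<Rightarrow> ('m \<Rightarrow> real^2) \<Rightarrow> 'm \<Rightarrow> real^2 \<Rightarrow> real^3" where
  "loc_diff \<phi> U x p = frechet_derivative (loc_rep \<phi> U x) (at (x p))"

(* The surface carries the metric induced by phi, which makes the immersion phi isometric;
   eta is its unit normal field. *)
definition bcv_surface ::
  "real \<Rightarrow> real \<Rightarrow> 'm::{t2_space,second_countable_topology} atlas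
     \<Rightarrow> ('m \<Rightarrow> real^3) \<Rightarrow> ('m \<Rightarrow> real^3) \<Rightarrow> bool" where
  "bcv_surface a b A \<phi> \<eta> \<longleftrightarrow>
     connected (UNIV :: 'm set) \<and> smooth_atlas A \<and>
     range \<phi> \<subseteq> bcv_space a b \<and> smooth_map A \<phi> \<and> smooth_map A \<eta> \<and>
     (\<forall>p. bcv_metric a b (\<phi> p) (\<eta> p) (\<eta> p) = 1) \<and>
     (\<forall>(U, x)\<in>A. \<forall>p\<in>U. inj (loc_diff \<phi> U x p) \<and>
        (\<forall>v. bcv_metric a b (\<phi> p) (loc_diff \<phi> U x p v) (\<eta> p) = 0))"

definition induced_metric ::
  "real \<Rightarrow> real \<Rightarrow> ('m \<Rightarrow> real^3) \<Rightarrow> 'm set \<Rightarrow> ('m \<Rightarrow> real^2) \<Rightarrow> (real^2) metric_tensor" where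
  "induced_metric a b \<phi> U x = pullback (loc_rep \<phi> U x) (bcv_metric a b)"

(* The normal component of the ambient covariant derivative of dphi(v) in direction dphi(u),
   for v a constant field in the coordinates of (U, x). *)
definition second_fundamental_form ::
  "real \<Rightarrow> real \<Rightarrow> ('m \<Rightarrow> real^3) \<Rightarrow> ('m \<Rightarrow> real^3) \<Rightarrow> 'm set \<Rightarrow> ('m \<Rightarrow> real^2)
     \<Rightarrow> 'm \<Rightarrow> real^2 \<Rightarrow> real^2 \<Rightarrow> real" where
  "second_fundamental_form a b \<phi> \<eta> U x p u v =
     bcv_metric a b (\<phi> p)
       (frechet_derivative (\<lambda>q. frechet_derivative (loc_rep \<phi> U x) (at q) v) (at (x p)) u
        + christoffel (bcv_metric a b) (\<phi> p) (loc_diff \<phi> U x p u) (loc_diff \<phi> U x p v))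
       (\<eta> p)"

definition totally_geodesic ::
  "real \<Rightarrow> real \<Rightarrow> 'm atlas \<Rightarrow> ('m \<Rightarrow> real^3) \<Rightarrow> ('m \<Rightarrow> real^3) \<Rightarrow> bool" where
  "totally_geodesic a b A \<phi> \<eta> \<longleftrightarrow>
     (\<forall>(U, x)\<in>A. \<forall>p\<in>U. \<forall>u v. second_fundamental_form a b \<phi> \<eta> U x p u v = 0)"

definition unit_speed_geodesic ::
  "real \<Rightarrow> real \<Rightarrow> 'm::topological_space atlas \<Rightarrow> ('m \<Rightarrow> real^3)
     \<Rightarrow> real set \<Rightarrow> (real \<Rightarrow> 'm) \<Rightarrow> bool" where
  "unit_speed_geodesic a b A \<phi> I \<gamma> \<longleftrightarrow> continuous_on I \<gamma> \<and>
     (\<forall>(U, x)\<in>A. let g = induced_metric a b \<phi> U x; c = x \<circ> \<gamma> in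
        smooth_on (I \<inter> \<gamma> -` U) c \<and>
        (\<forall>t\<in>I. \<gamma> t \<in> U \<longrightarrow>
           g (c t) (velocity c t) (velocity c t) = 1 \<and> cov_along g c (velocity c) t = 0))"

definition totally_biharmonic ::
  "real \<Rightarrow> real \<Rightarrow> 'm::topological_space atlas \<Rightarrow> ('m \<Rightarrow> real^3) \<Rightarrow> bool" where
  "totally_biharmonic a b A \<phi> \<longleftrightarrow>
     (\<forall>I \<gamma>. open I \<and> is_interval I \<and> I \<noteq> {} \<and> unit_speed_geodesic a b A \<phi> I \<gamma>
        \<longrightarrow> biharmonic_curve (bcv_space a b) (bcv_metric a b) I (\<phi> \<circ> \<gamma>))"

definition tangent_to_surface ::
  "'m atlas \<Rightarrow> ('m \<Rightarrow> real^3) \<Rightarrow> (real^3 \<Rightarrow> real^3) \<Rightarrow> bool" where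
  "tangent_to_surface A \<phi> X \<longleftrightarrow>
     (\<forall>(U, x)\<in>A. \<forall>p\<in>U. X (\<phi> p) \<in> range (loc_diff \<phi> U x p))"

definition hopf_cylinder :: "'m atlas \<Rightarrow> ('m \<Rightarrow> real^3) \<Rightarrow> bool" where
  "hopf_cylinder A \<phi> \<longleftrightarrow> tangent_to_surface A \<phi> E3"

(* A Killing field X is tangent to the surface, and near every point of the surface a local
   isometry F of the ambient space carries X to one and the same infinitesimal generator Y of
   a group of isometries isomorphic to SO(2), e.g. Y = -y d/dx + x d/dy.  Local isometries
   cannot be dispensed with: for a > 0 the space lacks the vertical fibre over the point at
   infinity of the (x,y)-plane, and rotations about other fibres are not complete on it. *)
definition rotational_surface ::
  "real \<Rightarrow> real \<Rightarrow> 'm atlas \<Rightarrow> ('m \<Rightarrow> real^3) \<Rightarrow> bool" where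
  "rotational_surface a b A \<phi> \<longleftrightarrow>
     (\<exists>X Y. killing_field (bcv_space a b) (bcv_metric a b) X \<and>
        tangent_to_surface A \<phi> X \<and>
        generates_SO2_action (bcv_space a b) (bcv_metric a b) Y \<and>
        (\<forall>p. \<exists>U F. \<phi> p \<in> U \<and> local_isometry (bcv_space a b) (bcv_metric a b) U F \<and>
           (\<forall>q\<in>U. frechet_derivative F (at q) (X q) = Y (F q))))"

definition rotational_hopf_cylinder ::
  "real \<Rightarrow> real \<Rightarrow> 'm atlas \<Rightarrow> ('m \<Rightarrow> real^3) \<Rightarrow> bool" where
  "rotational_hopf_cylinder a b A \<phi> \<longleftrightarrow> hopf_cylinder A \<phi> \<and> rotational_surface a b A \<phi>"

end

theory Submission
  imports Defs
begin

text \<open>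
  In the orthonormal coframe of \<open>N(a, b)\<close> the Levi-Civita derivative along a curve is \<open>DV = V' + W \<times> V\<close>. Let
  \<open>T\<close> be the velocity of a geodesic of the surface, \<open>e\<close> the unit normal and \<open>DT = k e\<close>. The component of the
  biharmonic equation along \<open>T\<close> says that \<open>k\<close> is constant, and if \<open>k \<noteq> 0\<close> the equation becomes \<open>D(De) = - R(e, T)T\<close>.
  It follows that \<open>\<bar>De\<bar>\<^sup>2 = b\<^sup>2/4 + (4 a - b\<^sup>2) n\<^sup>2\<close> with \<open>n = \<langle>e \<times> T, E3\<rangle>\<close>, and differentiating this once,
  \<open>n (2 \<langle>De, T \<times> E3\<rangle> - b/2 \<langle>e, E3\<rangle>) = 0\<close>. Both are polynomial identities in the direction \<open>T\<close>; since
  geodesics exist in every direction, they hold for all directions at a point where the second fundamental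
  form does not vanish, and leave only \<open>\<langle>e, E3\<rangle> = 0\<close> or \<open>e = \<plusminus>E3\<close>. The second alternative would persist along a
  geodesic with \<open>k \<noteq> 0\<close>, where it forces \<open>k = 0\<close>. So \<open>E3\<close> is tangent, and then the same identities give \<open>b = 0\<close>
  and a shape operator of rank one with eigenvalue \<open>\<plusminus>2 sqrt a\<close>. Hence non-vanishing of the second fundamental
  form is an open and closed condition, the surface is a cylinder over a circle of the sphere of curvature
  \<open>4 a\<close>, and a Moebius transformation moves the centre of the circle to the origin.
\<close>

section \<open>Calculus of smooth maps\<close>

text \<open>In frame components the metric is the standard inner product of R^3 and the connection
  acts by a cross product, so D obeys the product rules for inner and cross products and Christoffel
  symbols disappear. The hypothesis speaks of geodesics only; dividing the biharmonic equation by k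
  confines every pointwise identity to directions u with II(u, u) \<noteq> 0. The way out is
  algebraic: up to a power of 1 + r^2, each identity is a polynomial in the slope r of the
  direction, its product with the nonzero polynomial II vanishes for all r, and II can be cancelled.
  The value b = 0 comes from a clash. Differentiating <e, E3> = 0 prescribes an entry b/2 of the map
  u -> D_u e, while the coefficients of |De|^2 make the two columns of that map orthogonal, one of
  them with an entry of square 4 a - b^2 \<noteq> 0. Biharmonicity can only be used once geodesics
  exist, which requires a local existence theorem for ordinary differential equations and a
  description of geodesics that does not depend on the chart: acceleration parallel to the
  normal.\<close>

lemma C_k_on_subset: "C_k_on n S f \<Longrightarrow> T \<subseteq> S \<Longrightarrow> C_k_on n T f"
  by (induction n arbitrary: f) (auto intro: continuous_on_subset)

lemma C_k_on_cong:
  assumes "open S" "\<And>p. p \<in> S \<Longrightarrow> f p = g p"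
  shows "C_k_on n S f \<longleftrightarrow> C_k_on n S g"
  using assms(2)
proof (induction n arbitrary: f g)
  case 0
  then show ?case by (simp cong: continuous_on_cong)
next
  case (Suc n)
  have hd: "(f has_derivative D) (at p) \<longleftrightarrow> (g has_derivative D) (at p)" if "p \<in> S" for p D
    using has_derivative_transform_within_open[OF _ assms(1) that, of f D UNIV g]
      has_derivative_transform_within_open[OF _ assms(1) that, of g D UNIV f] Suc.prems
    by metis
  have fd: "frechet_derivative f (at p) = frechet_derivative g (at p)" if "p \<in> S" for p
    unfolding frechet_derivative_def using hd[OF that] by simp
  have "f differentiable at p \<longleftrightarrow> g differentiable at p" if "p \<in> S" for p
    unfolding differentiable_def using hd[OF that] by simp
  moreover have "C_k_on n S (\<lambda>p. frechet_derivative f (at p) v) \<longleftrightarrow>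
      C_k_on n S (\<lambda>p. frechet_derivative g (at p) v)" for v
    by (rule Suc.IH) (simp add: fd)
  ultimately show ?case by auto
qed

lemma C_k_on_SucD: "C_k_on (Suc n) S f \<Longrightarrow> C_k_on n S f"
proof (induction n arbitrary: f)
  case 0
  then show ?case
    by (auto intro!: differentiable_imp_continuous_on simp: differentiable_on_def
        intro: differentiable_at_imp_differentiable_on differentiable_within_subset)
next
  case (Suc n)
  then show ?case by (metis C_k_on.simps(2))
qed

lemma C_k_on_has_derivative:
  "C_k_on (Suc n) S f \<Longrightarrow> p \<in> S \<Longrightarrow> (f has_derivative frechet_derivative f (at p)) (at p)"
  by (simp add: frechet_derivative_works)

text \<open>The closure properties below go through this rule, which lets the derivative be given by
  a formula instead of \<open>frechet_derivative\<close>.\<close>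

lemma C_k_on_SucI:
  assumes "open S" "\<And>p. p \<in> S \<Longrightarrow> (f has_derivative D p) (at p)"
    and "\<And>v. C_k_on n S (\<lambda>p. D p v)"
  shows "C_k_on (Suc n) S f"
proof -
  have fd: "frechet_derivative f (at p) = D p" if "p \<in> S" for p
    using assms(2)[OF that] by (metis frechet_derivative_at)
  have "C_k_on n S (\<lambda>p. frechet_derivative f (at p) v)" for v
    using assms(3)[of v] C_k_on_cong[OF assms(1), of "\<lambda>p. frechet_derivative f (at p) v" "\<lambda>p. D p v" n]
    by (simp add: fd)
  then show ?thesis using assms(2) by (auto simp: differentiable_def)
qed

lemma C_k_on_const: "open S \<Longrightarrow> C_k_on n S (\<lambda>_. c)"
proof (induction n arbitrary: c)
  case (Suc n)
  then show ?case by (intro C_k_on_SucI[where D="\<lambda>_ _. 0"]) (auto intro: has_derivative_const)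
qed simp

lemma C_k_on_linear:
  assumes "open S" "bounded_linear L"
  shows "C_k_on n S L"
proof (cases n)
  case 0
  then show ?thesis using assms by (simp add: linear_continuous_on)
next
  case (Suc m)
  then show ?thesis using assms
    by (simp only: Suc)
      (intro C_k_on_SucI[where D="\<lambda>_. L"] C_k_on_const bounded_linear_imp_has_derivative)
qed

lemma C_k_on_linear_comp:
  assumes "open S" "bounded_linear L" "C_k_on n S f"
  shows "C_k_on n S (\<lambda>x. L (f x))"
  using assms(3)
proof (induction n arbitrary: f)
  case 0
  then show ?case using bounded_linear.continuous_on[OF assms(2)] by simp
next
  case (Suc n)
  show ?case
  proof (rule C_k_on_SucI[OF assms(1)])
    show "((\<lambda>x. L (f x)) has_derivative (\<lambda>v. L (frechet_derivative f (at p) v))) (at p)" if "p \<in> S" for p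
      using bounded_linear.has_derivative[OF assms(2) C_k_on_has_derivative[OF Suc.prems that]] .
    show "C_k_on n S (\<lambda>p. L (frechet_derivative f (at p) v))" for v
      using Suc by simp
  qed
qed

lemma C_k_on_add:
  assumes "open S" "C_k_on n S f" "C_k_on n S g"
  shows "C_k_on n S (\<lambda>x. f x + g x)"
  using assms(2,3)
proof (induction n arbitrary: f g)
  case 0
  then show ?case by (simp add: continuous_on_add)
next
  case (Suc n)
  show ?case
  proof (rule C_k_on_SucI[OF assms(1)])
    show "((\<lambda>x. f x + g x) has_derivative
        (\<lambda>v. frechet_derivative f (at p) v + frechet_derivative g (at p) v)) (at p)" if "p \<in> S" for p
      using that Suc.prems by (intro has_derivative_add C_k_on_has_derivative)
  qed (use Suc in simp)
qed

lemma C_k_on_bilinear: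
  assumes "open S" "bounded_bilinear B" "C_k_on n S f" "C_k_on n S g"
  shows "C_k_on n S (\<lambda>x. B (f x) (g x))"
  using assms(3,4)
proof (induction n arbitrary: f g)
  case 0
  then show ?case using bounded_bilinear.continuous_on[OF assms(2)] by simp
next
  case (Suc n)
  show ?case
  proof (rule C_k_on_SucI[OF assms(1)])
    show "((\<lambda>x. B (f x) (g x)) has_derivative
        (\<lambda>v. B (f p) (frechet_derivative g (at p) v) + B (frechet_derivative f (at p) v) (g p))) (at p)"
      if "p \<in> S" for p
      using that Suc.prems by (intro bounded_bilinear.FDERIV[OF assms(2)] C_k_on_has_derivative)
    show "C_k_on n S (\<lambda>p. B (f p) (frechet_derivative g (at p) v)
        + B (frechet_derivative f (at p) v) (g p))" for v
      by (intro C_k_on_add[OF assms(1)] Suc.IH)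
        (use Suc.prems C_k_on_SucD[OF Suc.prems(1)] C_k_on_SucD[OF Suc.prems(2)] in simp_all)
  qed
qed

lemma C_k_on_sum:
  assumes "open S" "\<And>i. i \<in> I \<Longrightarrow> C_k_on n S (f i)"
  shows "C_k_on n S (\<lambda>x. \<Sum>i\<in>I. f i x)"
  using assms(2)
proof (induction I rule: infinite_finite_induct)
  case (insert x F)
  then show ?case by (simp add: C_k_on_add assms(1))
qed (simp_all add: C_k_on_const assms(1))

lemma linear_expand:
  fixes v :: "'a::euclidean_space"
  assumes "linear L"
  shows "L v = (\<Sum>i\<in>Basis. (v \<bullet> i) *\<^sub>R L i)"
proof -
  have "L v = L (\<Sum>i\<in>Basis. (v \<bullet> i) *\<^sub>R i)" by (simp add: euclidean_representation)
  then show ?thesis by (simp add: linear_sum[OF assms] linear_scale[OF assms])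
qed

text \<open>The derivative of \<open>g\<close> is taken in the moving direction
  \<open>frechet_derivative f (at p) v\<close>, while \<open>C_k_on\<close> controls constant
  directions. Expanding the direction in \<open>Basis\<close> reduces to those; hence the Euclidean
  middle space.\<close>

lemma C_k_on_compose:
  fixes f :: "'a::real_normed_vector \<Rightarrow> 'b::euclidean_space" and g :: "'b \<Rightarrow> 'c::real_normed_vector"
  assumes "open S" "open T" "f ` S \<subseteq> T" "C_k_on n S f" "C_k_on n T g"
  shows "C_k_on n S (\<lambda>x. g (f x))"
  using assms(4,5)
proof (induction n arbitrary: g)
  case 0
  then show ?case using continuous_on_compose2[OF _ _ assms(3)] by simp
next
  case (Suc n)
  have lin: "linear (frechet_derivative g (at q))" if "q \<in> T" for q
    using that Suc.prems(2) by (simp add: linear_frechet_derivative)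
  have "C_k_on n S (\<lambda>p. \<Sum>i\<in>Basis. (frechet_derivative f (at p) v \<bullet> i) *\<^sub>R frechet_derivative g (at (f p)) i)" for v
    by (intro C_k_on_sum assms(1) C_k_on_bilinear[OF assms(1) bounded_bilinear_scaleR]
          Suc.IH C_k_on_linear_comp[OF assms(1) bounded_linear_inner_left])
      (use Suc.prems C_k_on_SucD[OF Suc.prems(1)] in simp_all)
  moreover have "frechet_derivative g (at (f p)) (frechet_derivative f (at p) v) =
     (\<Sum>i\<in>Basis. (frechet_derivative f (at p) v \<bullet> i) *\<^sub>R frechet_derivative g (at (f p)) i)"
     if "p \<in> S" for p v
    using assms(3) that by (intro linear_expand lin) auto
  ultimately have 1: "C_k_on n S (\<lambda>p. frechet_derivative g (at (f p)) (frechet_derivative f (at p) v))" for v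
    by (subst C_k_on_cong[OF assms(1)]) auto
  have 2: "((\<lambda>x. g (f x)) has_derivative
      (\<lambda>v. frechet_derivative g (at (f p)) (frechet_derivative f (at p) v))) (at p)"
    if "p \<in> S" for p
  proof -
    have "f p \<in> T" using that assms(3) by auto
    then show ?thesis
      using diff_chain_at[OF C_k_on_has_derivative[OF Suc.prems(1) that]
          C_k_on_has_derivative[OF Suc.prems(2)]] by (simp add: o_def)
  qed
  show ?case by (rule C_k_on_SucI[OF assms(1) 2 1])
qed

lemma smooth_on_subset: "smooth_on S f \<Longrightarrow> T \<subseteq> S \<Longrightarrow> smooth_on T f"
  unfolding smooth_on_def using C_k_on_subset by blast

lemma smooth_on_cong:
  assumes "open S" "\<And>p. p \<in> S \<Longrightarrow> f p = g p"
  shows "smooth_on S f \<longleftrightarrow> smooth_on S g"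
  unfolding smooth_on_def using C_k_on_cong[OF assms] by simp

lemma smooth_on_frechet: "smooth_on S f \<Longrightarrow> smooth_on S (\<lambda>p. frechet_derivative f (at p) v)"
  unfolding smooth_on_def by (metis C_k_on.simps(2))

lemma smooth_on_differentiable: "smooth_on S f \<Longrightarrow> p \<in> S \<Longrightarrow> f differentiable (at p)"
  unfolding smooth_on_def by (metis C_k_on.simps(2))

lemma smooth_on_has_derivative:
  "smooth_on S f \<Longrightarrow> p \<in> S \<Longrightarrow> (f has_derivative frechet_derivative f (at p)) (at p)"
  by (meson frechet_derivative_works smooth_on_differentiable)

lemma smooth_on_continuous: "smooth_on S f \<Longrightarrow> continuous_on S f"
  unfolding smooth_on_def by (metis C_k_on.simps(1))

lemma smooth_on_frechet_linear:
  "smooth_on S f \<Longrightarrow> p \<in> S \<Longrightarrow> linear (frechet_derivative f (at p))"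
  by (simp add: linear_frechet_derivative smooth_on_differentiable)

lemma smooth_on_const: "open S \<Longrightarrow> smooth_on S (\<lambda>_. c)"
  by (simp add: smooth_on_def C_k_on_const)

lemma smooth_on_linear: "open S \<Longrightarrow> bounded_linear L \<Longrightarrow> smooth_on S L"
  by (simp add: smooth_on_def C_k_on_linear)

lemma smooth_on_id: "open S \<Longrightarrow> smooth_on S (\<lambda>x. x)"
  by (rule smooth_on_linear) (auto intro: bounded_linear_ident)

lemma smooth_on_linear_comp:
  "open S \<Longrightarrow> bounded_linear L \<Longrightarrow> smooth_on S f \<Longrightarrow> smooth_on S (\<lambda>x. L (f x))"
  by (simp add: smooth_on_def C_k_on_linear_comp)

lemma smooth_on_bilinear:
  "open S \<Longrightarrow> bounded_bilinear B \<Longrightarrow> smooth_on S f \<Longrightarrow> smooth_on S g \<Longrightarrow>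
    smooth_on S (\<lambda>x. B (f x) (g x))"
  by (simp add: smooth_on_def C_k_on_bilinear)

lemma smooth_on_add:
  "open S \<Longrightarrow> smooth_on S f \<Longrightarrow> smooth_on S g \<Longrightarrow> smooth_on S (\<lambda>x. f x + g x)"
  by (simp add: smooth_on_def C_k_on_add)

lemma smooth_on_minus: "open S \<Longrightarrow> smooth_on S f \<Longrightarrow> smooth_on S (\<lambda>x. - f x)"
  by (rule smooth_on_linear_comp) (auto intro: bounded_linear_minus bounded_linear_ident)

lemma smooth_on_diff:
  "open S \<Longrightarrow> smooth_on S f \<Longrightarrow> smooth_on S g \<Longrightarrow> smooth_on S (\<lambda>x. f x - g x)"
  using smooth_on_add[of S f "\<lambda>x. - g x"] smooth_on_minus[of S g] by simp

lemma smooth_on_sum: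
  "open S \<Longrightarrow> (\<And>i. i \<in> I \<Longrightarrow> smooth_on S (f i)) \<Longrightarrow> smooth_on S (\<lambda>x. \<Sum>i\<in>I. f i x)"
  by (simp add: smooth_on_def C_k_on_sum)

lemma smooth_on_compose:
  fixes f :: "'a::real_normed_vector \<Rightarrow> 'b::euclidean_space"
  shows "open S \<Longrightarrow> open T \<Longrightarrow> f ` S \<subseteq> T \<Longrightarrow> smooth_on S f \<Longrightarrow> smooth_on T g \<Longrightarrow>
    smooth_on S (\<lambda>x. g (f x))"
  by (simp add: smooth_on_def C_k_on_compose)

lemma smooth_on_mult:
  fixes f g :: "'a::real_normed_vector \<Rightarrow> 'b::real_normed_algebra"
  shows "open S \<Longrightarrow> smooth_on S f \<Longrightarrow> smooth_on S g \<Longrightarrow> smooth_on S (\<lambda>x. f x * g x)"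
  by (rule smooth_on_bilinear) (auto intro: bounded_bilinear_mult)

lemma smooth_on_scaleR:
  "open S \<Longrightarrow> smooth_on S f \<Longrightarrow> smooth_on S g \<Longrightarrow> smooth_on S (\<lambda>x. f x *\<^sub>R g x)"
  by (rule smooth_on_bilinear) (auto intro: bounded_bilinear_scaleR)

lemma smooth_on_inner:
  "open S \<Longrightarrow> smooth_on S f \<Longrightarrow> smooth_on S g \<Longrightarrow> smooth_on S (\<lambda>x. f x \<bullet> g x)"
  by (rule smooth_on_bilinear) (auto intro: bounded_bilinear_inner)

lemma smooth_on_power:
  fixes f :: "'a::real_normed_vector \<Rightarrow> real"
  shows "open S \<Longrightarrow> smooth_on S f \<Longrightarrow> smooth_on S (\<lambda>x. f x ^ n)"
  by (induction n) (auto intro: smooth_on_const smooth_on_mult)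

text \<open>The derivative -p^-1 v p^-1 is built from the inverse by products, so order n for the
  inverse gives order n + 1.\<close>

lemma C_k_on_inverse: "C_k_on n (- {0}) (inverse :: 'a::real_normed_div_algebra \<Rightarrow> 'a)"
proof (induction n)
  case 0
  then show ?case by (auto intro!: continuous_intros)
next
  case (Suc n)
  have o: "open (- {0::'a})" by (simp add: open_Compl)
  show ?case
  proof (rule C_k_on_SucI[OF o])
    show "(inverse has_derivative (\<lambda>v. - (inverse p * v * inverse p))) (at p)" if "p \<in> - {0}" for p :: 'a
      using that by (auto intro!: has_derivative_inverse')
    have "C_k_on n (- {0}) (\<lambda>p. - ((inverse p * v) * inverse p))" for v :: 'a
      by (intro C_k_on_linear_comp[OF o bounded_linear_minus[OF bounded_linear_ident]]
          C_k_on_bilinear[OF o bounded_bilinear_mult] Suc C_k_on_const o)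
    then show "C_k_on n (- {0}) (\<lambda>p. - (inverse p * v * inverse p))" for v :: 'a by simp
  qed
qed

lemma smooth_on_inverse:
  fixes f :: "'a::real_normed_vector \<Rightarrow> 'b::{real_normed_div_algebra, euclidean_space}"
  assumes "open S" "smooth_on S f" "\<And>x. x \<in> S \<Longrightarrow> f x \<noteq> 0"
  shows "smooth_on S (\<lambda>x. inverse (f x))"
  by (rule smooth_on_compose[where T="- {0}"])
    (use assms in \<open>auto simp: open_Compl smooth_on_def C_k_on_inverse\<close>)

lemma smooth_on_divide:
  fixes f g :: "'a::real_normed_vector \<Rightarrow> 'b::{real_normed_field, euclidean_space}"
  assumes "open S" "smooth_on S f" "smooth_on S g" "\<And>x. x \<in> S \<Longrightarrow> g x \<noteq> 0"
  shows "smooth_on S (\<lambda>x. f x / g x)"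
  using smooth_on_mult[OF assms(1,2) smooth_on_inverse[OF assms(1,3,4)]] by (simp add: divide_inverse)

lemma smooth_on_nth: "open S \<Longrightarrow> smooth_on S f \<Longrightarrow> smooth_on S (\<lambda>x. f x $ i)"
  by (rule smooth_on_linear_comp) (auto intro: bounded_linear_vec_nth)

lemma smooth_on_Pair:
  assumes "open S" "smooth_on S f" "smooth_on S g"
  shows "smooth_on S (\<lambda>x. (f x, g x))"
proof -
  have "smooth_on S (\<lambda>x. (f x, 0) + (0, g x))"
    by (intro smooth_on_add assms smooth_on_linear_comp[where L="\<lambda>u. (u, 0)"]
        smooth_on_linear_comp[where L="\<lambda>u. (0, u)"] bounded_linear_Pair
        bounded_linear_ident bounded_linear_zero)
  then show ?thesis by simp
qed

lemma smooth_on_fst: "open S \<Longrightarrow> smooth_on S f \<Longrightarrow> smooth_on S (\<lambda>x. fst (f x))"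
  by (rule smooth_on_linear_comp) (auto intro: bounded_linear_fst)

lemma smooth_on_snd: "open S \<Longrightarrow> smooth_on S f \<Longrightarrow> smooth_on S (\<lambda>x. snd (f x))"
  by (rule smooth_on_linear_comp) (auto intro: bounded_linear_snd)

lemma bounded_bilinear_cross3: "bounded_bilinear (cross3 :: real^3 \<Rightarrow> real^3 \<Rightarrow> real^3)"
  using bilinear_conv_bounded_bilinear bilinear_cross by blast

lemma smooth_on_cross3:
  "open S \<Longrightarrow> smooth_on S f \<Longrightarrow> smooth_on S g \<Longrightarrow> smooth_on S (\<lambda>x. cross3 (f x) (g x))"
  by (rule smooth_on_bilinear) (auto intro: bounded_bilinear_cross3)

lemma smooth_on_vector3:
  fixes f g h :: "'a::real_normed_vector \<Rightarrow> real"
  assumes "open S" "smooth_on S f" "smooth_on S g" "smooth_on S h"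
  shows "smooth_on S (\<lambda>x. vector [f x, g x, h x] :: real^3)"
proof -
  have "smooth_on S (\<lambda>x. f x *\<^sub>R axis 1 1 + g x *\<^sub>R axis 2 1 + h x *\<^sub>R axis 3 (1::real) :: real^3)"
    by (intro smooth_on_add smooth_on_scaleR smooth_on_const assms)
  also have "(\<lambda>x. f x *\<^sub>R axis 1 1 + g x *\<^sub>R axis 2 1 + h x *\<^sub>R axis 3 (1::real) :: real^3) =
      (\<lambda>x. vector [f x, g x, h x])"
    by (auto simp: vec_eq_iff forall_3 vector_3 axis_def)
  finally show ?thesis .
qed

text \<open>Handles a derivative at a moving point in a moving direction, again by a basis
  expansion; this is what shows that the geodesic system is smooth.\<close>

lemma smooth_on_frechet_apply:
  fixes g :: "'a::real_normed_vector \<Rightarrow> 'b::euclidean_space" and f :: "'b \<Rightarrow> 'c::real_normed_vector"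
  assumes "open S" "open T" "g ` S \<subseteq> T" "smooth_on S g" "smooth_on S h" "smooth_on T f"
  shows "smooth_on S (\<lambda>p. frechet_derivative f (at (g p)) (h p))"
proof -
  have "smooth_on S (\<lambda>p. \<Sum>i\<in>Basis. (h p \<bullet> i) *\<^sub>R frechet_derivative f (at (g p)) i)"
    by (intro smooth_on_sum smooth_on_scaleR smooth_on_inner assms smooth_on_const
        smooth_on_compose[where T=T, OF _ _ _ _ smooth_on_frechet])
  moreover have "frechet_derivative f (at (g p)) (h p) =
      (\<Sum>i\<in>Basis. (h p \<bullet> i) *\<^sub>R frechet_derivative f (at (g p)) i)" if "p \<in> S" for p
    using assms that by (intro linear_expand smooth_on_frechet_linear[where S=T]) auto
  ultimately show ?thesis by (subst smooth_on_cong[OF assms(1)]) auto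
qed

lemma smooth_on_vector_derivative:
  fixes f :: "real \<Rightarrow> 'b::real_normed_vector"
  assumes "open S" "smooth_on S f"
  shows "smooth_on S (\<lambda>t. vector_derivative f (at t))"
proof -
  have "vector_derivative f (at t) = frechet_derivative f (at t) 1" if "t \<in> S" for t
    using smooth_on_has_derivative[OF assms(2) that] frechet_derivative_eq_vector_derivative
      smooth_on_differentiable[OF assms(2) that] by fastforce
  then show ?thesis using smooth_on_frechet[OF assms(2), of 1] by (subst smooth_on_cong[OF assms(1)]) auto
qed

lemma smooth_on_has_vector_derivative:
  fixes f :: "real \<Rightarrow> 'b::real_normed_vector"
  assumes "smooth_on S f" "t \<in> S"
  shows "(f has_vector_derivative vector_derivative f (at t)) (at t)"
  using smooth_on_differentiable[OF assms] vector_derivative_works by blast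

lemmas smooth_intros = smooth_on_const smooth_on_id smooth_on_add smooth_on_diff smooth_on_minus
  smooth_on_mult smooth_on_scaleR smooth_on_inner smooth_on_power smooth_on_divide smooth_on_nth
  smooth_on_Pair smooth_on_fst smooth_on_snd smooth_on_cross3 smooth_on_vector3 smooth_on_inverse

section \<open>Symmetry of second derivatives\<close>

lemma DERIV_along_line:
  fixes g :: "'a::real_normed_vector \<Rightarrow> real"
  assumes "smooth_on S g" "q + t *\<^sub>R u \<in> S"
  shows "((\<lambda>t. g (q + t *\<^sub>R u)) has_real_derivative frechet_derivative g (at (q + t *\<^sub>R u)) u) (at t)"
proof -
  have "((\<lambda>t. q + t *\<^sub>R u) has_derivative (\<lambda>h. h *\<^sub>R u)) (at t)"
    by (auto intro!: derivative_eq_intros)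
  from diff_chain_at[OF this smooth_on_has_derivative[OF assms]]
  show ?thesis
    using linear_scale[OF smooth_on_frechet_linear[OF assms]]
    by (simp add: has_field_derivative_def o_def mult.commute[of _ "frechet_derivative g _ u"])
qed

text \<open>The second difference over a parallelogram is symmetric in u and v. The mean value
  theorem, used in direction u and then in direction v, expresses it by one mixed derivative;
  exchanging u and v gives the other.\<close>

lemma second_difference_mvt:
  fixes g :: "'a::real_normed_vector \<Rightarrow> real"
  assumes "smooth_on S g" "0 < s"
    and S: "\<And>t t'. 0 \<le> t \<Longrightarrow> t \<le> s \<Longrightarrow> 0 \<le> t' \<Longrightarrow> t' \<le> s \<Longrightarrow> p + t *\<^sub>R u + t' *\<^sub>R v \<in> S"
  obtains x y where "0 < x" "x < s" "0 < y" "y < s"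
    "g (p + s *\<^sub>R u + s *\<^sub>R v) - g (p + s *\<^sub>R u) - g (p + s *\<^sub>R v) + g p =
      s * s * frechet_derivative (\<lambda>q. frechet_derivative g (at q) u) (at (p + x *\<^sub>R u + y *\<^sub>R v)) v"
proof -
  let ?h = "\<lambda>t. g ((p + s *\<^sub>R v) + t *\<^sub>R u) - g (p + t *\<^sub>R u)"
  let ?Dg = "\<lambda>q. frechet_derivative g (at q) u"
  have d: "(?h has_real_derivative (?Dg ((p + s *\<^sub>R v) + t *\<^sub>R u) - ?Dg (p + t *\<^sub>R u))) (at t)"
    if "0 \<le> t" "t \<le> s" for t
    using S[of t s] S[of t 0] that assms(2)
    by (intro DERIV_diff DERIV_along_line[OF assms(1)]) (auto simp: algebra_simps)
  obtain x where x: "0 < x" "x < s" "?h s - ?h 0 = (s - 0) * (?Dg ((p + s *\<^sub>R v) + x *\<^sub>R u) - ?Dg (p + x *\<^sub>R u))"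
    using MVT2[OF assms(2) d] by auto
  have d2: "((\<lambda>t. ?Dg ((p + x *\<^sub>R u) + t *\<^sub>R v)) has_real_derivative
       frechet_derivative ?Dg (at ((p + x *\<^sub>R u) + t *\<^sub>R v)) v) (at t)" if "0 \<le> t" "t \<le> s" for t
    using S[of x t] that x by (intro DERIV_along_line[OF smooth_on_frechet[OF assms(1)]]) auto
  obtain y where y: "0 < y" "y < s" "?Dg ((p + x *\<^sub>R u) + s *\<^sub>R v) - ?Dg ((p + x *\<^sub>R u) + 0 *\<^sub>R v) =
      (s - 0) * frechet_derivative ?Dg (at ((p + x *\<^sub>R u) + y *\<^sub>R v)) v"
    using MVT2[OF assms(2) d2] by auto
  have "?h s - ?h 0 = s * (s * frechet_derivative ?Dg (at ((p + x *\<^sub>R u) + y *\<^sub>R v)) v)"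
    using x(3) y(3) by (simp add: algebra_simps)
  then show ?thesis
    using that[OF x(1,2) y(1,2)] by (simp add: algebra_simps)
qed

text \<open>Both mixed derivatives, each at some point near p, equal the same second difference
  divided by s^2. By continuity they cannot differ at p by the gap 2 e.\<close>

lemma second_derivative_symmetric_real:
  fixes g :: "'a::real_normed_vector \<Rightarrow> real"
  assumes "open S" "smooth_on S g" "p \<in> S"
  shows "frechet_derivative (\<lambda>q. frechet_derivative g (at q) u) (at p) v =
    frechet_derivative (\<lambda>q. frechet_derivative g (at q) v) (at p) u" (is "?A p = ?B p")
proof (rule ccontr)
  assume ne: "?A p \<noteq> ?B p"
  define e where "e = \<bar>?A p - ?B p\<bar> / 2"
  have e: "e > 0" using ne by (simp add: e_def)
  have cA: "isCont ?A p" and cB: "isCont ?B p"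
    using smooth_on_continuous[OF smooth_on_frechet[OF smooth_on_frechet[OF assms(2)]]]
      continuous_on_eq_continuous_at[OF assms(1)] assms(3) by blast+
  obtain d1 where d1: "d1 > 0" "\<And>q. dist q p < d1 \<Longrightarrow> \<bar>?A q - ?A p\<bar> < e"
    using cA e unfolding continuous_at_eps_delta dist_real_def by blast
  obtain d2 where d2: "d2 > 0" "\<And>q. dist q p < d2 \<Longrightarrow> \<bar>?B q - ?B p\<bar> < e"
    using cB e unfolding continuous_at_eps_delta dist_real_def by blast
  obtain d3 where d3: "d3 > 0" "\<And>q. dist q p < d3 \<Longrightarrow> q \<in> S"
    using assms(1,3) open_dist by blast
  define d where "d = min d1 (min d2 d3)"
  have d: "d > 0" using d1 d2 d3 by (simp add: d_def)
  \<comment> \<open>Keeps the parallelogram spanned by s u and s v inside the ball of radius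
    \<open>d\<close>; the summand 1 covers u = v = 0.\<close>
  define s where "s = d / (norm u + norm v + 1)"
  have s: "s > 0" using d by (auto simp: s_def intro!: divide_pos_pos add_nonneg_pos)
  have sd: "s * norm u + s * norm v < d"
    unfolding s_def using d
    by (simp add: divide_simps add_nonneg_pos) (simp add: algebra_simps add_nonneg_pos)
  have near: "dist (p + t *\<^sub>R u + t' *\<^sub>R v) p < d" if "0 \<le> t" "t \<le> s" "0 \<le> t'" "t' \<le> s" for t t'
  proof -
    have "dist (p + t *\<^sub>R u + t' *\<^sub>R v) p = norm (t *\<^sub>R u + t' *\<^sub>R v)" by (simp add: dist_norm algebra_simps)
    also have "\<dots> \<le> t * norm u + t' * norm v" using that by (metis abs_of_nonneg norm_scaleR norm_triangle_ineq)
    also have "\<dots> \<le> s * norm u + s * norm v" using that by (intro add_mono mult_right_mono) auto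
    finally show ?thesis using sd by simp
  qed
  have near': "dist (p + t' *\<^sub>R v + t *\<^sub>R u) p < d" if "0 \<le> t" "t \<le> s" "0 \<le> t'" "t' \<le> s" for t t'
    using near[OF that] by (simp add: algebra_simps)
  obtain x y where xy: "0 < x" "x < s" "0 < y" "y < s"
    "g (p + s *\<^sub>R u + s *\<^sub>R v) - g (p + s *\<^sub>R u) - g (p + s *\<^sub>R v) + g p = s * s * ?A (p + x *\<^sub>R u + y *\<^sub>R v)"
    using second_difference_mvt[OF assms(2) s, of p u v] near d3 by (auto simp: d_def)
  obtain x' y' where xy': "0 < x'" "x' < s" "0 < y'" "y' < s"
    "g (p + s *\<^sub>R v + s *\<^sub>R u) - g (p + s *\<^sub>R v) - g (p + s *\<^sub>R u) + g p = s * s * ?B (p + x' *\<^sub>R v + y' *\<^sub>R u)"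
    using second_difference_mvt[OF assms(2) s, of p v u] near' d3 by (auto simp: d_def)
  have "s * s * ?A (p + x *\<^sub>R u + y *\<^sub>R v) = s * s * ?B (p + x' *\<^sub>R v + y' *\<^sub>R u)"
    using xy(5) xy'(5) by (simp add: algebra_simps)
  then have eq: "?A (p + x *\<^sub>R u + y *\<^sub>R v) = ?B (p + x' *\<^sub>R v + y' *\<^sub>R u)" using s by simp
  have "\<bar>?A (p + x *\<^sub>R u + y *\<^sub>R v) - ?A p\<bar> < e"
    using near[of x y] xy d1(2) by (simp add: d_def)
  moreover have "\<bar>?B (p + x' *\<^sub>R v + y' *\<^sub>R u) - ?B p\<bar> < e"
    using near'[of y' x'] xy' d2(2) by (simp add: d_def)
  ultimately have "\<bar>?A p - ?B p\<bar> < 2 * e" using eq by linarith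
  then show False by (simp add: e_def)
qed

lemma frechet_derivative_linear_comp:
  assumes "bounded_linear L" "f differentiable (at p)"
  shows "frechet_derivative (\<lambda>q. L (f q)) (at p) v = L (frechet_derivative f (at p) v)"
  using bounded_linear.has_derivative[OF assms(1)] assms(2) frechet_derivative_works
    frechet_derivative_at by metis

lemma frechet_derivative_cong_open:
  assumes "open S" "p \<in> S" "\<And>q. q \<in> S \<Longrightarrow> f q = g q"
  shows "frechet_derivative f (at p) = frechet_derivative g (at p)"
proof -
  have "(f has_derivative D) (at p) \<longleftrightarrow> (g has_derivative D) (at p)" for D
    using has_derivative_transform_within_open[OF _ assms(1,2), of f D UNIV g]
      has_derivative_transform_within_open[OF _ assms(1,2), of g D UNIV f] assms(3)
    by metis
  then show ?thesis unfolding frechet_derivative_def by simp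
qed

lemma second_derivative_symmetric:
  fixes f :: "'a::real_normed_vector \<Rightarrow> 'b::euclidean_space"
  assumes "open S" "smooth_on S f" "p \<in> S"
  shows "frechet_derivative (\<lambda>q. frechet_derivative f (at q) u) (at p) v =
    frechet_derivative (\<lambda>q. frechet_derivative f (at q) v) (at p) u"
proof (rule euclidean_eqI)
  fix i :: 'b assume "i \<in> Basis"
  have L: "bounded_linear (\<lambda>x::'b. x \<bullet> i)" by (rule bounded_linear_inner_left)
  have sm: "smooth_on S (\<lambda>q. f q \<bullet> i)" by (rule smooth_on_linear_comp[OF assms(1) L assms(2)])
  have *: "frechet_derivative (\<lambda>q. frechet_derivative f (at q) u) (at p) v \<bullet> i =
    frechet_derivative (\<lambda>q. frechet_derivative (\<lambda>q. f q \<bullet> i) (at q) u) (at p) v" for u v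
  proof -
    have "frechet_derivative (\<lambda>q. frechet_derivative (\<lambda>q. f q \<bullet> i) (at q) u) (at p) =
       frechet_derivative (\<lambda>q. frechet_derivative f (at q) u \<bullet> i) (at p)"
      using frechet_derivative_linear_comp[OF L smooth_on_differentiable[OF assms(2)]]
      by (intro frechet_derivative_cong_open[OF assms(1,3)]) auto
    then show ?thesis
      using frechet_derivative_linear_comp[OF L smooth_on_differentiable[OF smooth_on_frechet[OF assms(2)] assms(3)]]
      by simp
  qed
  show "frechet_derivative (\<lambda>q. frechet_derivative f (at q) u) (at p) v \<bullet> i =
    frechet_derivative (\<lambda>q. frechet_derivative f (at q) v) (at p) u \<bullet> i"
    unfolding * by (rule second_derivative_symmetric_real[OF assms(1) sm assms(3)])
qed

section \<open>Local solutions of smooth autonomous differential equations\<close>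

text \<open>Banach's fixed point theorem for the Picard operator on bounded continuous functions on
  the whole line; times are clamped to [-e, e] by \<open>c\<close>, so a solution on the small
  interval is extended by constants.\<close>

lemma picard_lindelof_lipschitz:
  fixes G :: "'a::euclidean_space \<Rightarrow> 'a"
  assumes L: "L \<ge> 0" "\<And>x y. norm (G x - G y) \<le> L * norm (x - y)"
    and B: "\<And>x. norm (G x) \<le> B"
  obtains e x where "e > 0" "x 0 = x0"
    "\<And>t. \<bar>t\<bar> < e \<Longrightarrow> (x has_vector_derivative G (x t)) (at t)"
proof -
  \<comment> \<open>The Picard operator contains two integrals over intervals of length at most 2 e,
    so its Lipschitz constant is 4 e L, here at most 1/2.\<close>
  define e where "e = 1 / (8 * (L + 1))"
  have e: "e > 0" "4 * e * L \<le> 1 / 2" using L(1) by (auto simp: e_def field_simps)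
  define c where "c t = max (-e) (min e t)" for t
  have c: "-e \<le> c t" "c t \<le> e" for t using e by (auto simp: c_def)
  have cc: "continuous_on UNIV c" unfolding c_def by (intro continuous_intros)
  have G: "continuous_on UNIV G"
    using L(2) by (intro lipschitz_on_continuous_on[of L]) (auto simp: lipschitz_on_def dist_norm L(1))
  \<comment> \<open>Integration starts at -e so that times of both signs are covered; the initial
    value at 0 is restored in \<open>P\<close> by subtracting \<open>J x 0\<close>.\<close>
  define J where "J x s = integral {-e..s} (\<lambda>s. G (x s))" for x :: "real \<Rightarrow> 'a" and s
  have int: "(\<lambda>s. G (x s)) integrable_on {-e..s}" if "continuous_on UNIV x" for x s
    by (intro integrable_continuous_real continuous_on_compose2[OF G] continuous_on_subset[OF that]) auto
  have Jc: "continuous_on {-e..e} (J x)" if "continuous_on UNIV x" for x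
    unfolding J_def by (intro indefinite_integral_continuous_1 int[OF that])
  have Jb: "norm (J x s) \<le> 2 * e * B" if "continuous_on UNIV x" "-e \<le> s" "s \<le> e" for x s
  proof -
    have "norm (J x s) \<le> B * (s - (-e))"
      unfolding J_def using that B
      by (intro integral_bound continuous_on_compose2[OF G] continuous_on_subset[OF that(1)]) auto
    also have "\<dots> \<le> B * (2 * e)"
      using that B[of 0] by (intro mult_left_mono) (auto intro: order_trans[OF norm_ge_zero])
    finally show ?thesis by (simp add: algebra_simps)
  qed
  have Jd: "norm (J x s - J y s) \<le> 2 * e * L * d"
    if "continuous_on UNIV x" "continuous_on UNIV y" "-e \<le> s" "s \<le> e" "\<And>t. dist (x t) (y t) \<le> d" for x y s d
  proof -
    have d: "d \<ge> 0" using that(5)[of 0] by (meson dist_le_zero_iff linear order_trans zero_le_dist)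
    have "norm (J x s - J y s) = norm (integral {-e..s} (\<lambda>s. G (x s) - G (y s)))"
      unfolding J_def using int that by (simp add: integral_diff)
    also have "\<dots> \<le> (L * d) * (s - (-e))"
    proof (rule integral_bound)
      show "continuous_on {-e..s} (\<lambda>s. G (x s) - G (y s))"
        by (intro continuous_intros continuous_on_compose2[OF G] continuous_on_subset[OF that(1)]
            continuous_on_subset[OF that(2)]) auto
      show "norm (G (x t) - G (y t)) \<le> L * d" for t
        using L(2)[of "x t" "y t"] mult_left_mono[OF that(5)[of t] L(1)] by (simp add: dist_norm)
    qed (use that in auto)
    also have "\<dots> \<le> (L * d) * (2 * e)"
      using that d L by (intro mult_left_mono) auto
    finally show ?thesis by (simp add: algebra_simps)
  qed
  define P :: "(real \<Rightarrow> 'a) \<Rightarrow> real \<Rightarrow> 'a" where "P x t = x0 + J x (c t) - J x 0" for x t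
  have Pb: "P x \<in> bcontfun" if "continuous_on UNIV x" for x
  proof -
    have "continuous_on UNIV (P x)"
      unfolding P_def by (intro continuous_intros continuous_on_compose2[OF Jc[OF that] cc]) (use c in auto)
    moreover have "norm (P x t) \<le> norm x0 + 2 * e * B + 2 * e * B" for t
      unfolding P_def using Jb[OF that, of "c t"] Jb[OF that, of 0] c[of t] e
      by (intro norm_triangle_le_diff norm_triangle_le add_mono) auto
    ultimately show ?thesis by (auto simp: bcontfun_def bounded_iff)
  qed
  define Q :: "(real \<Rightarrow>\<^sub>C 'a) \<Rightarrow> (real \<Rightarrow>\<^sub>C 'a)" where "Q x = Bcontfun (P (apply_bcontfun x))" for x
  have cont: "continuous_on UNIV (apply_bcontfun x)" for x :: "real \<Rightarrow>\<^sub>C 'a" by (rule continuous_on_apply_bcontfun)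
  have Q: "apply_bcontfun (Q x) = P (apply_bcontfun x)" for x
    unfolding Q_def by (rule Bcontfun_inverse[OF Pb[OF cont]])
  have "dist (Q x) (Q y) \<le> 1 / 2 * dist x y" for x y
  proof (rule dist_bound)
    fix t
    have "dist (apply_bcontfun (Q x) t) (apply_bcontfun (Q y) t) =
        norm ((J x (c t) - J y (c t)) - (J x 0 - J y 0))"
      unfolding Q by (simp add: P_def dist_norm algebra_simps)
    also have "\<dots> \<le> 2 * e * L * dist x y + 2 * e * L * dist x y"
      using c[of t] e by (intro norm_triangle_le_diff add_mono Jd cont dist_bounded) auto
    also have "\<dots> = (4 * e * L) * dist x y" by (simp add: algebra_simps)
    also have "\<dots> \<le> 1 / 2 * dist x y" using e by (intro mult_right_mono) auto
    finally show "dist (apply_bcontfun (Q x) t) (apply_bcontfun (Q y) t) \<le> 1 / 2 * dist x y" .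
  qed
  then obtain x where "Q x = x"
    using banach_fix_type[of "1/2" Q] by auto
  then have x: "apply_bcontfun x t = P (apply_bcontfun x) t" for t using Q by metis
  have "apply_bcontfun x 0 = x0"
    using x[of 0] e by (simp add: P_def c_def)
  moreover have "(apply_bcontfun x has_vector_derivative G (apply_bcontfun x t)) (at t)" if "\<bar>t\<bar> < e" for t
  proof -
    have "(J x has_vector_derivative G (apply_bcontfun x t)) (at t within {-e..e})"
      unfolding J_def[abs_def] using that
      by (intro integral_has_vector_derivative continuous_on_compose2[OF G] continuous_on_subset[OF cont]) auto
    moreover have "at t within {-e..e} = at t"
      using that by (intro at_within_interior) (auto simp: interior_atLeastAtMost_real)
    ultimately have d: "((\<lambda>t. x0 + J x t - J x 0) has_vector_derivative G (apply_bcontfun x t)) (at t)"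
      by (auto intro!: derivative_eq_intros)
    have eq: "x0 + J x s - J x 0 = apply_bcontfun x s" if "s \<in> {-e<..<e}" for s
      using that by (subst x) (auto simp: P_def c_def)
    show ?thesis
      unfolding has_vector_derivative_def
      by (rule has_derivative_transform_within_open[OF d[unfolded has_vector_derivative_def], of "{-e<..<e}"])
        (use that eq in auto)
  qed
  ultimately show ?thesis using that e by blast
qed

text \<open>Compactness of the ball bounds the finitely many partial derivatives, and convexity
  turns the resulting bound on the derivative into a Lipschitz constant.\<close>

lemma smooth_on_lipschitz_cball:
  fixes G :: "'a::euclidean_space \<Rightarrow> 'b::real_normed_vector"
  assumes "smooth_on S G" "cball x0 r \<subseteq> S"
  obtains L where "L \<ge> 0" "\<And>x y. x \<in> cball x0 r \<Longrightarrow> y \<in> cball x0 r \<Longrightarrow> norm (G x - G y) \<le> L * norm (x - y)"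
proof -
  let ?K = "cball x0 r"
  have "\<exists>M. \<forall>x\<in>?K. norm (frechet_derivative G (at x) i) \<le> M" for i
  proof -
    have "compact ((\<lambda>x. frechet_derivative G (at x) i) ` ?K)"
      using smooth_on_continuous[OF smooth_on_frechet[OF assms(1)]] assms(2)
      by (intro compact_continuous_image) (auto intro: continuous_on_subset)
    from compact_imp_bounded[OF this] show ?thesis unfolding bounded_iff by blast
  qed
  then obtain M where M: "\<And>i x. x \<in> ?K \<Longrightarrow> norm (frechet_derivative G (at x) i) \<le> M i" by metis
  define L where "L = (\<Sum>i\<in>Basis. \<bar>M i\<bar>)"
  have "norm (G x - G y) \<le> L * norm (x - y)" if "x \<in> ?K" "y \<in> ?K" for x y
  proof (rule differentiable_bound[of ?K G "\<lambda>x. frechet_derivative G (at x)"])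
    show "(G has_derivative frechet_derivative G (at x)) (at x within ?K)" if "x \<in> ?K" for x
      using smooth_on_has_derivative[OF assms(1)] that assms(2) has_derivative_at_withinI by blast
    show "onorm (frechet_derivative G (at x)) \<le> L" if x: "x \<in> ?K" for x
    proof (rule onorm_le)
      fix v
      have "frechet_derivative G (at x) v = (\<Sum>i\<in>Basis. (v \<bullet> i) *\<^sub>R frechet_derivative G (at x) i)"
        using x assms by (intro linear_expand smooth_on_frechet_linear[of S]) auto
      also have "norm \<dots> \<le> (\<Sum>i\<in>Basis. norm v * \<bar>M i\<bar>)"
      proof (rule sum_norm_le)
        fix i :: 'a assume "i \<in> Basis"
        then have "\<bar>v \<bullet> i\<bar> \<le> norm v" by (rule Basis_le_norm)
        then show "norm ((v \<bullet> i) *\<^sub>R frechet_derivative G (at x) i) \<le> norm v * \<bar>M i\<bar>"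
          using M[OF x, of i] by (auto intro!: mult_mono)
      qed
      finally show "norm (frechet_derivative G (at x) v) \<le> L * norm v"
        by (simp add: L_def sum_distrib_left[symmetric] mult.commute)
    qed
  qed (use that in auto)
  moreover have "L \<ge> 0" by (simp add: L_def sum_nonneg)
  ultimately show ?thesis using that by blast
qed

text \<open>Composing G with the nearest-point map of a closed ball around x0 makes it bounded and
  globally Lipschitz without changing it on the ball, and for short times the solution does not
  leave the ball.\<close>

lemma smooth_ode_exists:
  fixes G :: "'a::euclidean_space \<Rightarrow> 'a"
  assumes "open S" "smooth_on S G" "x0 \<in> S"
  obtains e x where "e > 0" "x 0 = x0" "smooth_on {-e<..<e} x" "x ` {-e<..<e} \<subseteq> S"
    "\<And>t. \<bar>t\<bar> < e \<Longrightarrow> (x has_vector_derivative G (x t)) (at t)"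
proof -
  obtain r where r: "r > 0" "cball x0 r \<subseteq> S" using assms(1,3) open_contains_cball by blast
  obtain L where L: "L \<ge> 0" "\<And>x y. x \<in> cball x0 r \<Longrightarrow> y \<in> cball x0 r \<Longrightarrow> norm (G x - G y) \<le> L * norm (x - y)"
    using smooth_on_lipschitz_cball[OF assms(2) r(2)] by blast
  define pr where "pr = closest_point (cball x0 r)"
  have pr: "pr x \<in> cball x0 r" for x
    unfolding pr_def using r by (intro closest_point_in_set) auto
  have prl: "norm (pr x - pr y) \<le> norm (x - y)" for x y
    using closest_point_lipschitz[of "cball x0 r" x y] r unfolding pr_def dist_norm by auto
  have "compact (G ` cball x0 r)"
    using smooth_on_continuous[OF assms(2)] r by (intro compact_continuous_image) (auto intro: continuous_on_subset)
  from compact_imp_bounded[OF this] obtain B where B: "\<And>x. x \<in> cball x0 r \<Longrightarrow> norm (G x) \<le> B"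
    unfolding bounded_iff by blast
  have lip: "norm (G (pr x) - G (pr y)) \<le> L * norm (x - y)" for x y
    using L(2)[OF pr pr, of x y] mult_left_mono[OF prl[of x y] L(1)] by simp
  obtain e x where x: "e > 0" "x 0 = x0"
    "\<And>t. \<bar>t\<bar> < e \<Longrightarrow> (x has_vector_derivative G (pr (x t))) (at t)"
    by (rule picard_lindelof_lipschitz[of L "\<lambda>x. G (pr x)" B x0, OF L(1) lip B[OF pr]]) blast
  have "isCont x 0" using x by (metis abs_zero has_vector_derivative_continuous)
  then obtain d where d: "d > 0" "\<And>t. \<bar>t\<bar> < d \<Longrightarrow> dist (x t) x0 < r"
    using r(1) x(2) unfolding continuous_at_eps_delta dist_real_def by auto
  define f where "f = min d e"
  have f: "f > 0" using x d by (simp add: f_def)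
  have in_ball: "x t \<in> cball x0 r" if "\<bar>t\<bar> < f" for t
    using d(2)[of t] that by (simp add: f_def dist_commute less_imp_le)
  have ode: "(x has_vector_derivative G (x t)) (at t)" if "\<bar>t\<bar> < f" for t
  proof -
    have "pr (x t) = x t" unfolding pr_def by (rule closest_point_self[OF in_ball[OF that]])
    then show ?thesis using x(3)[of t] that by (simp add: f_def)
  qed
  let ?I = "{-f<..<f}"
  have sub: "x ` ?I \<subseteq> S" using in_ball r by fastforce
  \<comment> \<open>Bootstrapping: x' = G(x) is as regular as x, so x gains one derivative in each
    step.\<close>
  have "C_k_on n ?I x" for n
  proof (induction n)
    case 0
    have "isCont x t" if "\<bar>t\<bar> < f" for t
      using has_vector_derivative_continuous[OF ode[OF that]] .
    then show ?case by (auto intro!: continuous_at_imp_continuous_on)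
  next
    case (Suc n)
    have "C_k_on n ?I (\<lambda>t. G (x t))"
      using assms(2) by (intro C_k_on_compose[OF _ assms(1) sub Suc]) (auto simp: smooth_on_def)
    then have "C_k_on n ?I (\<lambda>t. v *\<^sub>R G (x t))" for v :: real
      by (intro C_k_on_linear_comp[OF _ bounded_linear_scaleR_right]) auto
    then show ?case
      using ode by (intro C_k_on_SucI[where D="\<lambda>t v. v *\<^sub>R G (x t)"])
        (auto simp: has_vector_derivative_def)
  qed
  then show ?thesis using that[OF f x(2) _ sub] ode by (auto simp: smooth_on_def)
qed

section \<open>The orthonormal coframe of a Bianchi-Cartan-Vranceanu space\<close>

text \<open>The frame components of \<open>E3\<close>, the same at every point.\<close>

abbreviation E0 :: "real^3" where "E0 \<equiv> axis 3 1"

definition coframe :: "real \<Rightarrow> real \<Rightarrow> real^3 \<Rightarrow> real^3 \<Rightarrow> real^3" where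
  "coframe a b p v = vector [v $ 1 / bcv_lambda a p, v $ 2 / bcv_lambda a p, bcv_form a b p v]"

definition frame_inv :: "real \<Rightarrow> real \<Rightarrow> real^3 \<Rightarrow> real^3 \<Rightarrow> real^3" where
  "frame_inv a b p V = vector [bcv_lambda a p * V $ 1, bcv_lambda a p * V $ 2,
     V $ 3 - b / 2 * (p $ 2 * V $ 1 - p $ 1 * V $ 2)]"

text \<open>The derivative of \<open>coframe a b p v\<close> in the base point p, in direction u
  with v fixed; \<open>dl\<close> is the derivative of the conformal factor.\<close>

definition coframe_deriv :: "real \<Rightarrow> real \<Rightarrow> real^3 \<Rightarrow> real^3 \<Rightarrow> real^3 \<Rightarrow> real^3" where
  "coframe_deriv a b p u v = (let l = bcv_lambda a p; dl = 2 * a * (p $ 1 * u $ 1 + p $ 2 * u $ 2) in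
     vector [- (v $ 1 * dl) / l\<^sup>2, - (v $ 2 * dl) / l\<^sup>2,
       b / 2 * ((u $ 2 * v $ 1 - u $ 1 * v $ 2) / l - (p $ 2 * v $ 1 - p $ 1 * v $ 2) * dl / l\<^sup>2)])"

text \<open>In coframe components the Levi-Civita derivative of \<open>V\<close> in direction \<open>U\<close> is
  \<open>V' + W(U) \<times> V\<close>, where \<open>W(U)\<close> is the vector below.\<close>

definition conn_vec :: "real \<Rightarrow> real \<Rightarrow> real^3 \<Rightarrow> real^3 \<Rightarrow> real^3" where
  "conn_vec a b p U = (b / 2) *\<^sub>R U + (2 * a * (p $ 2 * U $ 1 - p $ 1 * U $ 2) - b * U $ 3) *\<^sub>R axis 3 1"

text \<open>The symmetric operator \<open>S\<close> with \<open>R(X, Y)Z = Z \<times> S(X \<times> Y)\<close>.\<close>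

definition curvature_map :: "real \<Rightarrow> real \<Rightarrow> real^3 \<Rightarrow> real^3" where
  "curvature_map a b Z = (b\<^sup>2 / 4) *\<^sub>R Z + ((4 * a - b\<^sup>2) * Z $ 3) *\<^sub>R axis 3 1"

lemma coframe_nth [simp]:
  "coframe a b p v $ 1 = v $ 1 / bcv_lambda a p"
  "coframe a b p v $ 2 = v $ 2 / bcv_lambda a p"
  "coframe a b p v $ 3 = bcv_form a b p v"
  by (simp_all add: coframe_def)

lemma frame_inv_nth [simp]:
  "frame_inv a b p v $ 1 = bcv_lambda a p * v $ 1"
  "frame_inv a b p v $ 2 = bcv_lambda a p * v $ 2"
  "frame_inv a b p V $ 3 = V $ 3 - b / 2 * (p $ 2 * V $ 1 - p $ 1 * V $ 2)"
  by (simp_all add: frame_inv_def)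

lemma conn_vec_nth [simp]:
  "conn_vec a b p U $ 1 = b / 2 * U $ 1"
  "conn_vec a b p U $ 2 = b / 2 * U $ 2"
  "conn_vec a b p U $ 3 = 2 * a * (p $ 2 * U $ 1 - p $ 1 * U $ 2) - b / 2 * U $ 3"
  by (simp_all add: conn_vec_def axis_def)

lemma curvature_map_nth [simp]:
  "curvature_map a b U $ 1 = b\<^sup>2 / 4 * U $ 1"
  "curvature_map a b U $ 2 = b\<^sup>2 / 4 * U $ 2"
  "curvature_map a b U $ 3 = (4 * a - 3 / 4 * b\<^sup>2) * U $ 3"
  by (simp_all add: curvature_map_def axis_def algebra_simps)

lemma coframe_deriv_nth [simp]:
  "coframe_deriv a b p u v $ 1 = - (v $ 1 * (2 * a * (p $ 1 * u $ 1 + p $ 2 * u $ 2))) / (bcv_lambda a p)\<^sup>2"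
  "coframe_deriv a b p u v $ 2 = - (v $ 2 * (2 * a * (p $ 1 * u $ 1 + p $ 2 * u $ 2))) / (bcv_lambda a p)\<^sup>2"
  "coframe_deriv a b p u v $ 3 = b / 2 * ((u $ 2 * v $ 1 - u $ 1 * v $ 2) / bcv_lambda a p
     - (p $ 2 * v $ 1 - p $ 1 * v $ 2) * (2 * a * (p $ 1 * u $ 1 + p $ 2 * u $ 2)) / (bcv_lambda a p)\<^sup>2)"
  by (simp_all add: coframe_deriv_def Let_def)

lemma inner_real3: "(u :: real^3) \<bullet> v = u $ 1 * v $ 1 + u $ 2 * v $ 2 + u $ 3 * v $ 3"
  by (simp add: inner_vec_def sum_3)

lemma cross3_nth:
  "cross3 u v $ 1 = u $ 2 * v $ 3 - u $ 3 * v $ 2"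
  "cross3 u v $ 2 = u $ 3 * v $ 1 - u $ 1 * v $ 3"
  "cross3 u v $ 3 = u $ 1 * v $ 2 - u $ 2 * v $ 1"
  by (simp_all add: cross3_def)

lemma real3_eqI: "u $ 1 = v $ 1 \<Longrightarrow> u $ 2 = v $ 2 \<Longrightarrow> u $ 3 = v $ 3 \<Longrightarrow> u = (v :: real^3)"
  by (simp add: vec_eq_iff forall_3)

lemma bcv_metric_frame: "bcv_metric a b p v w = coframe a b p v \<bullet> coframe a b p w"
  by (simp add: bcv_metric_def inner_real3 power2_eq_square add_divide_distrib)

lemma linear_coframe: "linear (coframe a b p)"
  by (rule linearI; rule real3_eqI) (auto simp: add_divide_distrib diff_divide_distrib bcv_form_def algebra_simps)

lemma coframe_frame_inv:
  assumes "p \<in> bcv_space a b" shows "coframe a b p (frame_inv a b p V) = V"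
  using assms by (intro real3_eqI) (auto simp: bcv_space_def bcv_form_def field_simps)

lemma frame_inv_coframe:
  assumes "p \<in> bcv_space a b" shows "frame_inv a b p (coframe a b p v) = v"
  using assms by (intro real3_eqI) (auto simp: bcv_space_def bcv_form_def divide_simps)

lemma coframe_eq_iff: "p \<in> bcv_space a b \<Longrightarrow> coframe a b p v = coframe a b p w \<longleftrightarrow> v = w"
  by (metis frame_inv_coframe)

lemma open_bcv_space: "open (bcv_space a b)"
  unfolding bcv_space_def bcv_lambda_def by (intro open_Collect_less continuous_intros)

text \<open>Cartan's first structure equation: the exterior derivative of the coframe is balanced by
  the connection, that is, the torsion vanishes. With the skewness of the cross product this singles
  out \<open>conn_vec\<close>.\<close>

lemma coframe_torsion:
  assumes "p \<in> bcv_space a b"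
  shows "coframe_deriv a b p u v - coframe_deriv a b p v u =
    cross3 (conn_vec a b p (coframe a b p v)) (coframe a b p u) -
    cross3 (conn_vec a b p (coframe a b p u)) (coframe a b p v)"
proof -
  define l where "l = bcv_lambda a p"
  have l: "l \<noteq> 0" "bcv_lambda a p = l" using assms by (auto simp: bcv_space_def l_def)
  have l2: "l = 1 + a * ((p $ 1)\<^sup>2 + (p $ 2)\<^sup>2)" by (simp add: l_def bcv_lambda_def)
  show ?thesis
    apply (rule real3_eqI)
      apply (simp_all add: cross3_nth bcv_form_def l(2))
      apply (simp_all add: l(1) divide_simps)
      apply (simp_all add: l2 power2_eq_square algebra_simps)
    done
qed

lemma has_derivative_coframe:
  assumes "p \<in> bcv_space a b" "(f has_derivative f') (at x)" "(V has_derivative V') (at x)" "f x = p"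
  shows "((\<lambda>y. coframe a b (f y) (V y)) has_derivative
    (\<lambda>h. coframe_deriv a b p (f' h) (V x) + coframe a b p (V' h))) (at x)"
proof -
  have l: "bcv_lambda a (f x) \<noteq> 0" using assms(1,4) by (auto simp: bcv_space_def)
  have f: "((\<lambda>y. f y $ i) has_derivative (\<lambda>h. f' h $ i)) (at x)" for i
    using bounded_linear.has_derivative[OF bounded_linear_vec_nth assms(2)] .
  have V: "((\<lambda>y. V y $ i) has_derivative (\<lambda>h. V' h $ i)) (at x)" for i
    using bounded_linear.has_derivative[OF bounded_linear_vec_nth assms(3)] .
  have lam: "((\<lambda>y. bcv_lambda a (f y)) has_derivative (\<lambda>h. 2 * a * (f x $ 1 * f' h $ 1 + f x $ 2 * f' h $ 2))) (at x)"
    unfolding bcv_lambda_def power2_eq_square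
    by (auto intro!: derivative_eq_intros f simp: algebra_simps)
  have 1: "((\<lambda>y. V y $ i / bcv_lambda a (f y)) has_derivative
      (\<lambda>h. - (V x $ i * (2 * a * (f x $ 1 * f' h $ 1 + f x $ 2 * f' h $ 2))) / (bcv_lambda a (f x))\<^sup>2
          + V' h $ i / bcv_lambda a (f x))) (at x)" for i
    using l by (auto intro!: derivative_eq_intros V lam simp: divide_simps power2_eq_square)
  have 3: "((\<lambda>y. bcv_form a b (f y) (V y)) has_derivative
     (\<lambda>h. coframe_deriv a b (f x) (f' h) (V x) $ 3 + bcv_form a b (f x) (V' h))) (at x)"
    unfolding bcv_form_def coframe_deriv_nth
    apply (rule derivative_eq_intros f V lam l refl)+
    using l by (simp add: fun_eq_iff field_simps power2_eq_square)
  have "((\<lambda>y. (V y $ 1 / bcv_lambda a (f y)) *\<^sub>R axis 1 1 + (V y $ 2 / bcv_lambda a (f y)) *\<^sub>R axis 2 1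
       + bcv_form a b (f y) (V y) *\<^sub>R axis 3 1 :: real^3) has_derivative
     (\<lambda>h. (- (V x $ 1 * (2 * a * (f x $ 1 * f' h $ 1 + f x $ 2 * f' h $ 2))) / (bcv_lambda a (f x))\<^sup>2
          + V' h $ 1 / bcv_lambda a (f x)) *\<^sub>R axis 1 1
       + (- (V x $ 2 * (2 * a * (f x $ 1 * f' h $ 1 + f x $ 2 * f' h $ 2))) / (bcv_lambda a (f x))\<^sup>2
          + V' h $ 2 / bcv_lambda a (f x)) *\<^sub>R axis 2 1
       + (coframe_deriv a b (f x) (f' h) (V x) $ 3 + bcv_form a b (f x) (V' h)) *\<^sub>R axis 3 1)) (at x)"
    by (intro has_derivative_add bounded_linear.has_derivative[OF bounded_linear_scaleR_left] 1 3)
  moreover have "(\<lambda>y. (V y $ 1 / bcv_lambda a (f y)) *\<^sub>R axis 1 1 + (V y $ 2 / bcv_lambda a (f y)) *\<^sub>R axis 2 1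
       + bcv_form a b (f y) (V y) *\<^sub>R axis 3 1 :: real^3) = (\<lambda>y. coframe a b (f y) (V y))"
    by (intro ext real3_eqI) (auto simp: axis_def)
  moreover have "(\<lambda>h. (- (V x $ 1 * (2 * a * (f x $ 1 * f' h $ 1 + f x $ 2 * f' h $ 2))) / (bcv_lambda a (f x))\<^sup>2
          + V' h $ 1 / bcv_lambda a (f x)) *\<^sub>R axis 1 1
       + (- (V x $ 2 * (2 * a * (f x $ 1 * f' h $ 1 + f x $ 2 * f' h $ 2))) / (bcv_lambda a (f x))\<^sup>2
          + V' h $ 2 / bcv_lambda a (f x)) *\<^sub>R axis 2 1
       + (coframe_deriv a b (f x) (f' h) (V x) $ 3 + bcv_form a b (f x) (V' h)) *\<^sub>R axis 3 1 :: real^3) =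
     (\<lambda>h. coframe_deriv a b p (f' h) (V x) + coframe a b p (V' h))"
    by (intro ext real3_eqI) (auto simp: axis_def assms(4))
  ultimately show ?thesis by simp
qed

lemma coframe_has_derivative:
  assumes "p \<in> bcv_space a b"
  shows "((\<lambda>q. coframe a b q v) has_derivative (\<lambda>u. coframe_deriv a b p u v)) (at p)"
  using has_derivative_coframe[OF assms has_derivative_ident has_derivative_const[of v] refl]
  by (simp add: linear_0[OF linear_coframe])

text \<open>\<open>christoffel\<close> is a definite description; the second hypothesis is the
  nondegeneracy that makes its value unique.\<close>

lemma christoffel_eqI:
  assumes "\<And>z. 2 * g p w z = metric_deriv g p u v z + metric_deriv g p v u z - metric_deriv g p z u v"
    and "\<And>w'. (\<And>z. g p w' z = g p w z) \<Longrightarrow> w' = w"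
  shows "christoffel g p u v = w"
  unfolding christoffel_def
proof (rule the_equality)
  fix w' assume "\<forall>z. 2 * g p w' z = metric_deriv g p u v z + metric_deriv g p v u z - metric_deriv g p z u v"
  then show "w' = w" using assms(1) by (intro assms(2)) (metis mult_left_cancel zero_neq_numeral)
qed (use assms(1) in simp)

lemma metric_deriv_bcv:
  assumes "p \<in> bcv_space a b"
  shows "metric_deriv (bcv_metric a b) p u v w =
    coframe_deriv a b p u v \<bullet> coframe a b p w + coframe a b p v \<bullet> coframe_deriv a b p u w"
proof -
  have "((\<lambda>q. coframe a b q v \<bullet> coframe a b q w) has_derivative
    (\<lambda>u. coframe a b p v \<bullet> coframe_deriv a b p u w + coframe_deriv a b p u v \<bullet> coframe a b p w)) (at p)"
    using assms by (intro has_derivative_inner coframe_has_derivative)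
  then have "((\<lambda>q. bcv_metric a b q v w) has_derivative
    (\<lambda>u. coframe a b p v \<bullet> coframe_deriv a b p u w + coframe_deriv a b p u v \<bullet> coframe a b p w)) (at p)"
    by (simp only: bcv_metric_frame)
  from frechet_derivative_at[OF this, symmetric] show ?thesis by (simp add: metric_deriv_def)
qed

text \<open>Torsion-freeness brings the coframe derivatives in the Koszul formula into one order of
  arguments, so that they cancel in pairs; what remains is twice the claimed vector, paired with
  z.\<close>

lemma coframe_christoffel:
  assumes "p \<in> bcv_space a b"
  shows "coframe a b p (christoffel (bcv_metric a b) p u v) =
    coframe_deriv a b p u v + cross3 (conn_vec a b p (coframe a b p u)) (coframe a b p v)"
proof -
  define w where "w = frame_inv a b p (coframe_deriv a b p u v +
      cross3 (conn_vec a b p (coframe a b p u)) (coframe a b p v))"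
  have w: "coframe a b p w = coframe_deriv a b p u v +
      cross3 (conn_vec a b p (coframe a b p u)) (coframe a b p v)"
    by (simp add: w_def coframe_frame_inv[OF assms])
  have "christoffel (bcv_metric a b) p u v = w"
  proof (rule christoffel_eqI)
    fix z
    have "coframe_deriv a b p v u = coframe_deriv a b p u v -
        (cross3 (conn_vec a b p (coframe a b p v)) (coframe a b p u) -
         cross3 (conn_vec a b p (coframe a b p u)) (coframe a b p v))"
     and "coframe_deriv a b p z u = coframe_deriv a b p u z -
        (cross3 (conn_vec a b p (coframe a b p z)) (coframe a b p u) -
         cross3 (conn_vec a b p (coframe a b p u)) (coframe a b p z))"
     and "coframe_deriv a b p z v = coframe_deriv a b p v z -
        (cross3 (conn_vec a b p (coframe a b p z)) (coframe a b p v) -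
         cross3 (conn_vec a b p (coframe a b p v)) (coframe a b p z))"
      using coframe_torsion[OF assms, of u v] coframe_torsion[OF assms, of u z]
        coframe_torsion[OF assms, of v z] by (simp_all add: algebra_simps)
    then show "2 * bcv_metric a b p w z = metric_deriv (bcv_metric a b) p u v z
        + metric_deriv (bcv_metric a b) p v u z - metric_deriv (bcv_metric a b) p z u v"
      unfolding metric_deriv_bcv[OF assms] bcv_metric_frame w
      by (simp only: inner_real3 cross3_nth conn_vec_nth vector_add_component vector_minus_component)
        (simp add: algebra_simps)
  next
    fix w' assume "\<And>z. bcv_metric a b p w' z = bcv_metric a b p w z"
    then have "coframe a b p w' \<bullet> Z = coframe a b p w \<bullet> Z" for Z
      unfolding bcv_metric_frame by (metis coframe_frame_inv[OF assms])
    then have "coframe a b p w' = coframe a b p w" by (metis vector_eq_rdot)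
    then show "w' = w" by (simp add: coframe_eq_iff[OF assms])
  qed
  then show ?thesis by (simp add: w)
qed

lemma christoffel_frame_inv:
  assumes "p \<in> bcv_space a b"
  shows "christoffel (bcv_metric a b) p u v = frame_inv a b p (coframe_deriv a b p u v +
    cross3 (conn_vec a b p (coframe a b p u)) (coframe a b p v))"
  using coframe_christoffel[OF assms] frame_inv_coframe[OF assms] by metis

lemma linear_coframe_deriv:
  assumes "p \<in> bcv_space a b"
  shows "linear (\<lambda>u. coframe_deriv a b p u v)"
  using coframe_has_derivative[OF assms] has_derivative_linear by blast

lemma smooth_on_bcv_lambda: "open S \<Longrightarrow> smooth_on S f \<Longrightarrow> smooth_on S (\<lambda>x. bcv_lambda a (f x))"
  unfolding bcv_lambda_def by (intro smooth_intros)

lemma smooth_on_coframe: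
  assumes "open S" "smooth_on S f" "smooth_on S V" "f ` S \<subseteq> bcv_space a b"
  shows "smooth_on S (\<lambda>x. coframe a b (f x) (V x))"
  unfolding coframe_def bcv_form_def using assms
  by (intro smooth_intros smooth_on_bcv_lambda) (auto simp: bcv_space_def)

lemma smooth_on_frame_inv:
  assumes "open S" "smooth_on S f" "smooth_on S V" "f ` S \<subseteq> bcv_space a b"
  shows "smooth_on S (\<lambda>x. frame_inv a b (f x) (V x))"
  unfolding frame_inv_def using assms
  by (intro smooth_intros smooth_on_bcv_lambda)

lemma smooth_on_conn_vec:
  assumes "open S" "smooth_on S f" "smooth_on S V"
  shows "smooth_on S (\<lambda>x. conn_vec a b (f x) (V x))"
  unfolding conn_vec_def using assms by (intro smooth_intros)

lemma smooth_on_coframe_deriv: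
  assumes "open S" "smooth_on S f" "smooth_on S U" "smooth_on S V" "f ` S \<subseteq> bcv_space a b"
  shows "smooth_on S (\<lambda>x. coframe_deriv a b (f x) (U x) (V x))"
  unfolding coframe_deriv_def Let_def using assms
  by (intro smooth_intros smooth_on_bcv_lambda) (auto simp: bcv_space_def)

section \<open>The curvature tensor\<close>

lemma conn_vec_linear: "linear (conn_vec a b p)"
  by (rule linearI; rule real3_eqI) (auto simp: algebra_simps)

text \<open>The derivative of \<open>conn_vec\<close> in its base point, in the coordinate direction
  u, with the frame components U held fixed.\<close>

definition conn_vec_deriv :: "real \<Rightarrow> real \<Rightarrow> real^3 \<Rightarrow> real^3 \<Rightarrow> real^3" where
  "conn_vec_deriv a b u U = (2 * a * (u $ 2 * U $ 1 - u $ 1 * U $ 2)) *\<^sub>R axis 3 1"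

lemma has_derivative_conn_vec:
  assumes "(f has_derivative f') (at x)" "(V has_derivative V') (at x)"
  shows "((\<lambda>y. conn_vec a b (f y) (V y)) has_derivative
    (\<lambda>h. conn_vec_deriv a b (f' h) (V x) + conn_vec a b (f x) (V' h))) (at x)"
proof -
  have f: "((\<lambda>y. f y $ i) has_derivative (\<lambda>h. f' h $ i)) (at x)" for i
    using bounded_linear.has_derivative[OF bounded_linear_vec_nth assms(1)] .
  have V: "((\<lambda>y. V y $ i) has_derivative (\<lambda>h. V' h $ i)) (at x)" for i
    using bounded_linear.has_derivative[OF bounded_linear_vec_nth assms(2)] .
  have d: "((\<lambda>y. 2 * a * (f y $ 2 * V y $ 1 - f y $ 1 * V y $ 2) - b * V y $ 3) has_derivative
    (\<lambda>h. 2 * a * (f' h $ 2 * V x $ 1 - f' h $ 1 * V x $ 2) +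
         (2 * a * (f x $ 2 * V' h $ 1 - f x $ 1 * V' h $ 2) - b * V' h $ 3))) (at x)"
    by (rule derivative_eq_intros f V refl)+ (simp add: fun_eq_iff algebra_simps)
  show ?thesis
    unfolding conn_vec_def conn_vec_deriv_def
    by (rule has_derivative_eq_rhs[OF has_derivative_add[OF
            bounded_linear.has_derivative[OF bounded_linear_scaleR_right assms(2)]
            bounded_linear.has_derivative[OF bounded_linear_scaleR_left d]]])
      (simp add: fun_eq_iff algebra_simps)
qed

lemma cross3_has_derivative:
  assumes "(f has_derivative f') (at x)" "(g has_derivative g') (at x)"
  shows "((\<lambda>y. cross3 (f y) (g y)) has_derivative (\<lambda>h. cross3 (f x) (g' h) + cross3 (f' h) (g x))) (at x)"
  using bounded_bilinear.FDERIV[OF bounded_bilinear_cross3 assms] .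

lemma nabla_const:
  "nabla g (\<lambda>_. u) Y = (\<lambda>p. frechet_derivative Y (at p) u + christoffel g p u (Y p))"
  by (simp add: nabla_def)

lemma frechet_derivative_const_fun [simp]: "frechet_derivative (\<lambda>_. c) (at p) = (\<lambda>_. 0)"
  by (rule frechet_derivative_at[symmetric]) (rule has_derivative_const)

text \<open>Cartan's second structure equation. Since the connection acts as cross product by W, the
  curvature acts as cross product by the vector dW(u, v) + W(u) \<times> W(v), which turns out to be
  -S(U \<times> V).\<close>

lemma curvature_bcv:
  assumes "p \<in> bcv_space a b"
  shows "coframe a b p (curvature (bcv_metric a b) p u v w) =
    cross3 (coframe a b p w) (curvature_map a b (cross3 (coframe a b p u) (coframe a b p v)))"
proof -
  let ?g = "bcv_metric a b" and ?N = "bcv_space a b"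
  let ?th = "coframe a b" and ?dth = "coframe_deriv a b" and ?W = "conn_vec a b"
  \<comment> \<open>Frame components of the covariant derivative of the constant field w along the
    constant field v, as a function of the point; differentiating this avoids differentiating
    \<open>christoffel\<close>.\<close>
  define G where "G v q = ?dth q v w + cross3 (?W q (?th q v)) (?th q w)" for v q
  have nab1: "nabla ?g (\<lambda>_. v) (\<lambda>_. w) q = christoffel ?g q v w" for v q
    by (simp add: nabla_const)
  have smC: "smooth_on ?N (\<lambda>q. christoffel ?g q v w)" for v
    by (subst smooth_on_cong[OF open_bcv_space christoffel_frame_inv], assumption,
        intro smooth_on_frame_inv smooth_on_add smooth_on_cross3 smooth_on_coframe_deriv
         smooth_on_conn_vec smooth_on_coframe smooth_on_id smooth_on_const open_bcv_space) auto
  have "?th p (nabla ?g (\<lambda>_. u) (nabla ?g (\<lambda>_. v) (\<lambda>_. w)) p) =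
      frechet_derivative (G v) (at p) u + cross3 (?W p (?th p u)) (G v p)" for u v
  proof -
    let ?C = "\<lambda>q. christoffel ?g q v w"
    have e: "nabla ?g (\<lambda>_. v) (\<lambda>_. w) = ?C" by (rule ext) (rule nab1)
    have d: "((\<lambda>q. ?th q (?C q)) has_derivative (\<lambda>h. ?dth p h (?C p) + ?th p (frechet_derivative ?C (at p) h))) (at p)"
      by (rule has_derivative_coframe[OF assms has_derivative_ident
            smooth_on_has_derivative[OF smC assms] refl])
    have "frechet_derivative (G v) (at p) = frechet_derivative (\<lambda>q. ?th q (?C q)) (at p)"
      by (rule frechet_derivative_cong_open[OF open_bcv_space assms])
        (simp add: coframe_christoffel G_def)
    also have "\<dots> = (\<lambda>h. ?dth p h (?C p) + ?th p (frechet_derivative ?C (at p) h))"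
      using frechet_derivative_at[OF d] by simp
    finally have "frechet_derivative (G v) (at p) u = ?dth p u (?C p) + ?th p (frechet_derivative ?C (at p) u)"
      by simp
    then show ?thesis
      unfolding nabla_const e
      using coframe_christoffel[OF assms]
      by (simp add: linear_add[OF linear_coframe] G_def)
  qed
  moreover have "nabla ?g (lie_bracket (\<lambda>_. u) (\<lambda>_. v)) (\<lambda>_. w) p = christoffel ?g p 0 w"
    by (simp add: lie_bracket_def nabla_def)
  moreover have "christoffel ?g p 0 w = 0"
  proof -
    have "?th p (christoffel ?g p 0 w) = ?th p 0"
      unfolding coframe_christoffel[OF assms]
      by (intro real3_eqI) (auto simp: cross3_nth bcv_form_def)
    then show ?thesis using coframe_eq_iff[OF assms] by blast
  qed
  ultimately have R: "?th p (curvature ?g p u v w) =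
      (frechet_derivative (G v) (at p) u + cross3 (?W p (?th p u)) (G v p)) -
      (frechet_derivative (G u) (at p) v + cross3 (?W p (?th p v)) (G u p))"
    unfolding curvature_def curvature_op_def
    by (simp add: linear_diff[OF linear_coframe] linear_0[OF linear_coframe])
  define l where "l = bcv_lambda a p"
  have l: "l \<noteq> 0" "bcv_lambda a p = l" using assms by (auto simp: bcv_space_def l_def)
  have l2: "l = 1 + a * ((p $ 1)\<^sup>2 + (p $ 2)\<^sup>2)" by (simp add: l_def bcv_lambda_def)
  define dd where "dd u v = frechet_derivative (\<lambda>q. ?dth q v w) (at p) u" for u v
  have smd: "smooth_on ?N (\<lambda>q. ?dth q v w)" for v
    by (intro smooth_on_coframe_deriv smooth_on_id smooth_on_const open_bcv_space) auto
  have smth: "smooth_on ?N (\<lambda>q. ?th q w)" 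
    by (intro smooth_on_coframe smooth_on_id smooth_on_const open_bcv_space) auto
  \<comment> \<open>\<open>coframe_deriv\<close> is itself a derivative, so second derivatives of
    the coframe are symmetric and cancel in R(u, v).\<close>
  have dsym: "dd u v = dd v u" for u v
  proof -
    have fd: "?dth q v w = frechet_derivative (\<lambda>q. ?th q w) (at q) v" if "q \<in> ?N" for q v
      using frechet_derivative_at[OF coframe_has_derivative[OF that, of w]] by metis
    have "dd u v = frechet_derivative (\<lambda>q. frechet_derivative (\<lambda>q. ?th q w) (at q) v) (at p) u" for u v
      unfolding dd_def by (intro fun_cong[OF frechet_derivative_cong_open[OF open_bcv_space assms]] fd)
    then show ?thesis using second_derivative_symmetric[OF open_bcv_space smth assms] by simp
  qed
  have GD: "frechet_derivative (G v) (at p) u = dd u v + (cross3 (?W p (?th p v)) (?dth p u w)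
      + cross3 (conn_vec_deriv a b u (?th p v) + ?W p (?dth p u v)) (?th p w))" for u v
  proof -
    have "(G v has_derivative (\<lambda>u. dd u v + (cross3 (?W p (?th p v)) (?dth p u w)
      + cross3 (conn_vec_deriv a b u (?th p v) + ?W p (?dth p u v)) (?th p w)))) (at p)"
      unfolding G_def[abs_def] dd_def
      by (intro has_derivative_add smooth_on_has_derivative[OF smd assms] cross3_has_derivative
          has_derivative_conn_vec has_derivative_ident coframe_has_derivative assms)
    from frechet_derivative_at[OF this, symmetric] show ?thesis by simp
  qed
  define K where "K u v = (conn_vec_deriv a b u (?th p v) + ?W p (?dth p u v))
     - (conn_vec_deriv a b v (?th p u) + ?W p (?dth p v u)) + cross3 (?W p (?th p u)) (?W p (?th p v))" for u v
  have K: "K u v = - curvature_map a b (cross3 (?th p u) (?th p v))"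
  proof -
    define U V where "U = ?th p u" and "V = ?th p v"
    have uv: "u $ 1 = l * U $ 1" "u $ 2 = l * U $ 2" "v $ 1 = l * V $ 1" "v $ 2 = l * V $ 2"
      using l by (simp_all add: U_def V_def)
    have "K u v = (conn_vec_deriv a b u V - conn_vec_deriv a b v U)
      + ?W p (?dth p u v - ?dth p v u) + cross3 (?W p U) (?W p V)"
      unfolding K_def U_def V_def by (simp add: linear_diff[OF conn_vec_linear])
    \<comment> \<open>Torsion-freeness replaces the antisymmetric part of the coframe derivative by
      cross products, and K becomes algebraic in U and V.\<close>
    also have "?dth p u v - ?dth p v u = cross3 (?W p V) U - cross3 (?W p U) V"
      unfolding U_def V_def by (rule coframe_torsion[OF assms])
    finally have "K u v = (conn_vec_deriv a b u V - conn_vec_deriv a b v U)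
      + ?W p (cross3 (?W p V) U - cross3 (?W p U) V) + cross3 (?W p U) (?W p V)" .
    also have "\<dots> = - curvature_map a b (cross3 U V)"
      by (rule real3_eqI; simp only: conn_vec_deriv_def vector_add_component vector_minus_component
          vector_uminus_component conn_vec_nth cross3_nth curvature_map_nth vector_scaleR_component uv)
        (simp_all add: axis_def l2 power2_eq_square algebra_simps)
    finally show ?thesis by (simp add: U_def V_def)
  qed
  have "?th p (curvature ?g p u v w) = cross3 (K u v) (?th p w)"
    unfolding R GD K_def G_def using dsym[of u v]
    by (intro real3_eqI; simp only: cross3_nth vector_add_component vector_minus_component)
      (simp_all add: algebra_simps)
  also have "\<dots> = cross3 (?th p w) (curvature_map a b (cross3 (?th p u) (?th p v)))"
    unfolding K by (metis cross_minus_left cross_skew)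
  finally show ?thesis .
qed

section \<open>Covariant derivative along a curve, in frame components\<close>

definition frame_cov :: "real \<Rightarrow> real \<Rightarrow> (real \<Rightarrow> real^3) \<Rightarrow> (real \<Rightarrow> real^3) \<Rightarrow> real \<Rightarrow> real^3" where
  "frame_cov a b c V t = vector_derivative V (at t) +
     cross3 (conn_vec a b (c t) (coframe a b (c t) (velocity c t))) (V t)"

lemma vector_derivative_cong_open:
  assumes "open S" "t \<in> S" "\<And>s. s \<in> S \<Longrightarrow> f s = g s"
  shows "vector_derivative f (at t) = vector_derivative g (at t)"
proof -
  have "(f has_vector_derivative D) (at t) \<longleftrightarrow> (g has_vector_derivative D) (at t)" for D
    unfolding has_vector_derivative_def
    using has_derivative_transform_within_open[OF _ assms(1,2), of f "\<lambda>x. x *\<^sub>R D" UNIV g]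
      has_derivative_transform_within_open[OF _ assms(1,2), of g "\<lambda>x. x *\<^sub>R D" UNIV f] assms(3)
    by metis
  then show ?thesis unfolding vector_derivative_def by simp
qed

lemma coframe_cov_along:
  assumes "open I" "t \<in> I" "smooth_on I c" "c ` I \<subseteq> bcv_space a b" "smooth_on I V"
  shows "coframe a b (c t) (cov_along (bcv_metric a b) c V t) =
    frame_cov a b c (\<lambda>t. coframe a b (c t) (V t)) t"
proof -
  have p: "c t \<in> bcv_space a b" using assms by auto
  have c: "(c has_derivative (\<lambda>h. h *\<^sub>R velocity c t)) (at t)"
    using smooth_on_has_vector_derivative[OF assms(3,2)] by (simp add: velocity_def has_vector_derivative_def)
  have V: "(V has_derivative (\<lambda>h. h *\<^sub>R vector_derivative V (at t))) (at t)"
    using smooth_on_has_vector_derivative[OF assms(5,2)] by (simp add: has_vector_derivative_def)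
  have "((\<lambda>t. coframe a b (c t) (V t)) has_vector_derivative
     (coframe_deriv a b (c t) (velocity c t) (V t) + coframe a b (c t) (vector_derivative V (at t)))) (at t)"
    unfolding has_vector_derivative_def
    by (rule has_derivative_eq_rhs[OF has_derivative_coframe[OF p c V refl]])
      (simp add: fun_eq_iff linear_scale[OF linear_coframe] linear_scale[OF linear_coframe_deriv[OF p]]
        scaleR_add_right)
  then have "vector_derivative (\<lambda>t. coframe a b (c t) (V t)) (at t) =
     coframe_deriv a b (c t) (velocity c t) (V t) + coframe a b (c t) (vector_derivative V (at t))"
    by (rule vector_derivative_at)
  then show ?thesis
    unfolding cov_along_def frame_cov_def
    by (simp add: linear_add[OF linear_coframe] coframe_christoffel[OF p])
qed

lemma smooth_on_frame_cov:
  assumes "open I" "smooth_on I c" "c ` I \<subseteq> bcv_space a b" "smooth_on I V"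
  shows "smooth_on I (frame_cov a b c V)"
  unfolding frame_cov_def[abs_def] velocity_def using assms
  by (intro smooth_on_add smooth_on_cross3 smooth_on_conn_vec smooth_on_coframe smooth_on_vector_derivative)

text \<open>Smoothness is read off from the frame formula, because the definite description in
  \<open>christoffel\<close> does not display it.\<close>

lemma smooth_on_cov_along:
  assumes "open I" "smooth_on I c" "c ` I \<subseteq> bcv_space a b" "smooth_on I V"
  shows "smooth_on I (cov_along (bcv_metric a b) c V)"
proof -
  have eq: "cov_along (bcv_metric a b) c V t =
      frame_inv a b (c t) (frame_cov a b c (\<lambda>t. coframe a b (c t) (V t)) t)" if "t \<in> I" for t
    using coframe_cov_along[OF assms(1) that assms(2-4)] frame_inv_coframe assms(3) that
    by (metis image_subset_iff)
  have sm: "smooth_on I (\<lambda>t. frame_inv a b (c t) (frame_cov a b c (\<lambda>t. coframe a b (c t) (V t)) t))"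
    using assms by (intro smooth_on_frame_inv smooth_on_frame_cov smooth_on_coframe)
  show ?thesis
    by (rule iffD2[OF smooth_on_cong[OF assms(1) eq] sm])
qed

lemma frame_cov_cong_open:
  assumes "open I" "t \<in> I" "\<And>s. s \<in> I \<Longrightarrow> V s = W s"
  shows "frame_cov a b c V t = frame_cov a b c W t"
  unfolding frame_cov_def using vector_derivative_cong_open[OF assms] assms(2,3) by simp

text \<open>R(DT, T)T becomes T \<times> S(DT \<times> T) by \<open>curvature_bcv\<close>. The three
  covariant derivatives are moved to components one at a time, which needs each intermediate field
  to be smooth.\<close>

lemma biharmonic_curve_frame:
  assumes bi: "biharmonic_curve (bcv_space a b) (bcv_metric a b) I c" and I: "open I" "t \<in> I"
    and T: "T = (\<lambda>t. coframe a b (c t) (velocity c t))"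
  shows "frame_cov a b c (frame_cov a b c (frame_cov a b c T)) t
    + cross3 (T t) (curvature_map a b (cross3 (frame_cov a b c T t) (T t))) = 0"
proof -
  let ?g = "bcv_metric a b" and ?v = "velocity c"
  have sc: "smooth_on I c" and cN: "c ` I \<subseteq> bcv_space a b"
    and eq: "(cov_along ?g c ^^ 3) ?v t + curvature ?g (c t) (cov_along ?g c ?v t) (?v t) (?v t) = 0"
    using bi I by (auto simp: biharmonic_curve_def)
  have sv: "smooth_on I ?v" unfolding velocity_def[abs_def] by (rule smooth_on_vector_derivative[OF I(1) sc])
  have s1: "smooth_on I (cov_along ?g c ?v)" by (rule smooth_on_cov_along[OF I(1) sc cN sv])
  have s2: "smooth_on I (cov_along ?g c (cov_along ?g c ?v))" by (rule smooth_on_cov_along[OF I(1) sc cN s1])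
  have e1: "coframe a b (c s) (cov_along ?g c ?v s) = frame_cov a b c T s" if "s \<in> I" for s
    using coframe_cov_along[OF I(1) that sc cN sv] by (simp add: T)
  have e2: "coframe a b (c s) (cov_along ?g c (cov_along ?g c ?v) s) = frame_cov a b c (frame_cov a b c T) s"
    if "s \<in> I" for s
    using coframe_cov_along[OF I(1) that sc cN s1] frame_cov_cong_open[OF I(1) that e1] by simp
  have e3: "coframe a b (c t) (cov_along ?g c (cov_along ?g c (cov_along ?g c ?v)) t) =
      frame_cov a b c (frame_cov a b c (frame_cov a b c T)) t"
    using coframe_cov_along[OF I sc cN s2] frame_cov_cong_open[OF I e2] by simp
  have p: "c t \<in> bcv_space a b" using cN I by auto
  have "coframe a b (c t) ((cov_along ?g c ^^ 3) ?v t) +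
      coframe a b (c t) (curvature ?g (c t) (cov_along ?g c ?v t) (?v t) (?v t)) = 0"
    using eq linear_0[OF linear_coframe] by (metis linear_add[OF linear_coframe])
  then show ?thesis
    by (simp add: numeral_3_eq_3 e3 curvature_bcv[OF p] e1[OF I(2)] T)
qed

section \<open>Biharmonic geodesics in the orthonormal frame\<close>

lemma frame_cov_has_vector_derivative:
  assumes "smooth_on I V" "t \<in> I"
  shows "(V has_vector_derivative frame_cov a b c V t -
    cross3 (conn_vec a b (c t) (coframe a b (c t) (velocity c t))) (V t)) (at t)"
  using smooth_on_has_vector_derivative[OF assms] by (simp add: frame_cov_def)

text \<open>Skewness of \<open>cross3 w\<close>; it makes D compatible with the inner
  product.\<close>

lemma cross3_triple: "cross3 w v \<bullet> u + v \<bullet> cross3 w u = 0" for u v w :: "real^3"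
  by (simp add: inner_real3 cross3_nth algebra_simps)

lemma frame_cov_inner:
  assumes "smooth_on I V" "smooth_on I W" "t \<in> I"
  shows "((\<lambda>t. V t \<bullet> W t) has_real_derivative frame_cov a b c V t \<bullet> W t + V t \<bullet> frame_cov a b c W t) (at t)"
proof -
  let ?w = "conn_vec a b (c t) (coframe a b (c t) (velocity c t))"
  have "((\<lambda>t. V t \<bullet> W t) has_vector_derivative
      V t \<bullet> (frame_cov a b c W t - cross3 ?w (W t)) + (frame_cov a b c V t - cross3 ?w (V t)) \<bullet> W t) (at t)"
    using assms by (intro bounded_bilinear.has_vector_derivative[OF bounded_bilinear_inner]
        frame_cov_has_vector_derivative)
  moreover have "V t \<bullet> (frame_cov a b c W t - cross3 ?w (W t)) + (frame_cov a b c V t - cross3 ?w (V t)) \<bullet> W t =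
     frame_cov a b c V t \<bullet> W t + V t \<bullet> frame_cov a b c W t"
    using cross3_triple[of ?w "V t" "W t"] by (simp add: inner_diff_left inner_diff_right)
  ultimately show ?thesis by (simp add: has_real_derivative_iff_has_vector_derivative)
qed

lemma frame_cov_scaleR:
  assumes "smooth_on I f" "smooth_on I V" "t \<in> I"
  shows "frame_cov a b c (\<lambda>t. f t *\<^sub>R V t) t = vector_derivative f (at t) *\<^sub>R V t + f t *\<^sub>R frame_cov a b c V t"
proof -
  have "((\<lambda>t. f t *\<^sub>R V t) has_vector_derivative
      f t *\<^sub>R vector_derivative V (at t) + vector_derivative f (at t) *\<^sub>R V t) (at t)"
    using assms by (intro bounded_bilinear.has_vector_derivative[OF bounded_bilinear_scaleR]
        smooth_on_has_vector_derivative)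
  from vector_derivative_at[OF this] show ?thesis
    unfolding frame_cov_def by (simp add: cross_mult_right scaleR_add_right)
qed

lemma frame_cov_add:
  assumes "smooth_on I V" "smooth_on I W" "t \<in> I"
  shows "frame_cov a b c (\<lambda>t. V t + W t) t = frame_cov a b c V t + frame_cov a b c W t"
proof -
  have "((\<lambda>t. V t + W t) has_vector_derivative vector_derivative V (at t) + vector_derivative W (at t)) (at t)"
    using assms by (intro has_vector_derivative_add smooth_on_has_vector_derivative)
  from vector_derivative_at[OF this] show ?thesis
    unfolding frame_cov_def by (simp add: cross_add_right)
qed

text \<open>The Jacobi identity; it makes D a derivation of the cross product.\<close>

lemma cross3_derivation:
  "cross3 w (cross3 u v) = cross3 (cross3 w u) v + cross3 u (cross3 w v)" for u v w :: "real^3"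
  by (intro real3_eqI) (simp_all add: cross3_nth algebra_simps)

lemma cross3_inner_cyclic: "cross3 u v \<bullet> w = cross3 w u \<bullet> v" for u v w :: "real^3"
  by (simp add: inner_real3 cross3_nth algebra_simps)

lemma frame_cov_cross3:
  assumes "smooth_on I V" "smooth_on I W" "t \<in> I"
  shows "frame_cov a b c (\<lambda>t. cross3 (V t) (W t)) t =
    cross3 (frame_cov a b c V t) (W t) + cross3 (V t) (frame_cov a b c W t)"
proof -
  have "((\<lambda>t. cross3 (V t) (W t)) has_vector_derivative
      cross3 (V t) (vector_derivative W (at t)) + cross3 (vector_derivative V (at t)) (W t)) (at t)"
    using assms by (intro bounded_bilinear.has_vector_derivative[OF bounded_bilinear_cross3]
        smooth_on_has_vector_derivative)
  from vector_derivative_at[OF this] show ?thesis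
    unfolding frame_cov_def
    by (simp add: cross3_derivation[of _ "V t" "W t"] cross_add_left cross_add_right)
qed

text \<open>\<open>E0\<close> is constant, so only W \<times> E0 is left; the component of W along
  \<open>E0\<close>, which carries the dependence on the position, drops out.\<close>

lemma frame_cov_E3:
  "frame_cov a b c (\<lambda>_. axis 3 1) t = (b / 2) *\<^sub>R cross3 (coframe a b (c t) (velocity c t)) (axis 3 1)"
  unfolding frame_cov_def
  by (intro real3_eqI) (simp_all add: cross3_nth axis_def)

lemma inner_axis3: "v \<bullet> axis 3 1 = v $ 3" "axis 3 1 \<bullet> v = v $ 3" for v :: "real^3"
  by (simp_all add: inner_real3 axis_def)

lemma real_derivative_zero_interval:
  fixes f :: "real \<Rightarrow> real"
  assumes "open I" "is_interval I" "\<And>t. t \<in> I \<Longrightarrow> (f has_real_derivative 0) (at t)" "s \<in> I" "t \<in> I"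
  shows "f s = f t"
proof -
  have "convex I" using assms(2) by (simp add: is_interval_convex)
  moreover have "(f has_derivative (\<lambda>h. 0)) (at x within I)" if "x \<in> I" for x
    by (rule has_derivative_at_withinI[OF has_derivative_eq_rhs[OF assms(3)[OF that, unfolded has_field_derivative_def]]])
      auto
  ultimately obtain k where "\<And>x. x \<in> I \<Longrightarrow> f x = k"
    using has_derivative_zero_constant[of I f] by blast
  then show ?thesis using assms(4,5) by simp
qed

text \<open>A geodesic of the surface seen from the ambient space: \<open>e\<close> is the surface
  normal along the curve, and DT parallel to \<open>e\<close> is the geodesic equation. Neither
  surface nor chart occurs, so the results concern a single curve.\<close>

locale biharmonic_geodesic =
  fixes a b :: real and I :: "real set" and c T e :: "real \<Rightarrow> real^3"
  assumes I: "open I" "is_interval I"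
    and biharm: "biharmonic_curve (bcv_space a b) (bcv_metric a b) I c"
    and T_def: "T = (\<lambda>t. coframe a b (c t) (velocity c t))"
    and smooth_e: "smooth_on I e"
    and unit_e: "\<And>t. t \<in> I \<Longrightarrow> e t \<bullet> e t = 1"
    and normal_e: "\<And>t. t \<in> I \<Longrightarrow> e t \<bullet> T t = 0"
    and geodesic: "\<And>t. t \<in> I \<Longrightarrow> \<exists>r. frame_cov a b c T t = r *\<^sub>R e t"
begin

abbreviation D where "D \<equiv> frame_cov a b c"

text \<open>The normal curvature of the surface in the direction of the curve; up to sign, the
  curvature of the curve in space.\<close>

definition k where "k t = D T t \<bullet> e t"

lemma smooth_c: "smooth_on I c" and c_in: "c ` I \<subseteq> bcv_space a b"
  using biharm by (auto simp: biharmonic_curve_def)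

lemma smooth_T: "smooth_on I T"
  unfolding T_def velocity_def
  by (intro smooth_on_coframe smooth_on_vector_derivative smooth_c c_in I)

lemma smooth_D: "smooth_on I V \<Longrightarrow> smooth_on I (D V)"
  by (intro smooth_on_frame_cov smooth_c c_in I)

lemma smooth_k: "smooth_on I k"
  unfolding k_def[abs_def] by (intro smooth_on_inner smooth_D smooth_T smooth_e I)

lemma unit_T: "t \<in> I \<Longrightarrow> T t \<bullet> T t = 1"
  using biharm by (simp add: biharmonic_curve_def bcv_metric_frame T_def)

lemma DT: "t \<in> I \<Longrightarrow> D T t = k t *\<^sub>R e t"
  using geodesic[of t] unit_e[of t] by (auto simp: k_def)

lemma real_deriv_eq:
  assumes "\<And>t. t \<in> I \<Longrightarrow> f t = (g t :: real)" "t \<in> I" "(f has_real_derivative f') (at t)"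
    "(g has_real_derivative g') (at t)"
  shows "f' = g'"
proof -
  have "(g has_real_derivative f') (at t)"
    using assms(3) unfolding has_field_derivative_def
    by (rule has_derivative_transform_within_open[OF _ I(1) assms(2)]) (use assms(1) in auto)
  then show ?thesis using assms(4) DERIV_unique by blast
qed

lemma De_e: "t \<in> I \<Longrightarrow> D e t \<bullet> e t = 0"
  using real_deriv_eq[OF unit_e _ frame_cov_inner[OF smooth_e smooth_e] DERIV_const]
  by (simp add: inner_commute)

lemma De_T: "t \<in> I \<Longrightarrow> D e t \<bullet> T t = - k t"
  using real_deriv_eq[OF normal_e _ frame_cov_inner[OF smooth_e smooth_T] DERIV_const, of t a b c]
  by (simp add: k_def inner_commute)

lemma has_real_derivative_smooth: "smooth_on I f \<Longrightarrow> t \<in> I \<Longrightarrow> (f has_real_derivative vector_derivative f (at t)) (at t)"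
  using smooth_on_has_vector_derivative by (simp add: has_real_derivative_iff_has_vector_derivative)

text \<open>Differentiate <De, T> = -k; the other term <De, DT> is a multiple of <De, e> =
  0.\<close>

lemma DDe_T: "t \<in> I \<Longrightarrow> D (D e) t \<bullet> T t = - vector_derivative k (at t)"
  using real_deriv_eq[OF De_T _ frame_cov_inner[OF smooth_D[OF smooth_e] smooth_T]
      DERIV_minus[OF has_real_derivative_smooth[OF smooth_k]], of t a b c] DT[of t] De_e[of t]
  by simp

lemma D3T:
  assumes t: "t \<in> I"
  shows "D (D (D T)) t = vector_derivative (\<lambda>t. vector_derivative k (at t)) (at t) *\<^sub>R e t
    + (2 * vector_derivative k (at t)) *\<^sub>R D e t + k t *\<^sub>R D (D e) t"
proof -
  let ?k' = "\<lambda>t. vector_derivative k (at t)"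
  have sk': "smooth_on I ?k'" by (rule smooth_on_vector_derivative[OF I(1) smooth_k])
  have 1: "D (D T) s = ?k' s *\<^sub>R e s + k s *\<^sub>R D e s" if "s \<in> I" for s
    using frame_cov_cong_open[OF I(1) that DT] frame_cov_scaleR[OF smooth_k smooth_e that] by simp
  have "D (D (D T)) t = D (\<lambda>s. ?k' s *\<^sub>R e s + k s *\<^sub>R D e s) t"
    by (rule frame_cov_cong_open[OF I(1) t 1])
  also have "\<dots> = D (\<lambda>s. ?k' s *\<^sub>R e s) t + D (\<lambda>s. k s *\<^sub>R D e s) t"
    by (intro frame_cov_add[OF _ _ t] smooth_on_scaleR smooth_D sk' smooth_k smooth_e I)
  also have "\<dots> = vector_derivative ?k' (at t) *\<^sub>R e t + (2 * ?k' t) *\<^sub>R D e t + k t *\<^sub>R D (D e) t"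
    by (intro real3_eqI; simp add: frame_cov_scaleR[OF sk' smooth_e t]
        frame_cov_scaleR[OF smooth_k smooth_D[OF smooth_e] t] algebra_simps)
  finally show ?thesis .
qed

lemma biharm_eq:
  assumes t: "t \<in> I"
  shows "vector_derivative (\<lambda>t. vector_derivative k (at t)) (at t) *\<^sub>R e t
    + (2 * vector_derivative k (at t)) *\<^sub>R D e t + k t *\<^sub>R D (D e) t
    + k t *\<^sub>R cross3 (T t) (curvature_map a b (cross3 (e t) (T t))) = 0"
proof -
  have "curvature_map a b (r *\<^sub>R v) = r *\<^sub>R curvature_map a b v" for r v
    by (intro real3_eqI) simp_all
  then show ?thesis
    using biharmonic_curve_frame[OF biharm I(1) t T_def]
    by (simp add: D3T[OF t] DT[OF t] cross_mult_left cross_mult_right)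
qed

text \<open>The component of the biharmonic equation along \<open>T\<close> is \<open>-3 k k' = 0\<close>.\<close>

lemma k_k': assumes t: "t \<in> I" shows "k t * vector_derivative k (at t) = 0"
proof -
  have "vector_derivative (\<lambda>t. vector_derivative k (at t)) (at t) * (e t \<bullet> T t)
    + (2 * vector_derivative k (at t)) * (D e t \<bullet> T t) + k t * (D (D e) t \<bullet> T t)
    + k t * (cross3 (T t) (curvature_map a b (cross3 (e t) (T t))) \<bullet> T t) = 0"
    using arg_cong[OF biharm_eq[OF t], of "\<lambda>v. v \<bullet> T t"] by (simp add: inner_add_left)
  then show ?thesis
    by (simp add: normal_e[OF t] De_T[OF t] DDe_T[OF t] dot_cross_self)
qed

text \<open>(k^2)' = 2 k k' = 0, so the square is constant without knowing beforehand that k has no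
  zero.\<close>

lemma k_const: assumes "s \<in> I" "t \<in> I" shows "(k s)\<^sup>2 = (k t)\<^sup>2"
proof (rule real_derivative_zero_interval[OF I _ assms])
  show "((\<lambda>t. (k t)\<^sup>2) has_real_derivative 0) (at t)" if "t \<in> I" for t
    using has_real_derivative_smooth[OF smooth_k that] k_k'[OF that]
    by (auto intro!: derivative_eq_intros)
qed

lemma k_nonzero: "s \<in> I \<Longrightarrow> t \<in> I \<Longrightarrow> k s \<noteq> 0 \<Longrightarrow> k t \<noteq> 0"
  using k_const[of s t] by auto

text \<open>One parameter value with k \<noteq> 0 suffices: by \<open>k_const\<close> there is then
  no zero on I, and the biharmonic equation may be divided by k throughout.\<close>

context
  fixes t0 assumes t0: "t0 \<in> I" "k t0 \<noteq> 0"
begin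

lemma DDe: assumes t: "t \<in> I" shows "D (D e) t = - cross3 (T t) (curvature_map a b (cross3 (e t) (T t)))"
proof -
  have k': "vector_derivative k (at s) = 0" if "s \<in> I" for s
    using k_k'[OF that] k_nonzero[OF t0(1) that t0(2)] by simp
  have "vector_derivative (\<lambda>t. vector_derivative k (at t)) (at t) = 0"
    using vector_derivative_cong_open[OF I(1) t k'] by simp
  then have "k t *\<^sub>R (D (D e) t + cross3 (T t) (curvature_map a b (cross3 (e t) (T t)))) = 0"
    using biharm_eq[OF t] k'[OF t] by (simp add: scaleR_add_right)
  then show ?thesis using k_nonzero[OF t0(1) t t0(2)] by (simp add: eq_neg_iff_add_eq_0)
qed

text \<open>Differentiating <De, e> = 0 gives |De|^2 = -<D(De), e> = <e \<times> T, S(e \<times>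
  T)>, and e \<times> T is a unit vector.\<close>

lemma De_norm:
  assumes t: "t \<in> I"
  shows "D e t \<bullet> D e t = b\<^sup>2 / 4 + (4 * a - b\<^sup>2) * (cross3 (e t) (T t) \<bullet> E0)\<^sup>2"
proof -
  have "D (D e) t \<bullet> e t + D e t \<bullet> D e t = 0"
    using real_deriv_eq[OF De_e t frame_cov_inner[OF smooth_D[OF smooth_e] smooth_e t] DERIV_const] by simp
  then have "D e t \<bullet> D e t = cross3 (T t) (curvature_map a b (cross3 (e t) (T t))) \<bullet> e t"
    by (simp add: DDe[OF t])
  also have "\<dots> = cross3 (e t) (T t) \<bullet> curvature_map a b (cross3 (e t) (T t))"
    by (rule cross3_inner_cyclic)
  also have "\<dots> = b\<^sup>2 / 4 * (cross3 (e t) (T t) \<bullet> cross3 (e t) (T t)) + (4 * a - b\<^sup>2) * (cross3 (e t) (T t) \<bullet> E0)\<^sup>2"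
    unfolding curvature_map_def by (simp add: inner_add_right inner_axis3 power2_eq_square algebra_simps)
  also have "cross3 (e t) (T t) \<bullet> cross3 (e t) (T t) = 1"
    using norm_cross_dot[of "e t" "T t"] unit_e[OF t] unit_T[OF t] normal_e[OF t]
    by (simp add: power_mult_distrib flip: power2_norm_eq_inner)
  finally show ?thesis by simp
qed

text \<open>Differentiate the identity for \<open>\<bar>De\<bar>\<^sup>2\<close> and substitute \<open>D(De) = - T \<times> S(e \<times> T)\<close> once more.\<close>

lemma second_condition:
  assumes t: "t \<in> I" and ab: "4 * a \<noteq> b\<^sup>2"
  shows "cross3 (e t) (T t) \<bullet> E0 * (2 * (D e t \<bullet> cross3 (T t) E0) - b / 2 * (e t \<bullet> E0)) = 0"
proof -
  define n where "n t = cross3 (e t) (T t) \<bullet> E0" for t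
  define X where "X = D e t \<bullet> cross3 (T t) E0"
  have dE: "D (\<lambda>_. E0) t = (b / 2) *\<^sub>R cross3 (T t) E0" by (simp add: frame_cov_E3 T_def)
  have "((\<lambda>t. cross3 (e t) (T t) \<bullet> E0) has_real_derivative
      D (\<lambda>t. cross3 (e t) (T t)) t \<bullet> E0 + cross3 (e t) (T t) \<bullet> D (\<lambda>_. E0) t) (at t)"
    by (intro frame_cov_inner[OF _ _ t] smooth_on_cross3 smooth_e smooth_T smooth_on_const I)
  moreover have "D (\<lambda>t. cross3 (e t) (T t)) t = cross3 (D e t) (T t)"
    using frame_cov_cross3[OF smooth_e smooth_T t] DT[OF t] by (simp add: cross_mult_right)
  moreover have "cross3 (D e t) (T t) \<bullet> E0 = X"
    unfolding X_def by (simp add: inner_real3 cross3_nth algebra_simps)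
  moreover have "cross3 (e t) (T t) \<bullet> cross3 (T t) E0 = (e t \<bullet> T t) * (T t \<bullet> E0) - (e t \<bullet> E0) * (T t \<bullet> T t)"
    by (simp add: inner_real3 cross3_nth algebra_simps)
  \<comment> \<open>e \<times> DT = 0, so n changes only through De and through the derivative of
    \<open>E0\<close>, which contributes the term with b.\<close>
  ultimately have n': "(n has_real_derivative X - b / 2 * (e t \<bullet> E0)) (at t)"
    by (simp add: n_def[abs_def] dE normal_e[OF t] unit_T[OF t])
  have A: "2 * (D e t \<bullet> D (D e) t) = (4 * a - b\<^sup>2) * (2 * n t * (X - b / 2 * (e t \<bullet> E0)))"
  proof (rule real_deriv_eq[OF De_norm t])
    show "((\<lambda>t. D e t \<bullet> D e t) has_real_derivative 2 * (D e t \<bullet> D (D e) t)) (at t)"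
      using frame_cov_inner[OF smooth_D[OF smooth_e] smooth_D[OF smooth_e] t, of a b c]
      by (simp add: inner_commute)
    show "((\<lambda>t. b\<^sup>2 / 4 + (4 * a - b\<^sup>2) * (cross3 (e t) (T t) \<bullet> E0)\<^sup>2) has_real_derivative
       (4 * a - b\<^sup>2) * (2 * n t * (X - b / 2 * (e t \<bullet> E0)))) (at t)"
      using n' unfolding n_def[symmetric] by (auto intro!: derivative_eq_intros)
  qed
  have B: "D e t \<bullet> D (D e) t = - (4 * a - b\<^sup>2) * n t * X"
  proof -
    have "cross3 (T t) (cross3 (e t) (T t)) = (T t \<bullet> T t) *\<^sub>R e t - (e t \<bullet> T t) *\<^sub>R T t"
      by (intro real3_eqI) (simp_all add: inner_real3 cross3_nth algebra_simps)
    then have eq: "cross3 (T t) (curvature_map a b (cross3 (e t) (T t))) =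
        (b\<^sup>2 / 4) *\<^sub>R e t + ((4 * a - b\<^sup>2) * n t) *\<^sub>R cross3 (T t) E0"
      unfolding curvature_map_def
      by (simp add: cross_add_right cross_mult_right n_def inner_axis3 normal_e[OF t] unit_T[OF t])
    show ?thesis
      unfolding DDe[OF t] eq by (simp add: inner_diff_right De_e[OF t] X_def algebra_simps)
  qed
  define h where "h = b / 2 * (e t \<bullet> E0)"
  \<comment> \<open>\<open>A\<close> and \<open>B\<close> evaluate the same derivative: up to the
    factor 4 a - b^2 they say -2 n X = 2 n (X - h).\<close>
  have "(4 * a - b\<^sup>2) * (n t * (2 * X - h)) = 0"
    using A B unfolding h_def[symmetric] by algebra
  then show ?thesis using ab by (simp add: n_def X_def h_def)
qed

end

end

section \<open>The shape operator at a point\<close>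

text \<open>The product of the two quadratics vanishes for every r, since the second is zero
  wherever the first is not. A real polynomial that vanishes everywhere is 0, and there are no zero
  divisors.\<close>

lemma quadratic_product_zero:
  fixes q0 q1 q2 p0 p1 p2 :: real
  assumes "\<And>r. q0 + q1 * r + q2 * r\<^sup>2 \<noteq> 0 \<Longrightarrow> p0 + p1 * r + p2 * r\<^sup>2 = 0"
    and "q0 \<noteq> 0 \<or> q1 \<noteq> 0 \<or> q2 \<noteq> 0"
  shows "p0 = 0 \<and> p1 = 0 \<and> p2 = 0"
proof -
  have "\<forall>r. poly ([:q0, q1, q2:] * [:p0, p1, p2:]) r = 0"
  proof
    fix r
    have "poly ([:q0, q1, q2:] * [:p0, p1, p2:]) r =
        (q0 + q1 * r + q2 * r\<^sup>2) * (p0 + p1 * r + p2 * r\<^sup>2)"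
      by (simp only: poly_mult) (simp add: power2_eq_square algebra_simps)
    then show "poly ([:q0, q1, q2:] * [:p0, p1, p2:]) r = 0" using assms(1)[of r] by auto
  qed
  then have "[:q0, q1, q2:] * [:p0, p1, p2:] = 0" by (simp only: poly_all_0_iff_0)
  then show ?thesis using assms(2) by (auto simp: mult_eq_0_iff pCons_eq_0_iff simp del: mult_pCons_left mult_pCons_right)
qed

lemma quadratic_linear_product_zero:
  fixes q0 q1 q2 p0 p1 p2 l0 l1 :: real
  assumes "\<And>r. q0 + q1 * r + q2 * r\<^sup>2 \<noteq> 0 \<Longrightarrow> (l0 + l1 * r) * (p0 + p1 * r + p2 * r\<^sup>2) = 0"
    and "q0 \<noteq> 0 \<or> q1 \<noteq> 0 \<or> q2 \<noteq> 0"
  shows "(l0 = 0 \<and> l1 = 0) \<or> (p0 = 0 \<and> p1 = 0 \<and> p2 = 0)"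
proof -
  have "\<forall>r. poly ([:q0, q1, q2:] * ([:l0, l1:] * [:p0, p1, p2:])) r = 0"
  proof
    fix r
    have "poly ([:q0, q1, q2:] * ([:l0, l1:] * [:p0, p1, p2:])) r =
        (q0 + q1 * r + q2 * r\<^sup>2) * ((l0 + l1 * r) * (p0 + p1 * r + p2 * r\<^sup>2))"
      by (simp only: poly_mult) (simp add: power2_eq_square algebra_simps)
    then show "poly ([:q0, q1, q2:] * ([:l0, l1:] * [:p0, p1, p2:])) r = 0" using assms(1)[of r] by auto
  qed
  then have "[:q0, q1, q2:] * ([:l0, l1:] * [:p0, p1, p2:]) = 0" by (simp only: poly_all_0_iff_0)
  then show ?thesis using assms(2) by (auto simp: mult_eq_0_iff pCons_eq_0_iff simp del: mult_pCons_left mult_pCons_right)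
qed


locale unit_frame =
  fixes e1 e2 e :: "real^3"
  assumes e1: "e1 \<bullet> e1 = 1" and e2: "e2 \<bullet> e2 = 1" and e12: "e1 \<bullet> e2 = 0" and e: "e = cross3 e1 e2"
begin

lemma cross: "cross3 e e1 = e2" "cross3 e e2 = - e1"
proof -
  have "cross3 (cross3 e1 e2) w = (w \<bullet> e1) *\<^sub>R e2 - (w \<bullet> e2) *\<^sub>R e1" for w
    by (intro real3_eqI) (simp_all add: inner_real3 cross3_nth algebra_simps)
  then show "cross3 e e1 = e2" "cross3 e e2 = - e1"
    using e1 e2 e12 by (simp_all add: e inner_commute[of e2 e1])
qed

lemma normal: "e1 \<bullet> e = 0" "e2 \<bullet> e = 0" "e \<bullet> e1 = 0" "e \<bullet> e2 = 0"
  unfolding e by (simp_all add: dot_cross_self)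

lemma unit: "e \<bullet> e = 1"
  using norm_cross_dot[of e1 e2] e1 e2 e12 unfolding e
  by (simp add: power_mult_distrib flip: power2_norm_eq_inner)

text \<open>The remainder w is orthogonal to all three vectors. Then w \<times> e = 0, and
  Lagrange's identity for w and e leaves |w|^2 = 0.\<close>

lemma expand: "v = (v \<bullet> e1) *\<^sub>R e1 + (v \<bullet> e2) *\<^sub>R e2 + (v \<bullet> e) *\<^sub>R e"
proof -
  define w where "w = v - ((v \<bullet> e1) *\<^sub>R e1 + (v \<bullet> e2) *\<^sub>R e2 + (v \<bullet> e) *\<^sub>R e)"
  have w: "w \<bullet> e1 = 0" "w \<bullet> e2 = 0" "w \<bullet> e = 0"
    using e1 e2 e12 normal unit
    by (simp_all add: w_def inner_diff_left inner_add_left inner_commute[of e2 e1])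
  have "cross3 w (cross3 e1 e2) = (w \<bullet> e2) *\<^sub>R e1 - (w \<bullet> e1) *\<^sub>R e2"
    by (intro real3_eqI) (simp_all add: inner_real3 cross3_nth algebra_simps)
  then have "cross3 w e = 0" using w e by simp
  moreover have "(w \<bullet> w) * (e \<bullet> e) = (w \<bullet> e)\<^sup>2 + cross3 w e \<bullet> cross3 w e"
    using norm_cross_dot[of w e] by (simp add: power_mult_distrib flip: power2_norm_eq_inner)
  ultimately have "w = 0" using w unit by simp
  then show ?thesis by (simp add: w_def)
qed

lemma inner_expand: "v \<bullet> w = (v \<bullet> e1) * (w \<bullet> e1) + (v \<bullet> e2) * (w \<bullet> e2) + (v \<bullet> e) * (w \<bullet> e)"
  using arg_cong[OF expand[of v], of "\<lambda>x. x \<bullet> w"]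
  by (simp only: inner_add_left inner_scaleR_left inner_commute[of w])

text \<open>The data at one point: \<open>b1\<close> and \<open>b2\<close> will be the covariant
  derivatives of the normal along \<open>e1\<close> and \<open>e2\<close>, \<open>E\<close> the
  vertical vector, \<open>t\<close> = b/2 and \<open>d\<close> = 4 a - b^2. The last assumption says
  that the second fundamental form is not zero.\<close>

context
  fixes b1 b2 E :: "real^3" and t d :: real
  assumes b: "b1 \<bullet> e = 0" "b2 \<bullet> e = 0"
    and ex: "\<exists>c s. (c *\<^sub>R b1 + s *\<^sub>R b2) \<bullet> (c *\<^sub>R e1 + s *\<^sub>R e2) \<noteq> 0"
begin

abbreviation "tv c s \<equiv> c *\<^sub>R e1 + s *\<^sub>R e2"
abbreviation "bv c s \<equiv> c *\<^sub>R b1 + s *\<^sub>R b2"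

text \<open>The direction e1 + r e2 has nonzero normal curvature. Omitting the direction e2 does no
  harm: polynomial identities in r determine all coefficients.\<close>

definition "Q r \<longleftrightarrow> b1 \<bullet> e1 + (b2 \<bullet> e1 + b1 \<bullet> e2) * r + (b2 \<bullet> e2) * r\<^sup>2 \<noteq> 0"

lemma Q_coeffs: "b1 \<bullet> e1 \<noteq> 0 \<or> b2 \<bullet> e1 + b1 \<bullet> e2 \<noteq> 0 \<or> b2 \<bullet> e2 \<noteq> 0"
proof (rule ccontr)
  assume "\<not> ?thesis"
  then have "b1 \<bullet> e1 = 0" "b2 \<bullet> e1 = - (b1 \<bullet> e2)" "b2 \<bullet> e2 = 0" by auto
  then show False using ex by (auto simp: inner_add_left inner_add_right)
qed

lemma Q_direction:
  assumes "Q r"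
  defines "w \<equiv> sqrt (1 + r\<^sup>2)"
  shows "w > 0" "(1 / w)\<^sup>2 + (r / w)\<^sup>2 = 1" "bv (1 / w) (r / w) \<bullet> tv (1 / w) (r / w) \<noteq> 0"
    "bv (1 / w) (r / w) = (1 / w) *\<^sub>R (b1 + r *\<^sub>R b2)" "tv (1 / w) (r / w) = (1 / w) *\<^sub>R (e1 + r *\<^sub>R e2)"
    "w\<^sup>2 = 1 + r\<^sup>2"
proof -
  show w: "w\<^sup>2 = 1 + r\<^sup>2" by (simp add: w_def add_nonneg_nonneg)
  show p: "w > 0" by (simp add: w_def add_pos_nonneg)
  show "(1 / w)\<^sup>2 + (r / w)\<^sup>2 = 1"
  proof -
    have "(1 / w)\<^sup>2 + (r / w)\<^sup>2 = (1 + r\<^sup>2) / w\<^sup>2" by (simp only: power_divide add_divide_distrib) simp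
    then show ?thesis using w p by (metis divide_self less_numeral_extra(3) zero_less_power)
  qed
  show B: "bv (1 / w) (r / w) = (1 / w) *\<^sub>R (b1 + r *\<^sub>R b2)"
    and T: "tv (1 / w) (r / w) = (1 / w) *\<^sub>R (e1 + r *\<^sub>R e2)"
    by (simp_all add: scaleR_add_right)
  have "(b1 + r *\<^sub>R b2) \<bullet> (e1 + r *\<^sub>R e2) \<noteq> 0"
    using assms(1) by (simp add: Q_def inner_add_left inner_add_right algebra_simps power2_eq_square)
  then show "bv (1 / w) (r / w) \<bullet> tv (1 / w) (r / w) \<noteq> 0"
    unfolding B T using p by simp
qed

lemma cross_direction: "cross3 e (e1 + r *\<^sub>R e2) \<bullet> E = e2 \<bullet> E - r * (e1 \<bullet> E)"
  by (simp add: cross_add_right cross_mult_right cross inner_add_left inner_diff_left)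

text \<open>Multiplied by 1 + r^2, the identity for the unit vector of slope r becomes quadratic in
  r; the three claims are its coefficients.\<close>

lemma shape_coefficients:
  assumes "\<And>c s. c\<^sup>2 + s\<^sup>2 = 1 \<Longrightarrow> bv c s \<bullet> tv c s \<noteq> 0 \<Longrightarrow>
      bv c s \<bullet> bv c s = t\<^sup>2 + d * (cross3 e (tv c s) \<bullet> E)\<^sup>2"
  shows "b1 \<bullet> b1 = t\<^sup>2 + d * (e2 \<bullet> E)\<^sup>2" "b2 \<bullet> b2 = t\<^sup>2 + d * (e1 \<bullet> E)\<^sup>2"
    "b1 \<bullet> b2 = - (d * (e1 \<bullet> E) * (e2 \<bullet> E))"
proof -
  have *: "(b1 \<bullet> b1 - t\<^sup>2 - d * (e2 \<bullet> E)\<^sup>2) + (2 * (b1 \<bullet> b2 + d * (e1 \<bullet> E) * (e2 \<bullet> E))) * r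
      + (b2 \<bullet> b2 - t\<^sup>2 - d * (e1 \<bullet> E)\<^sup>2) * r\<^sup>2 = 0" if r: "Q r" for r
  proof -
    define w where "w = sqrt (1 + r\<^sup>2)"
    note w = Q_direction[OF r, folded w_def]
    have "(1 / w)\<^sup>2 * ((b1 + r *\<^sub>R b2) \<bullet> (b1 + r *\<^sub>R b2)) =
        t\<^sup>2 + d * ((1 / w) * (e2 \<bullet> E - r * (e1 \<bullet> E)))\<^sup>2"
      using assms[OF w(2,3)] unfolding w(4,5)
      by (simp add: cross_mult_right cross_direction power2_eq_square)
    then have "(b1 + r *\<^sub>R b2) \<bullet> (b1 + r *\<^sub>R b2) = t\<^sup>2 * w\<^sup>2 + d * (e2 \<bullet> E - r * (e1 \<bullet> E))\<^sup>2"
      using w(1) by (simp add: field_simps power2_eq_square)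
    then show ?thesis
      unfolding w(6) by (simp add: inner_add_left inner_add_right inner_commute[of b2 b1] power2_eq_square algebra_simps)
  qed
  then show "b1 \<bullet> b1 = t\<^sup>2 + d * (e2 \<bullet> E)\<^sup>2" "b2 \<bullet> b2 = t\<^sup>2 + d * (e1 \<bullet> E)\<^sup>2"
    "b1 \<bullet> b2 = - (d * (e1 \<bullet> E) * (e2 \<bullet> E))"
    using quadratic_product_zero[OF * Q_coeffs] by (auto simp: Q_def)
qed

text \<open>The second identity factors into a linear polynomial in r, zero only if E has no
  tangential part, and a quadratic one. If e \<bullet> E \<noteq> 0 and the quadratic vanishes, then
  \<open>b1\<close>, \<open>b2\<close> are the images of \<open>e1\<close>, \<open>e2\<close> under
  a similarity of the tangent plane, hence orthogonal and of equal length;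
  \<open>shape_coefficients\<close> then removes the tangential part of E all the same.\<close>

lemma normal_or_tangent:
  assumes "d \<noteq> 0"
    and "\<And>c s. c\<^sup>2 + s\<^sup>2 = 1 \<Longrightarrow> bv c s \<bullet> tv c s \<noteq> 0 \<Longrightarrow>
      bv c s \<bullet> bv c s = t\<^sup>2 + d * (cross3 e (tv c s) \<bullet> E)\<^sup>2"
    and G: "\<And>c s. c\<^sup>2 + s\<^sup>2 = 1 \<Longrightarrow> bv c s \<bullet> tv c s \<noteq> 0 \<Longrightarrow>
      cross3 e (tv c s) \<bullet> E *
       (2 * (bv c s \<bullet> cross3 (tv c s) E) - t * (e \<bullet> E)) = 0"
  shows "e \<bullet> E = 0 \<or> (e1 \<bullet> E = 0 \<and> e2 \<bullet> E = 0)"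
proof -
  let ?n = "e \<bullet> E"
  have B: "b1 = (b1 \<bullet> e1) *\<^sub>R e1 + (b1 \<bullet> e2) *\<^sub>R e2" "b2 = (b2 \<bullet> e1) *\<^sub>R e1 + (b2 \<bullet> e2) *\<^sub>R e2"
    using expand[of b1] expand[of b2] b by simp_all
  have c21: "cross3 e2 e1 = - e" using e cross_skew[of e2 e1] by simp
  \<comment> \<open>b \<bullet> (v \<times> E) = (b \<times> v) \<bullet> E, and the cross product
    of two tangent vectors is a multiple of \<open>e\<close>.\<close>
  have X: "(b1 + r *\<^sub>R b2) \<bullet> cross3 (e1 + r *\<^sub>R e2) E =
    ?n * ((b1 \<bullet> e1 + r * (b2 \<bullet> e1)) * r - (b1 \<bullet> e2 + r * (b2 \<bullet> e2)))" for r
  proof -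
    define p1 q1 p2 q2 where "p1 = b1 \<bullet> e1" "q1 = b1 \<bullet> e2" "p2 = b2 \<bullet> e1" "q2 = b2 \<bullet> e2"
    have "b1 = p1 *\<^sub>R e1 + q1 *\<^sub>R e2" "b2 = p2 *\<^sub>R e1 + q2 *\<^sub>R e2"
      using B by (simp_all add: p1_q1_p2_q2_def)
    then have "cross3 (b1 + r *\<^sub>R b2) (e1 + r *\<^sub>R e2) = ((p1 + r * p2) * r - (q1 + r * q2)) *\<^sub>R e"
      by (simp add: cross_add_left cross_add_right cross_mult_left cross_mult_right c21 flip: e)
        (simp add: algebra_simps)
    moreover have "(b1 + r *\<^sub>R b2) \<bullet> cross3 (e1 + r *\<^sub>R e2) E = cross3 (b1 + r *\<^sub>R b2) (e1 + r *\<^sub>R e2) \<bullet> E"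
      by (metis cross3_inner_cyclic inner_commute)
    ultimately show ?thesis by (simp add: p1_q1_p2_q2_def)
  qed
  have *: "(e2 \<bullet> E + (- (e1 \<bullet> E)) * r) * ((?n * (- 2 * (b1 \<bullet> e2) - t)) + (?n * (2 * (b1 \<bullet> e1 - b2 \<bullet> e2))) * r
      + (?n * (2 * (b2 \<bullet> e1) - t)) * r\<^sup>2) = 0" if r: "Q r" for r
  proof -
    define w where "w = sqrt (1 + r\<^sup>2)"
    note w = Q_direction[OF r, folded w_def]
    have "(e2 \<bullet> E - r * (e1 \<bullet> E)) * (2 * ((b1 + r *\<^sub>R b2) \<bullet> cross3 (e1 + r *\<^sub>R e2) E) / w\<^sup>2 - t * ?n) = 0"
      using G[OF w(2,3)] w(1) unfolding w(4,5)
      by (simp add: cross_mult_right cross_mult_left cross_direction power2_eq_square)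
    then have "(e2 \<bullet> E - r * (e1 \<bullet> E)) * (2 * ((b1 + r *\<^sub>R b2) \<bullet> cross3 (e1 + r *\<^sub>R e2) E) - t * ?n * w\<^sup>2) = 0"
      using w(1) by (auto simp: field_simps)
    then show ?thesis
      unfolding w(6) X by (simp only: mult_eq_0_iff) (simp add: power2_eq_square algebra_simps)
  qed
  show ?thesis
  proof (rule ccontr)
    assume ne: "\<not> ?thesis"
    then have "2 * (b1 \<bullet> e2) = - t" "b1 \<bullet> e1 = b2 \<bullet> e2" "2 * (b2 \<bullet> e1) = t"
      using quadratic_linear_product_zero[OF * Q_coeffs] by (auto simp: Q_def)
    then have 1: "b2 \<bullet> e1 = t / 2" "b1 \<bullet> e2 = - (t / 2)" "b1 \<bullet> e1 = b2 \<bullet> e2" by auto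
    have bb: "b1 \<bullet> b1 = (b1 \<bullet> e1)\<^sup>2 + (b1 \<bullet> e2)\<^sup>2" "b2 \<bullet> b2 = (b2 \<bullet> e1)\<^sup>2 + (b2 \<bullet> e2)\<^sup>2"
       "b1 \<bullet> b2 = (b1 \<bullet> e1) * (b2 \<bullet> e1) + (b1 \<bullet> e2) * (b2 \<bullet> e2)"
      using inner_expand[of b1 b1] inner_expand[of b2 b2] inner_expand[of b1 b2] b
      by (simp_all add: power2_eq_square)
    have "b1 \<bullet> b2 = 0" "b1 \<bullet> b1 = b2 \<bullet> b2"
      unfolding bb 1 by (simp_all add: algebra_simps)
    then have "d * (e1 \<bullet> E) * (e2 \<bullet> E) = 0" "d * (e1 \<bullet> E)\<^sup>2 = d * (e2 \<bullet> E)\<^sup>2"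
      using shape_coefficients[OF assms(2)] by auto
    then have "(e1 \<bullet> E) * (e2 \<bullet> E) = 0" "(e1 \<bullet> E)\<^sup>2 = (e2 \<bullet> E)\<^sup>2" using assms(1) by auto
    then show False using ne by auto
  qed
qed

text \<open>The linear identity \<open>H\<close> gives b1 \<bullet> e1 = 0 and b2 \<bullet> e1 = t.
  The coefficients of the quadratic one then read (b1 \<bullet> e2)^2 = t^2, (b2 \<bullet> e2)^2 = d
  and (b1 \<bullet> e2) (b2 \<bullet> e2) = 0; since d \<noteq> 0, both b1 \<bullet> e2 and t are
  0.\<close>

lemma tangent_shape:
  assumes "d \<noteq> 0" and E: "e1 = E"
    and "\<And>c s. c\<^sup>2 + s\<^sup>2 = 1 \<Longrightarrow> bv c s \<bullet> tv c s \<noteq> 0 \<Longrightarrow>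
      bv c s \<bullet> bv c s = t\<^sup>2 + d * (cross3 e (tv c s) \<bullet> E)\<^sup>2"
    and H: "\<And>c s. c\<^sup>2 + s\<^sup>2 = 1 \<Longrightarrow> bv c s \<bullet> tv c s \<noteq> 0 \<Longrightarrow>
      bv c s \<bullet> E + t * (e \<bullet> cross3 (tv c s) E) = 0"
  shows "t = 0" "b1 = 0" "b2 = (b2 \<bullet> e2) *\<^sub>R e2" "(b2 \<bullet> e2)\<^sup>2 = d"
proof -
  have x: "e1 \<bullet> E = 1" "e2 \<bullet> E = 0" using E e1 e12 by (auto simp: inner_commute)
  have *: "(b1 \<bullet> E + t * (e2 \<bullet> E)) + (b2 \<bullet> E - t * (e1 \<bullet> E)) * r + 0 * r\<^sup>2 = 0" if r: "Q r" for r
  proof -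
    define w where "w = sqrt (1 + r\<^sup>2)"
    note w = Q_direction[OF r, folded w_def]
    have eq: "e \<bullet> cross3 (e1 + r *\<^sub>R e2) E = e2 \<bullet> E - r * (e1 \<bullet> E)"
      using cross_direction[of r] by (metis cross3_inner_cyclic inner_commute)
    have "(1 / w) * ((b1 + r *\<^sub>R b2) \<bullet> E + t * (e2 \<bullet> E - r * (e1 \<bullet> E))) = 0"
      using H[OF w(2,3)] unfolding w(4,5) cross_mult_left inner_scaleR_left inner_scaleR_right eq
      by (simp only: distrib_left mult.left_commute)
    then have "(b1 + r *\<^sub>R b2) \<bullet> E + t * (e2 \<bullet> E - r * (e1 \<bullet> E)) = 0"
      using w(1) by (auto simp only: mult_eq_0_iff divide_eq_0_iff)
    then show ?thesis by (simp add: inner_add_left algebra_simps)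
  qed
  have p: "b1 \<bullet> e1 = 0" "b2 \<bullet> e1 = t"
    using quadratic_product_zero[OF *[unfolded Q_def] Q_coeffs] x E by auto
  have B: "b1 = (b1 \<bullet> e2) *\<^sub>R e2" "b2 = t *\<^sub>R e1 + (b2 \<bullet> e2) *\<^sub>R e2"
    using expand[of b1] expand[of b2] b p by simp_all
  have bb: "b1 \<bullet> b1 = (b1 \<bullet> e2)\<^sup>2" "b2 \<bullet> b2 = t\<^sup>2 + (b2 \<bullet> e2)\<^sup>2" "b1 \<bullet> b2 = (b1 \<bullet> e2) * (b2 \<bullet> e2)"
    using inner_expand[of b1 b1] inner_expand[of b2 b2] inner_expand[of b1 b2] b p
    by (simp_all add: power2_eq_square)
  have q: "(b1 \<bullet> e2)\<^sup>2 = t\<^sup>2" "(b2 \<bullet> e2)\<^sup>2 = d" "(b1 \<bullet> e2) * (b2 \<bullet> e2) = 0"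
    using shape_coefficients[OF assms(3)] bb x by auto
  then have q1: "b1 \<bullet> e2 = 0" using assms(1) by auto
  then show "t = 0" using q by auto
  then show "b1 = 0" "b2 = (b2 \<bullet> e2) *\<^sub>R e2" "(b2 \<bullet> e2)\<^sup>2 = d" using B q1 q by simp_all
qed

end

end

section \<open>Surface patches\<close>

text \<open>Cramer's rule in the basis u, v, w, multiplied by the determinant so that no
  independence has to be assumed.\<close>

lemma cramer3:
  "(cross3 u v \<bullet> w) *\<^sub>R x = (cross3 x v \<bullet> w) *\<^sub>R u + (cross3 u x \<bullet> w) *\<^sub>R v + (cross3 u v \<bullet> x) *\<^sub>R w"
  for u v w x :: "real^3"
  by (intro real3_eqI) (simp_all add: inner_real3 cross3_nth algebra_simps)

lemma has_derivative_locally_const: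
  assumes "(g has_derivative g') (at q)" "open S" "q \<in> S" "\<And>p. p \<in> S \<Longrightarrow> g p = k"
  shows "g' u = 0"
proof -
  have "((\<lambda>_. k) has_derivative g') (at q)"
    by (rule has_derivative_transform_within_open[OF assms(1-4)])
  then have "g' = (\<lambda>_. 0)" by (rule has_derivative_unique) (rule has_derivative_const)
  then show ?thesis by simp
qed

text \<open>A surface in one chart: \<open>f\<close> is the immersion and \<open>n\<close> the unit
  normal, both as functions of the coordinates in \<open>P\<close>.\<close>

locale surface_patch =
  fixes a b :: real and P :: "(real^2) set" and f n :: "real^2 \<Rightarrow> real^3"
  assumes open_P: "open P" and smooth_f: "smooth_on P f" and f_in: "f ` P \<subseteq> bcv_space a b"
    and smooth_n: "smooth_on P n"
    and metric_unit: "\<And>q. q \<in> P \<Longrightarrow> bcv_metric a b (f q) (n q) (n q) = 1"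
    and metric_normal: "\<And>q v. q \<in> P \<Longrightarrow> bcv_metric a b (f q) (frechet_derivative f (at q) v) (n q) = 0"
    and inj_f: "\<And>q. q \<in> P \<Longrightarrow> inj (frechet_derivative f (at q))"
begin

definition F where "F q v = coframe a b (f q) (frechet_derivative f (at q) v)"
definition e where "e q = coframe a b (f q) (n q)"
definition DF where "DF q u v = frechet_derivative (\<lambda>q. F q v) (at q) u"
text \<open>The covariant derivative of the unit normal in direction u, in frame components: the
  negative of the shape operator.\<close>

definition B where "B q u = frechet_derivative e (at q) u + cross3 (conn_vec a b (f q) (F q u)) (e q)"

abbreviation "frame_vel c \<equiv> \<lambda>t. coframe a b (f (c t)) (velocity (\<lambda>t. f (c t)) t)"

abbreviation "W q u \<equiv> conn_vec a b (f q) (F q u)"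

lemma in_space: "q \<in> P \<Longrightarrow> f q \<in> bcv_space a b"
  using f_in by auto

lemma smooth_F: "smooth_on P (\<lambda>q. F q v)"
  unfolding F_def by (intro smooth_on_coframe smooth_on_frechet smooth_f f_in open_P)

lemma smooth_e: "smooth_on P e"
  unfolding e_def[abs_def] by (intro smooth_on_coframe smooth_f smooth_n f_in open_P)

lemma linear_F: "q \<in> P \<Longrightarrow> linear (F q)"
  unfolding F_def[abs_def]
  using linear_compose[OF smooth_on_frechet_linear[OF smooth_f] linear_coframe] by (simp add: o_def)

lemma unit_e: "q \<in> P \<Longrightarrow> e q \<bullet> e q = 1"
  using metric_unit by (simp add: e_def bcv_metric_frame)

lemma normal_F: "q \<in> P \<Longrightarrow> F q v \<bullet> e q = 0"
  using metric_normal by (simp add: e_def F_def bcv_metric_frame)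

lemma normal_F': "q \<in> P \<Longrightarrow> e q \<bullet> F q v = 0"
  using normal_F by (simp add: inner_commute)

lemma inj_F: "q \<in> P \<Longrightarrow> inj (F q)"
  unfolding inj_def F_def using coframe_eq_iff[OF in_space] inj_f by (metis injD)

lemma F_eq_0: "q \<in> P \<Longrightarrow> F q v = 0 \<longleftrightarrow> v = 0"
  using inj_F linear_F by (metis injD linear_0)

lemma linear_B: "q \<in> P \<Longrightarrow> linear (B q)"
  unfolding B_def[abs_def]
  using smooth_on_frechet_linear[OF smooth_e] linear_compose[OF linear_F conn_vec_linear]
  by (intro linear_compose_add linear_compose[OF linear_compose[OF linear_F conn_vec_linear],
      of q "\<lambda>w. cross3 w (e q)" for q, unfolded o_def])
    (auto intro!: linearI simp: cross_add_left cross_mult_left)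

lemma F_DF: assumes "q \<in> P"
  shows "((\<lambda>q. F q v) has_derivative (\<lambda>u. DF q u v)) (at q)"
  unfolding DF_def by (rule smooth_on_has_derivative[OF smooth_F assms])

lemma DF_eq:
  assumes "q \<in> P"
  shows "DF q u v = coframe_deriv a b (f q) (frechet_derivative f (at q) u) (frechet_derivative f (at q) v)
    + coframe a b (f q) (frechet_derivative (\<lambda>q. frechet_derivative f (at q) v) (at q) u)"
proof -
  have "((\<lambda>q. F q v) has_derivative (\<lambda>u. coframe_deriv a b (f q) (frechet_derivative f (at q) u) (frechet_derivative f (at q) v)
    + coframe a b (f q) (frechet_derivative (\<lambda>q. frechet_derivative f (at q) v) (at q) u))) (at q)"
    unfolding F_def
    by (rule has_derivative_coframe[OF in_space[OF assms] smooth_on_has_derivative[OF smooth_f assms]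
          smooth_on_has_derivative[OF smooth_on_frechet[OF smooth_f] assms] refl])
  from frechet_derivative_at[OF this, symmetric] show ?thesis by (simp add: DF_def)
qed

text \<open>The second derivatives of \<open>f\<close> are symmetric and cancel, which leaves
  \<open>coframe_torsion\<close>. It is the source of the symmetry of the second fundamental
  form.\<close>

lemma torsion:
  assumes "q \<in> P"
  shows "DF q u v + cross3 (W q u) (F q v) = DF q v u + cross3 (W q v) (F q u)"
  using coframe_torsion[OF in_space[OF assms], of "frechet_derivative f (at q) u" "frechet_derivative f (at q) v"]
    second_derivative_symmetric[OF open_P smooth_f assms, of u v]
  unfolding DF_eq[OF assms] F_def by (simp add: algebra_simps)

lemma linear_DF: assumes "q \<in> P" shows "linear (DF q u)"
proof (rule linearI)
  have lin: "F q' (v + v') = F q' v + F q' v'" "F q' (r *\<^sub>R v) = r *\<^sub>R F q' v" if "q' \<in> P" for q' v v' r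
    using linear_F[OF that] by (simp_all add: linear_add linear_scale)
  show "DF q u (v + v') = DF q u v + DF q u v'" for v v'
  proof -
    have "((\<lambda>q. F q v + F q v') has_derivative (\<lambda>u. DF q u v + DF q u v')) (at q)"
      by (intro has_derivative_add F_DF assms)
    from frechet_derivative_at[OF this, symmetric] show ?thesis
      unfolding DF_def[of q u "v + v'"] using frechet_derivative_cong_open[OF open_P assms lin(1)] by simp
  qed
  show "DF q u (r *\<^sub>R v) = r *\<^sub>R DF q u v" for r v
  proof -
    have "((\<lambda>q. r *\<^sub>R F q v) has_derivative (\<lambda>u. r *\<^sub>R DF q u v)) (at q)"
      by (intro has_derivative_scaleR_right F_DF assms)
    from frechet_derivative_at[OF this, symmetric] show ?thesis
      unfolding DF_def[of q u "r *\<^sub>R v"] using frechet_derivative_cong_open[OF open_P assms lin(2)] by simp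
  qed
qed

definition second_form where "second_form q u v = (DF q u v + cross3 (W q u) (F q v)) \<bullet> e q"

lemma second_form_eq:
  assumes "q \<in> P"
  shows "bcv_metric a b (f q) (frechet_derivative (\<lambda>q. frechet_derivative f (at q) v) (at q) u
     + christoffel (bcv_metric a b) (f q) (frechet_derivative f (at q) u) (frechet_derivative f (at q) v)) (n q)
   = second_form q u v"
  unfolding second_form_def bcv_metric_frame[of a b "f q" _ "n q"] DF_eq[OF assms] e_def
  by (simp add: linear_add[OF linear_coframe] coframe_christoffel[OF in_space[OF assms]] F_def add.assoc add.left_commute)

lemma second_form_sym: "q \<in> P \<Longrightarrow> second_form q u v = second_form q v u"
  unfolding second_form_def using torsion by simp

text \<open>The Weingarten equation: differentiate <F v, e> = 0 and let the connection terms cancel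
  by skewness.\<close>

lemma second_form_B:
  assumes "q \<in> P"
  shows "second_form q u v = - (F q v \<bullet> B q u)"
proof -
  have d: "((\<lambda>q. F q v \<bullet> e q) has_derivative (\<lambda>u. F q v \<bullet> frechet_derivative e (at q) u + DF q u v \<bullet> e q)) (at q)"
    by (intro has_derivative_inner F_DF assms smooth_on_has_derivative[OF smooth_e])
  have "F q v \<bullet> frechet_derivative e (at q) u + DF q u v \<bullet> e q = 0"
    by (rule has_derivative_locally_const[OF d open_P assms normal_F])
  then show ?thesis
    using cross3_triple[of "W q u" "F q v" "e q"]
    unfolding second_form_def B_def by (simp add: inner_add_left inner_add_right)
qed

lemma B_normal: assumes "q \<in> P" shows "B q u \<bullet> e q = 0"
proof -
  have d: "((\<lambda>q. e q \<bullet> e q) has_derivative (\<lambda>u. e q \<bullet> frechet_derivative e (at q) u + frechet_derivative e (at q) u \<bullet> e q)) (at q)"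
    by (intro has_derivative_inner assms smooth_on_has_derivative[OF smooth_e])
  have "e q \<bullet> frechet_derivative e (at q) u + frechet_derivative e (at q) u \<bullet> e q = 0"
    by (rule has_derivative_locally_const[OF d open_P assms unit_e])
  then show ?thesis
    unfolding B_def inner_add_left
    by (simp add: dot_cross_self inner_commute[of "e q" "frechet_derivative e (at q) u"])
qed

definition J where "J q = cross3 (F q (axis 1 1)) (F q (axis 2 1)) \<bullet> e q"

text \<open>If J = 0, then u \<times> v is orthogonal to the normal; being also a multiple of it, it
  vanishes, and the coordinate vectors are dependent, against the injectivity of
  \<open>F q\<close>.\<close>

lemma J_nonzero:
  assumes "q \<in> P" shows "J q \<noteq> 0"
proof
  assume J: "J q = 0"
  let ?u = "F q (axis 1 1)" and ?v = "F q (axis 2 1)" and ?e = "e q"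
  have "(?e \<bullet> ?e) *\<^sub>R cross3 ?u ?v = (cross3 ?u ?v \<bullet> ?e) *\<^sub>R ?e - cross3 ?e ((?e \<bullet> ?v) *\<^sub>R ?u - (?e \<bullet> ?u) *\<^sub>R ?v)"
    by (intro real3_eqI) (simp_all add: inner_real3 cross3_nth algebra_simps)
  then have "cross3 ?u ?v = 0"
    using J unit_e[OF assms] normal_F'[OF assms] by (simp add: J_def)
  moreover have "(?u \<bullet> ?u) *\<^sub>R ?v - (?u \<bullet> ?v) *\<^sub>R ?u = cross3 (cross3 ?u ?v) ?u"
    by (intro real3_eqI) (simp_all add: inner_real3 cross3_nth algebra_simps)
  ultimately have "F q ((?u \<bullet> ?u) *\<^sub>R axis 2 1 - (?u \<bullet> ?v) *\<^sub>R axis 1 1) = 0"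
    by (simp add: linear_diff[OF linear_F[OF assms]] linear_scale[OF linear_F[OF assms]])
  then have "(?u \<bullet> ?u) *\<^sub>R axis 2 1 - (?u \<bullet> ?v) *\<^sub>R axis 1 1 = (0 :: real^2)"
    using F_eq_0[OF assms] by blast
  from arg_cong[OF this, of "\<lambda>v. v $ 2"] have "?u \<bullet> ?u = 0" by (simp add: axis_def)
  then have "axis 1 1 = (0 :: real^2)" using F_eq_0[OF assms] by simp
  then show False by (simp add: axis_eq_0_iff)
qed

text \<open>Cramer's rule for the tangential part of \<open>X\<close>; it makes the geodesic equation an explicit smooth system.\<close>

definition tangent_coords where
  "tangent_coords q X = (cross3 X (F q (axis 2 1)) \<bullet> e q / J q) *\<^sub>R axis 1 1
     + (cross3 (F q (axis 1 1)) X \<bullet> e q / J q) *\<^sub>R (axis 2 1 :: real^2)"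

lemma F_tangent_coords:
  assumes "q \<in> P"
  shows "F q (tangent_coords q X) = X - (X \<bullet> e q) *\<^sub>R e q"
proof -
  let ?u = "F q (axis 1 1)" and ?v = "F q (axis 2 1)"
  have "J q *\<^sub>R F q (tangent_coords q X) = (cross3 X ?v \<bullet> e q) *\<^sub>R ?u + (cross3 ?u X \<bullet> e q) *\<^sub>R ?v"
    using J_nonzero[OF assms] unfolding tangent_coords_def
    by (simp add: linear_add[OF linear_F[OF assms]] linear_scale[OF linear_F[OF assms]] scaleR_add_right)
  also have "\<dots> = J q *\<^sub>R X - (cross3 ?u ?v \<bullet> X) *\<^sub>R e q"
    unfolding J_def using cramer3[of ?u ?v "e q" X] by (simp add: algebra_simps)
  finally have *: "J q *\<^sub>R F q (tangent_coords q X) = J q *\<^sub>R X - (cross3 ?u ?v \<bullet> X) *\<^sub>R e q" .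
  from arg_cong[OF this, of "\<lambda>v. v \<bullet> e q"] have "cross3 ?u ?v \<bullet> X = J q * (X \<bullet> e q)"
    using unit_e[OF assms] normal_F[OF assms] by (simp add: inner_diff_left)
  with * have "J q *\<^sub>R F q (tangent_coords q X) = J q *\<^sub>R (X - (X \<bullet> e q) *\<^sub>R e q)"
    by (simp add: scaleR_diff_right)
  then show ?thesis using J_nonzero[OF assms] by simp
qed

lemma F_onto: "q \<in> P \<Longrightarrow> X \<bullet> e q = 0 \<Longrightarrow> \<exists>u. F q u = X"
  using F_tangent_coords[of q X] by auto

lemma tangent_range:
  assumes "q \<in> P" "coframe a b (f q) X \<bullet> e q = 0"
  shows "X \<in> range (frechet_derivative f (at q))"
proof -
  obtain u where "F q u = coframe a b (f q) X" using F_onto[OF assms] by blast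
  then have "frechet_derivative f (at q) u = X"
    by (simp add: F_def coframe_eq_iff[OF in_space[OF assms(1)]])
  then show ?thesis by blast
qed

context
  fixes I :: "real set" and c :: "real \<Rightarrow> real^2"
  assumes I: "open I" and smooth_c: "smooth_on I c" and c_in: "c ` I \<subseteq> P"
begin

lemma velocity_f: assumes "t \<in> I" shows "velocity (\<lambda>t. f (c t)) t = frechet_derivative f (at (c t)) (velocity c t)"
proof -
  have p: "c t \<in> P" using assms c_in by auto
  have "(c has_derivative (\<lambda>h. h *\<^sub>R velocity c t)) (at t)"
    using smooth_on_has_vector_derivative[OF smooth_c assms] by (simp add: velocity_def has_vector_derivative_def)
  from diff_chain_at[OF this smooth_on_has_derivative[OF smooth_f p]]
  have "((\<lambda>t. f (c t)) has_vector_derivative frechet_derivative f (at (c t)) (velocity c t)) (at t)"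
    by (simp add: has_vector_derivative_def o_def linear_scale[OF smooth_on_frechet_linear[OF smooth_f p]])
  then show ?thesis unfolding velocity_def by (rule vector_derivative_at)
qed

lemma frame_velocity: "t \<in> I \<Longrightarrow> frame_vel c t = F (c t) (velocity c t)"
  by (simp add: velocity_f F_def)

lemma smooth_fc: "smooth_on I (\<lambda>t. f (c t))"
  by (rule smooth_on_compose[OF I open_P c_in smooth_c smooth_f])

lemma smooth_ec: "smooth_on I (\<lambda>t. e (c t))"
  by (rule smooth_on_compose[OF I open_P c_in smooth_c smooth_e])

lemma smooth_v: "smooth_on I (velocity c)"
  unfolding velocity_def[abs_def] by (rule smooth_on_vector_derivative[OF I smooth_c])

lemma frame_cov_e: assumes "t \<in> I"
  shows "frame_cov a b (\<lambda>t. f (c t)) (\<lambda>t. e (c t)) t = B (c t) (velocity c t)"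
proof -
  have p: "c t \<in> P" using assms c_in by auto
  have "(c has_derivative (\<lambda>h. h *\<^sub>R velocity c t)) (at t)"
    using smooth_on_has_vector_derivative[OF smooth_c assms] by (simp add: velocity_def has_vector_derivative_def)
  from diff_chain_at[OF this smooth_on_has_derivative[OF smooth_e p]]
  have "((\<lambda>t. e (c t)) has_vector_derivative frechet_derivative e (at (c t)) (velocity c t)) (at t)"
    by (simp add: has_vector_derivative_def o_def linear_scale[OF smooth_on_frechet_linear[OF smooth_e p]])
  then show ?thesis
    unfolding frame_cov_def B_def by (simp add: vector_derivative_at frame_velocity[OF assms])
qed

text \<open>Base point and argument of \<open>F\<close> both move; expanding the velocity in
  \<open>Basis\<close> separates the two contributions.\<close>

lemma F_velocity_derivative:
  assumes "t \<in> I"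
  shows "((\<lambda>t. F (c t) (velocity c t)) has_vector_derivative
     DF (c t) (velocity c t) (velocity c t) + F (c t) (vector_derivative (velocity c) (at t))) (at t)"
proof -
  let ?v = "velocity c" and ?a = "vector_derivative (velocity c) (at t)"
  have p: "c s \<in> P" if "s \<in> I" for s using that c_in by auto
  have 1: "((\<lambda>s. F (c s) i) has_vector_derivative DF (c t) (?v t) i) (at t)" for i
  proof -
    have "(c has_derivative (\<lambda>h. h *\<^sub>R velocity c t)) (at t)"
      using smooth_on_has_vector_derivative[OF smooth_c assms] by (simp add: velocity_def has_vector_derivative_def)
    from diff_chain_at[OF this F_DF[OF p[OF assms], of i]] show ?thesis
      using linear_scale[OF smooth_on_frechet_linear[OF smooth_F p[OF assms]]]
      by (simp add: has_vector_derivative_def o_def DF_def)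
  qed
  have 2: "((\<lambda>s. ?v s \<bullet> i) has_vector_derivative ?a \<bullet> i) (at t)" for i
    using bounded_linear.has_vector_derivative[OF bounded_linear_inner_left smooth_on_has_vector_derivative[OF smooth_v assms]] .
  have "((\<lambda>s. \<Sum>i\<in>Basis. (?v s \<bullet> i) *\<^sub>R F (c s) i) has_vector_derivative
      (\<Sum>i\<in>Basis. (?v t \<bullet> i) *\<^sub>R DF (c t) (?v t) i + (?a \<bullet> i) *\<^sub>R F (c t) i)) (at t)"
    by (intro has_vector_derivative_sum bounded_bilinear.has_vector_derivative[OF bounded_bilinear_scaleR] 1 2)
  also have "(\<Sum>i\<in>Basis. (?v t \<bullet> i) *\<^sub>R DF (c t) (?v t) i + (?a \<bullet> i) *\<^sub>R F (c t) i) = DF (c t) (?v t) (?v t) + F (c t) ?a"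
    using linear_expand[OF linear_DF[OF p[OF assms]], of "?v t" "?v t"] linear_expand[OF linear_F[OF p[OF assms]], of ?a]
    by (simp add: sum.distrib)
  finally have d: "((\<lambda>s. \<Sum>i\<in>Basis. (?v s \<bullet> i) *\<^sub>R F (c s) i) has_vector_derivative
      DF (c t) (?v t) (?v t) + F (c t) ?a) (at t)" .
  show ?thesis
    unfolding has_vector_derivative_def
    by (rule has_derivative_transform_within_open[OF d[unfolded has_vector_derivative_def] I assms])
      (rule linear_expand[OF linear_F[OF p], symmetric])
qed

lemma frame_acceleration:
  assumes "t \<in> I"
  shows "frame_cov a b (\<lambda>t. f (c t)) (frame_vel c) t =
    DF (c t) (velocity c t) (velocity c t) + F (c t) (vector_derivative (velocity c) (at t))
      + cross3 (W (c t) (velocity c t)) (F (c t) (velocity c t))"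
proof -
  have "frame_cov a b (\<lambda>t. f (c t)) (frame_vel c) t =
      frame_cov a b (\<lambda>t. f (c t)) (\<lambda>t. F (c t) (velocity c t)) t"
    by (rule frame_cov_cong_open[OF I assms frame_velocity])
  then show ?thesis
    unfolding frame_cov_def by (simp add: vector_derivative_at[OF F_velocity_derivative[OF assms]] frame_velocity[OF assms])
qed

end

lemma pullback_frame: "pullback f (bcv_metric a b) q u v = F q u \<bullet> F q v"
  by (simp add: pullback_def bcv_metric_frame F_def)

lemma pullback_metric_deriv:
  assumes "q \<in> P"
  shows "metric_deriv (pullback f (bcv_metric a b)) q u v w = DF q u v \<bullet> F q w + F q v \<bullet> DF q u w"
proof -
  have "((\<lambda>q. F q v \<bullet> F q w) has_derivative (\<lambda>u. F q v \<bullet> DF q u w + DF q u v \<bullet> F q w)) (at q)"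
    by (intro has_derivative_inner F_DF assms)
  from frechet_derivative_at[OF this, symmetric] show ?thesis
    by (simp add: metric_deriv_def pullback_frame)
qed

text \<open>The hypothesis says that the ambient acceleration of a curve with velocity u and
  coordinate acceleration w is normal. Paired with tangent vectors it is the Koszul formula of the
  induced metric; uniqueness comes from the injectivity of \<open>F q\<close>.\<close>

lemma pullback_christoffel:
  assumes q: "q \<in> P" and w: "\<And>z. (DF q u u + F q w + cross3 (W q u) (F q u)) \<bullet> F q z = 0"
  shows "christoffel (pullback f (bcv_metric a b)) q u u = - w"
proof (rule christoffel_eqI)
  fix z
  have "DF q z u = DF q u z + cross3 (W q u) (F q z) - cross3 (W q z) (F q u)"
    using torsion[OF q, of u z] by (simp add: algebra_simps)
  moreover have "F q u \<bullet> cross3 (W q z) (F q u) = 0" "F q u \<bullet> cross3 (W q u) (F q z) = - (cross3 (W q u) (F q u) \<bullet> F q z)"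
    using cross3_triple[of "W q u" "F q u" "F q z"] by (simp_all add: dot_cross_self)
  moreover have "- (F q w \<bullet> F q z) = DF q u u \<bullet> F q z + cross3 (W q u) (F q u) \<bullet> F q z"
    using w[of z] by (simp add: inner_add_left)
  ultimately show "2 * pullback f (bcv_metric a b) q (- w) z = metric_deriv (pullback f (bcv_metric a b)) q u u z
      + metric_deriv (pullback f (bcv_metric a b)) q u u z - metric_deriv (pullback f (bcv_metric a b)) q z u u"
    unfolding pullback_metric_deriv[OF q] pullback_frame
    by (simp add: linear_neg[OF linear_F[OF q]] inner_commute[of _ "F q u"] inner_add_right inner_diff_right)
next
  fix w' assume "\<And>z. pullback f (bcv_metric a b) q w' z = pullback f (bcv_metric a b) q (- w) z"
  then have "F q (w' - - w) \<bullet> F q (w' - - w) = 0"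
    unfolding pullback_frame linear_diff[OF linear_F[OF q]] by (simp add: inner_diff_left inner_diff_right)
  then have "F q (w' - - w) = 0" by simp
  then show "w' = - w" using F_eq_0[OF q] by (metis eq_iff_diff_eq_0)
qed

lemma pullback_geodesicI:
  assumes I: "open I" and c: "smooth_on I c" "c ` I \<subseteq> P" and t: "t \<in> I"
    and acc: "frame_cov a b (\<lambda>t. f (c t)) (frame_vel c) t = r *\<^sub>R e (c t)"
  shows "cov_along (pullback f (bcv_metric a b)) c (velocity c) t = 0"
proof -
  have q: "c t \<in> P" using c t by auto
  have "christoffel (pullback f (bcv_metric a b)) (c t) (velocity c t) (velocity c t) = - vector_derivative (velocity c) (at t)"
    using acc[unfolded frame_acceleration[OF I c t]] normal_F[OF q]
    by (intro pullback_christoffel[OF q]) (simp add: inner_commute)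
  then show ?thesis by (simp add: cov_along_def)
qed

text \<open>A first-order system for position and velocity in which the coordinate acceleration
  cancels the tangential part of the ambient acceleration. The speed is constant because the
  acceleration is normal.\<close>

lemma geodesic_patch_exists:
  assumes q0: "q0 \<in> P" and u0: "F q0 u0 \<bullet> F q0 u0 = 1"
  obtains r c where "r > 0" "smooth_on {-r<..<r} c" "c ` {-r<..<r} \<subseteq> P" "c 0 = q0" "velocity c 0 = u0"
    "\<And>t. t \<in> {-r<..<r} \<Longrightarrow> \<exists>k. frame_cov a b (\<lambda>t. f (c t)) (frame_vel c) t = k *\<^sub>R e (c t)"
    "\<And>t. t \<in> {-r<..<r} \<Longrightarrow> F (c t) (velocity c t) \<bullet> F (c t) (velocity c t) = 1"
proof -
  \<comment> \<open>The ambient acceleration without the image of the coordinate acceleration; the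
    sum over \<open>Basis\<close> expands \<open>DF\<close> in the moving velocity and so makes
    smoothness visible.\<close>
  define S where "S z = (\<Sum>j\<in>Basis. (snd z \<bullet> j) *\<^sub>R DF (fst z) (snd z) j) +
      cross3 (W (fst z) (snd z)) (F (fst z) (snd z))" for z
  define G where "G z = (snd z, - tangent_coords (fst z) (S z))" for z
  let ?D = "P \<times> (UNIV :: (real^2) set)"
  have oD: "open ?D" by (intro open_Times open_P) simp
  have sfst: "smooth_on ?D fst" and ssnd: "smooth_on ?D snd"
    by (intro smooth_on_linear oD bounded_linear_fst bounded_linear_snd)+
  have imf: "fst ` ?D \<subseteq> P" by auto
  note comp = smooth_on_compose[OF oD open_P imf sfst]
  have sF: "smooth_on ?D (\<lambda>z. F (fst z) (snd z))"
    unfolding F_def using f_in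
    by (intro smooth_on_coframe smooth_on_frechet_apply[OF oD open_P imf sfst ssnd smooth_f]
        comp[OF smooth_f] oD) auto
  have sS: "smooth_on ?D S"
    unfolding S_def[abs_def] DF_def
    by (intro smooth_on_add smooth_on_sum smooth_on_scaleR smooth_on_inner smooth_on_cross3
        smooth_on_conn_vec smooth_on_frechet_apply[OF oD open_P imf sfst ssnd smooth_F]
        comp[OF smooth_f] sF ssnd smooth_on_const oD)
  have sG: "smooth_on ?D G"
    unfolding G_def[abs_def] tangent_coords_def J_def using J_nonzero
    by (intro smooth_on_Pair smooth_on_minus smooth_on_add smooth_on_scaleR smooth_on_const smooth_on_divide
        smooth_on_inner smooth_on_cross3 sS comp[OF smooth_e] comp[OF smooth_F] ssnd oD) (auto simp: J_def)
  obtain r z where r: "r > 0" "z 0 = (q0, u0)" "smooth_on {-r<..<r} z" "z ` {-r<..<r} \<subseteq> ?D"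
    "\<And>t. \<bar>t\<bar> < r \<Longrightarrow> (z has_vector_derivative G (z t)) (at t)"
    using smooth_ode_exists[OF oD sG, of "(q0, u0)"] q0 by blast
  let ?I = "{-r<..<r}"
  define c where "c t = fst (z t)" for t
  have sc: "smooth_on ?I c" unfolding c_def[abs_def] by (intro smooth_on_fst r) simp
  have cO: "c ` ?I \<subseteq> P" using r(4) by (auto simp: c_def)
  have v: "velocity c t = snd (z t)" if "t \<in> ?I" for t
  proof -
    have "(c has_vector_derivative fst (G (z t))) (at t)"
      unfolding c_def[abs_def] using r(5)[of t] that
      by (intro bounded_linear.has_vector_derivative[OF bounded_linear_fst]) auto
    then show ?thesis unfolding velocity_def by (simp add: vector_derivative_at G_def)
  qed
  have acc: "vector_derivative (velocity c) (at t) = - tangent_coords (c t) (S (z t))" if "t \<in> ?I" for t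
  proof -
    have "((\<lambda>t. snd (z t)) has_vector_derivative snd (G (z t))) (at t)"
      using r(5)[of t] that by (intro bounded_linear.has_vector_derivative[OF bounded_linear_snd]) auto
    then have "vector_derivative (\<lambda>t. snd (z t)) (at t) = - tangent_coords (c t) (S (z t))"
      by (simp add: vector_derivative_at G_def c_def)
    then show ?thesis using vector_derivative_cong_open[OF _ that v] by simp
  qed
  have SS: "S (z t) = DF (c t) (velocity c t) (velocity c t) + cross3 (W (c t) (velocity c t)) (F (c t) (velocity c t))"
    if "t \<in> ?I" for t
    unfolding S_def v[OF that] c_def[symmetric]
    using cO that by (subst linear_expand[OF linear_DF, of "c t" _ "snd (z t)"]) auto
  have oI: "open ?I" by simp
  have geo: "frame_cov a b (\<lambda>t. f (c t)) (frame_vel c) t =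
      (S (z t) \<bullet> e (c t)) *\<^sub>R e (c t)" if "t \<in> ?I" for t
  proof -
    have q: "c t \<in> P" using cO that by auto
    show ?thesis
      unfolding frame_acceleration[OF oI sc cO that] acc[OF that] linear_neg[OF linear_F[OF q]] F_tangent_coords[OF q]
      using SS[OF that] by simp
  qed
  define T where "T = (frame_vel c)"
  have sT: "smooth_on ?I T"
    unfolding T_def velocity_def using smooth_fc[OF oI sc cO] f_in cO
    by (intro smooth_on_coframe smooth_on_vector_derivative oI) auto
  have TF: "T t = F (c t) (velocity c t)" if "t \<in> ?I" for t
    unfolding T_def by (rule frame_velocity[OF oI sc cO that])
  have "T t \<bullet> T t = T 0 \<bullet> T 0" if "t \<in> ?I" for t
  proof (rule real_derivative_zero_interval[OF oI _ _ that])
    fix t assume t: "t \<in> ?I"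
    have q: "c t \<in> P" using cO t by auto
    show "((\<lambda>t. T t \<bullet> T t) has_real_derivative 0) (at t)"
      using frame_cov_inner[OF sT sT t, of a b "\<lambda>t. f (c t)"]
      unfolding geo[OF t, folded T_def] unfolding TF[OF t] by (simp add: normal_F[OF q] normal_F'[OF q])
  qed (use r in \<open>auto simp: is_interval_oo\<close>)
  moreover have "0 \<in> ?I" using r by simp
  ultimately have unit: "F (c t) (velocity c t) \<bullet> F (c t) (velocity c t) = 1" if "t \<in> ?I" for t
    using that TF TF[of 0] u0 v[of 0] r(2) by (simp add: c_def)
  have v0: "velocity c 0 = u0" using v[of 0] r by simp
  have c0: "c 0 = q0" using r by (simp add: c_def)
  show ?thesis
    by (rule that[OF r(1) sc cO c0 v0 _ unit]) (use geo in blast)+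
qed

end

section \<open>Totally biharmonic patches\<close>

text \<open>One short biharmonic geodesic for each point and unit direction is assumed, in ambient
  terms only; an atlas is not mentioned, so the pointwise analysis takes place in a single
  patch.\<close>

locale biharmonic_patch = surface_patch +
  assumes generic: "4 * a \<noteq> b\<^sup>2"
    and biharmonic_geodesics: "\<And>q u. q \<in> P \<Longrightarrow> F q u \<bullet> F q u = 1 \<Longrightarrow>
      \<exists>r c. r > 0 \<and> smooth_on {-r<..<r} c \<and> c ` {-r<..<r} \<subseteq> P \<and> c 0 = q \<and> velocity c 0 = u \<and>
        (\<forall>t\<in>{-r<..<r}. \<exists>k. frame_cov a b (\<lambda>t. f (c t))
           (frame_vel c) t = k *\<^sub>R e (c t)) \<and>
        biharmonic_curve (bcv_space a b) (bcv_metric a b) {-r<..<r} (\<lambda>t. f (c t))"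
begin

text \<open>Nonvanishing of the second fundamental form as a quadratic form; by symmetry and
  polarisation the same as nonvanishing of the bilinear form.\<close>

definition regular where "regular q \<longleftrightarrow> (\<exists>u. B q u \<bullet> F q u \<noteq> 0)"

lemma regular_unit:
  assumes "q \<in> P" "regular q"
  obtains u where "F q u \<bullet> F q u = 1" "B q u \<bullet> F q u \<noteq> 0"
proof -
  obtain u where u: "B q u \<bullet> F q u \<noteq> 0" using assms(2) by (auto simp: regular_def)
  define s where "s = 1 / norm (F q u)"
  have ne: "F q u \<noteq> 0" using u by auto
  then have s: "s \<noteq> 0" by (simp add: s_def)
  have "F q (s *\<^sub>R u) \<bullet> F q (s *\<^sub>R u) = 1"
    using ne by (simp add: linear_scale[OF linear_F[OF assms(1)]] s_def power2_norm_eq_inner[symmetric] power2_eq_square)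
  moreover have "B q (s *\<^sub>R u) \<bullet> F q (s *\<^sub>R u) \<noteq> 0"
    using u s by (simp add: linear_scale[OF linear_F[OF assms(1)]] linear_scale[OF linear_B[OF assms(1)]])
  ultimately show ?thesis using that by blast
qed

text \<open>The normal curvature k(t) is -<B v, F v> at the velocity v. It is nonzero at 0 and of
  constant square, so the whole geodesic consists of regular points.\<close>

lemma geodesic_through:
  assumes q: "q \<in> P" and u: "F q u \<bullet> F q u = 1" "B q u \<bullet> F q u \<noteq> 0"
  obtains r c where "r > 0" "smooth_on {-r<..<r} c" "c ` {-r<..<r} \<subseteq> P" "c 0 = q" "velocity c 0 = u"
    "biharmonic_geodesic a b {-r<..<r} (\<lambda>t. f (c t))
       (frame_vel c) (\<lambda>t. e (c t))"
    "\<And>t. t \<in> {-r<..<r} \<Longrightarrow> regular (c t)"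
    "\<And>t. t \<in> {-r<..<r} \<Longrightarrow> biharmonic_geodesic.k a b (\<lambda>t. f (c t))
       (frame_vel c) (\<lambda>t. e (c t)) t \<noteq> 0"
proof -
  obtain r c where r: "r > 0" and sc: "smooth_on {-r<..<r} c" and cP: "c ` {-r<..<r} \<subseteq> P"
    and c0: "c 0 = q" and v0: "velocity c 0 = u"
    and acc: "\<And>t. t \<in> {-r<..<r} \<Longrightarrow> \<exists>k. frame_cov a b (\<lambda>t. f (c t))
           (frame_vel c) t = k *\<^sub>R e (c t)"
    and bi: "biharmonic_curve (bcv_space a b) (bcv_metric a b) {-r<..<r} (\<lambda>t. f (c t))"
    using biharmonic_geodesics[OF q u(1)] by blast
  let ?I = "{-r<..<r}"
  have oI: "open ?I" by simp
  have cP': "c t \<in> P" if "t \<in> ?I" for t using cP that by auto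
  interpret g: biharmonic_geodesic a b ?I "\<lambda>t. f (c t)"
    "frame_vel c" "\<lambda>t. e (c t)"
  proof
    show "is_interval ?I" by (simp add: is_interval_oo)
    show "e (c t) \<bullet> frame_vel c t = 0" if "t \<in> ?I" for t
      by (simp add: frame_velocity[OF oI sc cP that] normal_F'[OF cP'[OF that]])
  qed (use bi acc unit_e[OF cP'] smooth_ec[OF oI sc cP] in auto)
  have k: "g.k t = - (B (c t) (velocity c t) \<bullet> F (c t) (velocity c t))" if "t \<in> ?I" for t
    using g.De_T[OF that] by (simp add: frame_cov_e[OF oI sc cP that] frame_velocity[OF oI sc cP that])
  have "0 \<in> ?I" using r by simp
  then have k0: "g.k t \<noteq> 0" if "t \<in> ?I" for t
    using g.k_nonzero[of 0 t] k[of 0] u(2) c0 v0 that by simp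
  then have "regular (c t)" if "t \<in> ?I" for t using k[OF that] that unfolding regular_def by fastforce
  then show ?thesis using that[OF r sc cP c0 v0] g.biharmonic_geodesic_axioms k0 by blast
qed

lemma unit_frame_at:
  assumes "q \<in> P" "e1 \<bullet> e1 = 1" "e1 \<bullet> e q = 0"
  shows "unit_frame e1 (cross3 (e q) e1) (e q)"
proof
  show "e q = cross3 e1 (cross3 (e q) e1)"
  proof -
    have "cross3 e1 (cross3 (e q) e1) = (e1 \<bullet> e1) *\<^sub>R e q - (e1 \<bullet> e q) *\<^sub>R e1"
      by (intro real3_eqI) (simp_all add: inner_real3 cross3_nth algebra_simps)
    then show ?thesis using assms by simp
  qed
  have "cross3 (e q) e1 \<bullet> cross3 (e q) e1 = (e q \<bullet> e q) * (e1 \<bullet> e1) - (e1 \<bullet> e q)\<^sup>2"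
    by (simp add: inner_real3 cross3_nth power2_eq_square algebra_simps)
  then show "cross3 (e q) e1 \<bullet> cross3 (e q) e1 = 1" using assms unit_e by simp
qed (use assms in \<open>simp_all add: dot_cross_self\<close>)

lemma shape_conditions:
  assumes q: "q \<in> P" and u: "F q u \<bullet> F q u = 1" "B q u \<bullet> F q u \<noteq> 0"
  shows "B q u \<bullet> B q u = (b / 2)\<^sup>2 + (4 * a - b\<^sup>2) * (cross3 (e q) (F q u) \<bullet> E0)\<^sup>2"
    and "cross3 (e q) (F q u) \<bullet> E0 * (2 * (B q u \<bullet> cross3 (F q u) E0) - b / 2 * (e q \<bullet> E0)) = 0"
proof -
  obtain r c where r: "r > 0" and sc: "smooth_on {-r<..<r} c" and cP: "c ` {-r<..<r} \<subseteq> P"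
    and c0: "c 0 = q" and v0: "velocity c 0 = u"
    and bg: "biharmonic_geodesic a b {-r<..<r} (\<lambda>t. f (c t))
       (frame_vel c) (\<lambda>t. e (c t))"
    and k: "\<And>t. t \<in> {-r<..<r} \<Longrightarrow> biharmonic_geodesic.k a b (\<lambda>t. f (c t))
       (frame_vel c) (\<lambda>t. e (c t)) t \<noteq> 0"
    by (rule geodesic_through[OF q u]) (rule that; assumption)
  interpret g: biharmonic_geodesic a b "{-r<..<r}" "\<lambda>t. f (c t)"
    "frame_vel c" "\<lambda>t. e (c t)" by (rule bg)
  have 0: "0 \<in> {-r<..<r}" using r by simp
  have oI: "open {-r<..<r}" by simp
  note eqs = c0 frame_cov_e[OF oI sc cP 0, unfolded c0 v0] frame_velocity[OF oI sc cP 0, unfolded c0 v0]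
  show "B q u \<bullet> B q u = (b / 2)\<^sup>2 + (4 * a - b\<^sup>2) * (cross3 (e q) (F q u) \<bullet> E0)\<^sup>2"
    using g.De_norm[OF 0 k[OF 0] 0] unfolding eqs by (simp add: power_divide)
  show "cross3 (e q) (F q u) \<bullet> E0 * (2 * (B q u \<bullet> cross3 (F q u) E0) - b / 2 * (e q \<bullet> E0)) = 0"
    using g.second_condition[OF 0 k[OF 0] 0 generic] unfolding eqs .
qed

text \<open>Lifts an orthonormal tangent frame to coordinate vectors \<open>u1\<close>,
  \<open>u2\<close>, so that the results of \<open>unit_frame\<close> apply to the columns
  \<open>B q u1\<close> and \<open>B q u2\<close>.\<close>

lemma frame_hyps:
  assumes q: "q \<in> P" and reg: "regular q" and e1: "e1 \<bullet> e1 = 1" "e1 \<bullet> e q = 0"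
  obtains u1 u2 where "F q u1 = e1" "F q u2 = cross3 (e q) e1"
    "\<exists>c s. (c *\<^sub>R B q u1 + s *\<^sub>R B q u2) \<bullet> (c *\<^sub>R e1 + s *\<^sub>R cross3 (e q) e1) \<noteq> 0"
    "\<And>c s. c *\<^sub>R B q u1 + s *\<^sub>R B q u2 = B q (c *\<^sub>R u1 + s *\<^sub>R u2)"
    "\<And>c s. c *\<^sub>R e1 + s *\<^sub>R cross3 (e q) e1 = F q (c *\<^sub>R u1 + s *\<^sub>R u2)"
    "\<And>c s. c\<^sup>2 + s\<^sup>2 = 1 \<Longrightarrow> F q (c *\<^sub>R u1 + s *\<^sub>R u2) \<bullet> F q (c *\<^sub>R u1 + s *\<^sub>R u2) = 1"
proof -
  let ?e2 = "cross3 (e q) e1"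
  interpret u: unit_frame e1 ?e2 "e q" by (rule unit_frame_at[OF q e1])
  obtain u1 where u1: "F q u1 = e1" using F_onto[OF q e1(2)] by blast
  obtain u2 where u2: "F q u2 = ?e2" using F_onto[OF q u.normal(2)] by blast
  have Bl: "c *\<^sub>R B q u1 + s *\<^sub>R B q u2 = B q (c *\<^sub>R u1 + s *\<^sub>R u2)"
    and Fl: "c *\<^sub>R e1 + s *\<^sub>R ?e2 = F q (c *\<^sub>R u1 + s *\<^sub>R u2)" for c s
    using linear_F[OF q] linear_B[OF q] by (simp_all add: linear_add linear_scale u1 u2)
  obtain u where u: "B q u \<bullet> F q u \<noteq> 0" using reg by (auto simp: regular_def)
  have "F q u = (F q u \<bullet> e1) *\<^sub>R e1 + (F q u \<bullet> ?e2) *\<^sub>R ?e2"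
    using u.expand[of "F q u"] normal_F[OF q] by simp
  then have "F q u = F q ((F q u \<bullet> e1) *\<^sub>R u1 + (F q u \<bullet> ?e2) *\<^sub>R u2)" by (simp only: Fl)
  then have "u = (F q u \<bullet> e1) *\<^sub>R u1 + (F q u \<bullet> ?e2) *\<^sub>R u2" using inj_F[OF q] by (simp add: inj_eq)
  then have ex: "\<exists>c s. (c *\<^sub>R B q u1 + s *\<^sub>R B q u2) \<bullet> (c *\<^sub>R e1 + s *\<^sub>R ?e2) \<noteq> 0"
    using u unfolding Bl Fl by metis
  have un: "F q (c *\<^sub>R u1 + s *\<^sub>R u2) \<bullet> F q (c *\<^sub>R u1 + s *\<^sub>R u2) = 1" if "c\<^sup>2 + s\<^sup>2 = 1" for c s
    unfolding Fl[symmetric] using that u.e1 u.e2 u.e12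
    by (simp add: inner_add_left inner_add_right inner_commute[of ?e2 e1] power2_eq_square)
  show ?thesis by (rule that[OF u1 u2 ex Bl Fl un])
qed

text \<open>When the tangential part of the unit vector \<open>E0\<close> is zero, Parseval gives (e
  \<bullet> E0)^2 = 1. In this form e \<bullet> E0 has only three possible values, which a
  continuity argument can use.\<close>

lemma normal_or_tangent_E3:
  assumes q: "q \<in> P" and reg: "regular q"
  shows "e q \<bullet> E0 = 0 \<or> (e q \<bullet> E0)\<^sup>2 = 1"
proof -
  obtain u where u: "F q u \<bullet> F q u = 1" using regular_unit[OF q reg] .
  define e1 where "e1 = F q u"
  have e1: "e1 \<bullet> e1 = 1" "e1 \<bullet> e q = 0" using u normal_F[OF q] by (simp_all add: e1_def)
  interpret u: unit_frame e1 "cross3 (e q) e1" "e q" by (rule unit_frame_at[OF q e1])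
  obtain u1 u2 where uu: "F q u1 = e1" "F q u2 = cross3 (e q) e1"
    "\<exists>c s. (c *\<^sub>R B q u1 + s *\<^sub>R B q u2) \<bullet> (c *\<^sub>R e1 + s *\<^sub>R cross3 (e q) e1) \<noteq> 0"
    "\<And>c s. c *\<^sub>R B q u1 + s *\<^sub>R B q u2 = B q (c *\<^sub>R u1 + s *\<^sub>R u2)"
    "\<And>c s. c *\<^sub>R e1 + s *\<^sub>R cross3 (e q) e1 = F q (c *\<^sub>R u1 + s *\<^sub>R u2)"
    "\<And>c s. c\<^sup>2 + s\<^sup>2 = 1 \<Longrightarrow> F q (c *\<^sub>R u1 + s *\<^sub>R u2) \<bullet> F q (c *\<^sub>R u1 + s *\<^sub>R u2) = 1"
    by (rule frame_hyps[OF q reg e1]) (rule that; assumption)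
  have "e q \<bullet> E0 = 0 \<or> (e1 \<bullet> E0 = 0 \<and> cross3 (e q) e1 \<bullet> E0 = 0)"
  proof (rule u.normal_or_tangent[OF B_normal[OF q] B_normal[OF q] uu(3)])
    show "4 * a - b\<^sup>2 \<noteq> 0" using generic by simp
    show "(c *\<^sub>R B q u1 + s *\<^sub>R B q u2) \<bullet> (c *\<^sub>R B q u1 + s *\<^sub>R B q u2) =
        (b / 2)\<^sup>2 + (4 * a - b\<^sup>2) * (cross3 (e q) (c *\<^sub>R e1 + s *\<^sub>R cross3 (e q) e1) \<bullet> E0)\<^sup>2"
      if "c\<^sup>2 + s\<^sup>2 = 1" "(c *\<^sub>R B q u1 + s *\<^sub>R B q u2) \<bullet> (c *\<^sub>R e1 + s *\<^sub>R cross3 (e q) e1) \<noteq> 0" for c s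
      using that(2) unfolding uu(4,5) by (intro shape_conditions(1) q uu(6) that(1))
    show "cross3 (e q) (c *\<^sub>R e1 + s *\<^sub>R cross3 (e q) e1) \<bullet> E0 *
       (2 * ((c *\<^sub>R B q u1 + s *\<^sub>R B q u2) \<bullet> cross3 (c *\<^sub>R e1 + s *\<^sub>R cross3 (e q) e1) E0) - b / 2 * (e q \<bullet> E0)) = 0"
      if "c\<^sup>2 + s\<^sup>2 = 1" "(c *\<^sub>R B q u1 + s *\<^sub>R B q u2) \<bullet> (c *\<^sub>R e1 + s *\<^sub>R cross3 (e q) e1) \<noteq> 0" for c s
      using that(2) unfolding uu(4,5) by (intro shape_conditions(2) q uu(6) that(1))
  qed
  moreover have "E0 \<bullet> E0 = 1" by (simp add: inner_axis_axis)
  then have "(e1 \<bullet> E0)\<^sup>2 + (cross3 (e q) e1 \<bullet> E0)\<^sup>2 + (e q \<bullet> E0)\<^sup>2 = 1"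
    using u.inner_expand[of E0 E0]
    by (simp only: power2_eq_square inner_commute[of E0 e1] inner_commute[of E0 "cross3 (e q) e1"]
        inner_commute[of E0 "e q"])
  ultimately show ?thesis by auto
qed

lemma E3_tangent:
  assumes q: "q \<in> P" and reg: "regular q"
  shows "e q \<bullet> E0 = 0"
proof (rule ccontr)
  assume "e q \<bullet> E0 \<noteq> 0"
  then have n0: "(e q \<bullet> E0)\<^sup>2 = 1" using normal_or_tangent_E3[OF q reg] by simp
  obtain u where u: "F q u \<bullet> F q u = 1" "B q u \<bullet> F q u \<noteq> 0" using regular_unit[OF q reg] .
  obtain r c where r: "r > 0" and sc: "smooth_on {-r<..<r} c" and cP: "c ` {-r<..<r} \<subseteq> P"
    and c0: "c 0 = q" and v0: "velocity c 0 = u"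
    and rg: "\<And>t. t \<in> {-r<..<r} \<Longrightarrow> regular (c t)"
    by (rule geodesic_through[OF q u]) (rule that; assumption)
  let ?I = "{-r<..<r}"
  have 0: "0 \<in> ?I" using r by simp
  have oI: "open ?I" by simp
  have cP': "c t \<in> P" if "t \<in> ?I" for t using cP that by auto
  let ?n = "\<lambda>t. e (c t) \<bullet> E0"
  \<comment> \<open>A continuous function on an interval with finitely many values is constant: the
    normal stays vertical along the geodesic.\<close>
  have "?n t \<in> {0, 1, -1}" if "t \<in> ?I" for t
    using normal_or_tangent_E3[OF cP'[OF that] rg[OF that]] by (auto simp: power2_eq_1_iff)
  then have "?n ` ?I \<subseteq> {0, 1, -1}" by blast
  then have "finite (?n ` ?I)" by (rule finite_subset) simp
  moreover have "continuous_on ?I ?n"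
    by (intro continuous_on_inner smooth_on_continuous[OF smooth_ec[OF oI sc cP]] continuous_on_const)
  ultimately have "?n constant_on ?I"
    using continuous_finite_range_constant[of ?I ?n] by simp
  then have nt: "?n t = e q \<bullet> E0" if "t \<in> ?I" for t
    using that 0 c0 unfolding constant_on_def by metis
  \<comment> \<open>The equality case of the Cauchy-Schwarz inequality for two unit vectors.\<close>
  have et: "e (c t) = (e q \<bullet> E0) *\<^sub>R E0" if t: "t \<in> ?I" for t
  proof -
    let ?w = "e (c t) - (e q \<bullet> E0) *\<^sub>R E0"
    have "?w \<bullet> ?w = 0"
      using unit_e[OF cP'[OF t]] nt[OF t] n0
      by (simp add: inner_diff_left inner_diff_right inner_commute[of E0] inner_axis_axis power2_eq_square)
    then show ?thesis by simp
  qed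
  have "B q u = frame_cov a b (\<lambda>t. f (c t)) (\<lambda>t. e (c t)) 0"
    using frame_cov_e[OF oI sc cP 0] c0 v0 by simp
  also have "\<dots> = frame_cov a b (\<lambda>t. f (c t)) (\<lambda>t. (e q \<bullet> E0) *\<^sub>R E0) 0"
    by (rule frame_cov_cong_open[OF oI 0 et])
  also have "\<dots> = (e q \<bullet> E0) *\<^sub>R frame_cov a b (\<lambda>t. f (c t)) (\<lambda>t. E0) 0"
    by (simp add: frame_cov_def cross_mult_right)
  also have "\<dots> = ((e q \<bullet> E0) * (b / 2)) *\<^sub>R cross3 (F q u) E0"
    using frame_velocity[OF oI sc cP 0] c0 v0 by (simp add: frame_cov_E3)
  \<comment> \<open>De is a multiple of T \<times> E0, hence orthogonal to T, against nonzero normal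
    curvature.\<close>
  finally show False using u(2) by (simp add: dot_cross_self)
qed

text \<open>The geodesic stays in the regular set, so e \<bullet> E0 = 0 holds along it and can be
  differentiated.\<close>

lemma tangent_condition:
  assumes q: "q \<in> P" and u: "F q u \<bullet> F q u = 1" "B q u \<bullet> F q u \<noteq> 0"
  shows "B q u \<bullet> E0 + b / 2 * (e q \<bullet> cross3 (F q u) E0) = 0"
proof -
  obtain r c where r: "r > 0" and sc: "smooth_on {-r<..<r} c" and cP: "c ` {-r<..<r} \<subseteq> P"
    and c0: "c 0 = q" and v0: "velocity c 0 = u"
    and rg: "\<And>t. t \<in> {-r<..<r} \<Longrightarrow> regular (c t)"
    by (rule geodesic_through[OF q u]) (rule that; assumption)
  let ?I = "{-r<..<r}"
  have 0: "0 \<in> ?I" using r by simp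
  have oI: "open ?I" by simp
  have en: "e (c t) \<bullet> E0 = 0" if "t \<in> ?I" for t
    using E3_tangent[OF _ rg[OF that]] cP that by blast
  have d: "((\<lambda>t. e (c t) \<bullet> E0) has_real_derivative
      frame_cov a b (\<lambda>t. f (c t)) (\<lambda>t. e (c t)) 0 \<bullet> E0 + e (c 0) \<bullet> frame_cov a b (\<lambda>t. f (c t)) (\<lambda>t. E0) 0) (at 0)"
    by (rule frame_cov_inner[OF smooth_ec[OF oI sc cP] smooth_on_const[OF oI] 0])
  have "frame_cov a b (\<lambda>t. f (c t)) (\<lambda>t. e (c t)) 0 \<bullet> E0 + e (c 0) \<bullet> frame_cov a b (\<lambda>t. f (c t)) (\<lambda>t. E0) 0 = 0"
    using has_derivative_locally_const[OF d[unfolded has_field_derivative_def] oI 0 en, of 1] by simp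
  then show ?thesis
    using frame_velocity[OF oI sc cP 0] frame_cov_e[OF oI sc cP 0] c0 v0 by (simp add: frame_cov_E3)
qed

text \<open>\<open>tangent_shape\<close> in the frame \<open>E0\<close>, e \<times> E0: the vertical
  direction lies in the kernel of the shape operator, and the conormal e \<times> E0 is the
  remaining eigenvector.\<close>

lemma regular_shape:
  assumes q: "q \<in> P" and reg: "regular q"
  shows "b = 0" and "\<exists>k. k\<^sup>2 = 4 * a \<and> (\<forall>u. B q u = (k * (F q u \<bullet> cross3 (e q) E0)) *\<^sub>R cross3 (e q) E0)"
proof -
  have e1: "E0 \<bullet> E0 = 1" "E0 \<bullet> e q = 0"
    using E3_tangent[OF q reg] by (simp_all add: inner_axis_axis inner_commute)
  let ?e2 = "cross3 (e q) E0"
  interpret u: unit_frame E0 ?e2 "e q" by (rule unit_frame_at[OF q e1])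
  obtain u1 u2 where uu: "F q u1 = E0" "F q u2 = ?e2"
    "\<exists>c s. (c *\<^sub>R B q u1 + s *\<^sub>R B q u2) \<bullet> (c *\<^sub>R E0 + s *\<^sub>R ?e2) \<noteq> 0"
    "\<And>c s. c *\<^sub>R B q u1 + s *\<^sub>R B q u2 = B q (c *\<^sub>R u1 + s *\<^sub>R u2)"
    "\<And>c s. c *\<^sub>R E0 + s *\<^sub>R ?e2 = F q (c *\<^sub>R u1 + s *\<^sub>R u2)"
    "\<And>c s. c\<^sup>2 + s\<^sup>2 = 1 \<Longrightarrow> F q (c *\<^sub>R u1 + s *\<^sub>R u2) \<bullet> F q (c *\<^sub>R u1 + s *\<^sub>R u2) = 1"
    by (rule frame_hyps[OF q reg e1]) (rule that; assumption)
  have d: "4 * a - b\<^sup>2 \<noteq> 0" using generic by simp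
  have 1: "(c *\<^sub>R B q u1 + s *\<^sub>R B q u2) \<bullet> (c *\<^sub>R B q u1 + s *\<^sub>R B q u2) =
        (b / 2)\<^sup>2 + (4 * a - b\<^sup>2) * (cross3 (e q) (c *\<^sub>R E0 + s *\<^sub>R ?e2) \<bullet> E0)\<^sup>2"
      if "c\<^sup>2 + s\<^sup>2 = 1" "(c *\<^sub>R B q u1 + s *\<^sub>R B q u2) \<bullet> (c *\<^sub>R E0 + s *\<^sub>R ?e2) \<noteq> 0" for c s
    using that(2) unfolding uu(4,5) by (intro shape_conditions(1) q uu(6) that(1))
  have 2: "(c *\<^sub>R B q u1 + s *\<^sub>R B q u2) \<bullet> E0 + b / 2 * (e q \<bullet> cross3 (c *\<^sub>R E0 + s *\<^sub>R ?e2) E0) = 0"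
      if "c\<^sup>2 + s\<^sup>2 = 1" "(c *\<^sub>R B q u1 + s *\<^sub>R B q u2) \<bullet> (c *\<^sub>R E0 + s *\<^sub>R ?e2) \<noteq> 0" for c s
    using that(2) unfolding uu(4,5) by (intro tangent_condition q uu(6) that(1))
  note sh = u.tangent_shape[OF B_normal[OF q] B_normal[OF q] uu(3) d refl 1 2]
  show b: "b = 0" using sh(1) by simp
  let ?k = "B q u2 \<bullet> ?e2"
  have "B q u = (?k * (F q u \<bullet> ?e2)) *\<^sub>R ?e2" for u
  proof -
    have "F q u = (F q u \<bullet> E0) *\<^sub>R E0 + (F q u \<bullet> ?e2) *\<^sub>R ?e2"
      using u.expand[of "F q u"] normal_F[OF q] by simp
    then have "F q u = F q ((F q u \<bullet> E0) *\<^sub>R u1 + (F q u \<bullet> ?e2) *\<^sub>R u2)" by (simp only: uu(5))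
    then have "u = (F q u \<bullet> E0) *\<^sub>R u1 + (F q u \<bullet> ?e2) *\<^sub>R u2" using inj_F[OF q] by (simp add: inj_eq)
    then have "B q u = (F q u \<bullet> E0) *\<^sub>R B q u1 + (F q u \<bullet> ?e2) *\<^sub>R B q u2" by (simp only: uu(4))
    also have "\<dots> = (F q u \<bullet> ?e2) *\<^sub>R (?k *\<^sub>R ?e2)" using sh(2,3) by simp
    finally show ?thesis by (simp add: mult.commute)
  qed
  moreover have "?k\<^sup>2 = 4 * a" using sh(4) b by simp
  ultimately show "\<exists>k. k\<^sup>2 = 4 * a \<and> (\<forall>u. B q u = (k * (F q u \<bullet> ?e2)) *\<^sub>R ?e2)" by blast
qed

end

section \<open>Totally biharmonic surfaces\<close>

lemma frame_cov_cong_curve: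
  assumes "open J" "t \<in> J" "\<And>s. s \<in> J \<Longrightarrow> c s = c' s" "\<And>s. s \<in> J \<Longrightarrow> V s = V' s"
  shows "frame_cov a b c V t = frame_cov a b c' V' t"
  unfolding frame_cov_def velocity_def
  using vector_derivative_cong_open[OF assms(1,2,3)] vector_derivative_cong_open[OF assms(1,2,4)] assms
  by simp

context surface_patch
begin

lemma smooth_B: "smooth_on P (\<lambda>q. B q u)"
  unfolding B_def
  by (intro smooth_on_add smooth_on_frechet smooth_on_cross3 smooth_on_conn_vec smooth_e smooth_f smooth_F open_P)

lemma open_shape_pos: "open {q \<in> P. \<exists>u. 0 < s * (B q u \<bullet> F q u)}"
proof -
  have "open (\<Union>u. P \<inter> (\<lambda>q. s * (B q u \<bullet> F q u)) -` {0<..})"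
    by (intro open_UN ballI continuous_open_preimage open_P open_greaterThan continuous_on_mult
        continuous_on_const continuous_on_inner smooth_on_continuous[OF smooth_B] smooth_on_continuous[OF smooth_F])
  moreover have "{q \<in> P. \<exists>u. 0 < s * (B q u \<bullet> F q u)} = (\<Union>u. P \<inter> (\<lambda>q. s * (B q u \<bullet> F q u)) -` {0<..})"
    by auto
  ultimately show ?thesis by simp
qed

end

context biharmonic_patch
begin

lemma conormal_unit:
  assumes "q \<in> P" "e q \<bullet> E0 = 0"
  shows "cross3 (e q) E0 \<bullet> cross3 (e q) E0 = 1"
  using unit_e[OF assms(1)] assms(2) by (simp add: inner_real3 cross3_nth axis_def)

text \<open>On regular points \<open>II(u, u)\<^sup>2 = 4 a \<langle>u, h\<rangle>\<^sup>4\<close> and \<open>E3\<close> is tangent; these closed conditions in turn force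
  \<open>II \<noteq> 0\<close>, so the regular set is also closed.\<close>

lemma regular_or_open_nonregular:
  assumes "\<exists>q0\<in>P'. biharmonic_patch.regular a b f' n' q0" "biharmonic_patch a b P' f' n'"
  shows "open {q \<in> P. \<not> regular q}"
proof -
  \<comment> \<open>The regular point may lie in a different patch; it fixes b = 0 and a > 0 even if
    the present patch has no regular point.\<close>
  obtain k0 where k0: "k0\<^sup>2 = 4 * a" and b: "b = 0"
    using assms biharmonic_patch.regular_shape by metis
  have a: "a > 0" using k0 generic b zero_le_power2[of k0] by (cases "a = 0") auto
  define h where "h q = cross3 (e q) E0" for q
  define K where "K u q = (B q u \<bullet> F q u)\<^sup>2 - 4 * a * (F q u \<bullet> h q) ^ 4" for u q
  have cont: "continuous_on P (\<lambda>q. e q \<bullet> E0)" "continuous_on P (K u)" for u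
    unfolding K_def[abs_def] h_def
    by (intro smooth_on_continuous[OF smooth_on_inner] smooth_on_continuous[OF smooth_on_diff] smooth_on_diff smooth_on_mult
        smooth_on_power smooth_on_inner smooth_on_cross3 smooth_B smooth_F smooth_e smooth_on_const open_P)+
  have eq: "{q \<in> P. \<not> regular q} = (P \<inter> (\<lambda>q. e q \<bullet> E0) -` (- {0})) \<union> (\<Union>u. P \<inter> K u -` (- {0}))"
  proof (intro set_eqI iffI)
    fix q assume q: "q \<in> {q \<in> P. \<not> regular q}"
    then have qP: "q \<in> P" by simp
    show "q \<in> (P \<inter> (\<lambda>q. e q \<bullet> E0) -` (- {0})) \<union> (\<Union>u. P \<inter> K u -` (- {0}))"
    proof (rule ccontr)
      assume "\<not> ?thesis"
      then have n: "e q \<bullet> E0 = 0" and K: "\<And>u. K u q = 0" using qP by auto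
      \<comment> \<open>The conormal is the test direction: there <F u, h> = 1, and K = 0 yields
        II(u, u)^2 = 4 a > 0.\<close>
      obtain u where u: "F q u = h q"
        using F_onto[OF qP, of "h q"] by (auto simp: h_def dot_cross_self)
      have "(B q u \<bullet> F q u)\<^sup>2 = 4 * a"
        using K[of u] conormal_unit[OF qP n] u by (simp add: K_def h_def)
      then have "B q u \<bullet> F q u \<noteq> 0" using a by auto
      then have "regular q" unfolding regular_def by blast
      then show False using q by simp
    qed
  next
    fix q assume q: "q \<in> (P \<inter> (\<lambda>q. e q \<bullet> E0) -` (- {0})) \<union> (\<Union>u. P \<inter> K u -` (- {0}))"
    then have qP: "q \<in> P" by auto
    have "\<not> regular q"
    proof
      assume r: "regular q"
      obtain k where k: "k\<^sup>2 = 4 * a" "\<And>u. B q u = (k * (F q u \<bullet> h q)) *\<^sub>R h q"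
        using regular_shape(2)[OF qP r] unfolding h_def by blast
      have "(B q u \<bullet> F q u)\<^sup>2 = k\<^sup>2 * (F q u \<bullet> h q) ^ 4" for u
        unfolding k(2) by (simp add: power_mult_distrib inner_commute[of "h q"] power2_eq_square power4_eq_xxxx)
      then have "K u q = 0" for u by (simp add: K_def k(1))
      then show False using q E3_tangent[OF qP r] by auto
    qed
    then show "q \<in> {q \<in> P. \<not> regular q}" using qP by simp
  qed
  show ?thesis
    unfolding eq by (intro open_Un open_UN ballI continuous_open_preimage cont open_P open_Compl) auto
qed

end

section \<open>Passing between the charts of a surface\<close>

locale bcv_immersion =
  fixes a b :: real and A :: "'m::{t2_space,second_countable_topology} atlas"
    and \<phi> \<eta> :: "'m \<Rightarrow> real^3"
  assumes surface: "bcv_surface a b A \<phi> \<eta>"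
begin

lemma atlas: "smooth_atlas A"
  using surface by (simp add: bcv_surface_def)

lemma chart_ex: "\<exists>U x. (U, x) \<in> A \<and> p \<in> U"
proof -
  have "p \<in> (\<Union>(U, x)\<in>A. U)" using atlas by (simp add: smooth_atlas_def)
  then show ?thesis by auto
qed

lemma chart:
  assumes "(U, x) \<in> A"
  shows "open U" "open (x ` U)" "homeomorphism U (x ` U) x (inv_into U x)"
    "inj_on x U" "continuous_on U x" "continuous_on (x ` U) (inv_into U x)"
proof -
  show 1: "open U" "open (x ` U)" "homeomorphism U (x ` U) x (inv_into U x)"
    using atlas assms unfolding smooth_atlas_def by blast+
  show "inj_on x U" by (rule inj_on_inverseI) (rule homeomorphism_apply1[OF 1(3)])
  show "continuous_on U x" "continuous_on (x ` U) (inv_into U x)"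
    using 1(3) by (simp_all add: homeomorphism_def)
qed

lemma transition: "(U, x) \<in> A \<Longrightarrow> (V, y) \<in> A \<Longrightarrow> smooth_on (x ` (U \<inter> V)) (y \<circ> inv_into U x)"
  using atlas unfolding smooth_atlas_def by blast

lemma open_overlap:
  assumes "(U, x) \<in> A" "open V"
  shows "open (x ` (U \<inter> V))"
proof -
  have "x ` (U \<inter> V) = x ` U \<inter> inv_into U x -` V"
    using chart(4)[OF assms(1)] by auto
  then show ?thesis using continuous_open_preimage[OF chart(6,2)[OF assms(1)] assms(2)] by simp
qed

lemma loc_rep_chart: "(U, x) \<in> A \<Longrightarrow> p \<in> U \<Longrightarrow> loc_rep g U x (x p) = g p"
  using chart(4) by (simp add: loc_rep_def)

lemma patch:
  assumes "(U, x) \<in> A"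
  shows "surface_patch a b (x ` U) (loc_rep \<phi> U x) (loc_rep \<eta> U x)"
proof
  have inc: "\<And>p. p \<in> U \<Longrightarrow> inj (loc_diff \<phi> U x p)"
    "\<And>p v. p \<in> U \<Longrightarrow> bcv_metric a b (\<phi> p) (loc_diff \<phi> U x p v) (\<eta> p) = 0"
    using surface assms unfolding bcv_surface_def by blast+
  show "open (x ` U)" using chart[OF assms] by simp
  show "smooth_on (x ` U) (loc_rep \<phi> U x)" "smooth_on (x ` U) (loc_rep \<eta> U x)"
    using surface assms unfolding bcv_surface_def smooth_map_def by blast+
  show "loc_rep \<phi> U x ` x ` U \<subseteq> bcv_space a b"
    using surface unfolding bcv_surface_def loc_rep_def by auto
  fix q assume "q \<in> x ` U"
  then obtain p where p: "p \<in> U" "q = x p" by auto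
  note [simp] = p(2) loc_rep_chart[OF assms p(1)]
  show "bcv_metric a b (loc_rep \<phi> U x q) (loc_rep \<eta> U x q) (loc_rep \<eta> U x q) = 1"
    using surface by (simp add: bcv_surface_def)
  show "bcv_metric a b (loc_rep \<phi> U x q) (frechet_derivative (loc_rep \<phi> U x) (at q) v) (loc_rep \<eta> U x q) = 0" for v
    using inc(2)[OF p(1)] by (simp add: loc_diff_def)
  show "inj (frechet_derivative (loc_rep \<phi> U x) (at q))"
    using inc(1)[OF p(1)] by (simp add: loc_diff_def)
qed

abbreviation pF where "pF U x \<equiv> surface_patch.F a b (loc_rep \<phi> U x)"
abbreviation pB where "pB U x \<equiv> surface_patch.B a b (loc_rep \<phi> U x) (loc_rep \<eta> U x)"
abbreviation pe where "pe U x \<equiv> surface_patch.e a b (loc_rep \<phi> U x) (loc_rep \<eta> U x)"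

definition nrm where "nrm p = coframe a b (\<phi> p) (\<eta> p)"

lemma pe_chart: "(U, x) \<in> A \<Longrightarrow> p \<in> U \<Longrightarrow> pe U x (x p) = nrm p"
  using surface_patch.e_def[OF patch] by (simp add: nrm_def loc_rep_chart)

text \<open>A curve given in the chart x is read in the chart y. Its image, velocity and normal live
  in the ambient space and hence do not depend on the chart.\<close>

lemma curve_in_charts:
  assumes Ux: "(U, x) \<in> A" and Vy: "(V, y) \<in> A" and I: "open I" and c: "smooth_on I c" "c ` I \<subseteq> x ` U"
    and g: "g = (\<lambda>t. inv_into U x (c t))" and J: "J = I \<inter> g -` V"
  shows "open J" "smooth_on J (y \<circ> g)" "(y \<circ> g) ` J \<subseteq> y ` V"
    "t \<in> J \<Longrightarrow> coframe a b (loc_rep \<phi> V y ((y \<circ> g) t)) (velocity (\<lambda>t. loc_rep \<phi> V y ((y \<circ> g) t)) t) =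
       coframe a b (loc_rep \<phi> U x (c t)) (velocity (\<lambda>t. loc_rep \<phi> U x (c t)) t)"
    "t \<in> J \<Longrightarrow> loc_rep \<phi> V y ((y \<circ> g) t) = loc_rep \<phi> U x (c t)"
    "t \<in> J \<Longrightarrow> pe V y ((y \<circ> g) t) = pe U x (c t)"
proof -
  have cg: "continuous_on I g"
    unfolding g by (rule continuous_on_compose2[OF chart(6)[OF Ux] smooth_on_continuous[OF c(1)] c(2)])
  show oJ: "open J" unfolding J by (rule continuous_open_preimage[OF cg I chart(1)[OF Vy]])
  have JI: "J \<subseteq> I" by (auto simp: J)
  have gU: "g t \<in> U" "x (g t) = c t" if "t \<in> I" for t
  proof -
    have "c t \<in> x ` U" using c(2) that by auto
    then show "g t \<in> U" "x (g t) = c t" unfolding g by (simp_all add: inv_into_into f_inv_into_f)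
  qed
  have gV: "g t \<in> V" if "t \<in> J" for t using that by (simp add: J)
  have "c t \<in> x ` (U \<inter> V)" if "t \<in> J" for t
    using gU[of t] gV[OF that] that JI by (intro image_eqI[of _ _ "g t"]) auto
  then have im: "c ` J \<subseteq> x ` (U \<inter> V)" by auto
  have "smooth_on J (\<lambda>t. (y \<circ> inv_into U x) (c t))"
    by (rule smooth_on_compose[OF oJ open_overlap[OF Ux chart(1)[OF Vy]] im smooth_on_subset[OF c(1) JI] transition[OF Ux Vy]])
  then show "smooth_on J (y \<circ> g)" by (simp add: g o_def)
  show "(y \<circ> g) ` J \<subseteq> y ` V" using gV by auto
  have eq: "loc_rep \<phi> V y ((y \<circ> g) t) = loc_rep \<phi> U x (c t)" if "t \<in> J" for t
    using loc_rep_chart[OF Vy gV[OF that], of \<phi>] loc_rep_chart[OF Ux gU(1)[OF subsetD[OF JI that]], of \<phi>]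
      gU(2)[OF subsetD[OF JI that]] by simp
  show "t \<in> J \<Longrightarrow> loc_rep \<phi> V y ((y \<circ> g) t) = loc_rep \<phi> U x (c t)" by (rule eq)
  show "pe V y ((y \<circ> g) t) = pe U x (c t)" if "t \<in> J"
    using pe_chart[OF Vy gV[OF that]] pe_chart[OF Ux gU(1)[OF subsetD[OF JI that]]]
      gU(2)[OF subsetD[OF JI that]] by simp
  have ve: "vector_derivative (\<lambda>t. loc_rep \<phi> V y ((y \<circ> g) t)) (at t) =
      vector_derivative (\<lambda>t. loc_rep \<phi> U x (c t)) (at t)" if "t \<in> J" for t
    by (rule vector_derivative_cong_open[OF oJ that eq])
  show "t \<in> J \<Longrightarrow> coframe a b (loc_rep \<phi> V y ((y \<circ> g) t)) (velocity (\<lambda>t. loc_rep \<phi> V y ((y \<circ> g) t)) t) =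
       coframe a b (loc_rep \<phi> U x (c t)) (velocity (\<lambda>t. loc_rep \<phi> U x (c t)) t)"
    by (simp only: velocity_def eq ve)
qed

text \<open>\<open>unit_speed_geodesic\<close> tests every chart of the atlas, whereas the geodesic
  was constructed in one. The ambient condition, acceleration parallel to the normal, carries over
  to all of them.\<close>

lemma unit_speed_geodesicI:
  assumes Ux: "(U, x) \<in> A" and I: "open I" and c: "smooth_on I c" "c ` I \<subseteq> x ` U"
    and acc: "\<And>t. t \<in> I \<Longrightarrow> \<exists>k. frame_cov a b (\<lambda>t. loc_rep \<phi> U x (c t))
       (\<lambda>t. coframe a b (loc_rep \<phi> U x (c t)) (velocity (\<lambda>t. loc_rep \<phi> U x (c t)) t)) t = k *\<^sub>R pe U x (c t)"
    and unit: "\<And>t. t \<in> I \<Longrightarrow> pF U x (c t) (velocity c t) \<bullet> pF U x (c t) (velocity c t) = 1"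
  shows "unit_speed_geodesic a b A \<phi> I (\<lambda>t. inv_into U x (c t))"
proof -
  define g where "g = (\<lambda>t. inv_into U x (c t))"
  interpret u: surface_patch a b "x ` U" "loc_rep \<phi> U x" "loc_rep \<eta> U x" by (rule patch[OF Ux])
  have cg: "continuous_on I g"
    unfolding g_def by (rule continuous_on_compose2[OF chart(6)[OF Ux] smooth_on_continuous[OF c(1)] c(2)])
  have "smooth_on (I \<inter> g -` V) (y \<circ> g) \<and> (\<forall>t\<in>I. g t \<in> V \<longrightarrow>
      induced_metric a b \<phi> V y ((y \<circ> g) t) (velocity (y \<circ> g) t) (velocity (y \<circ> g) t) = 1 \<and>
      cov_along (induced_metric a b \<phi> V y) (y \<circ> g) (velocity (y \<circ> g)) t = 0)" if Vy: "(V, y) \<in> A" for V y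
  proof -
    interpret v: surface_patch a b "y ` V" "loc_rep \<phi> V y" "loc_rep \<eta> V y" by (rule patch[OF Vy])
    define J where "J = I \<inter> g -` V"
    note cc = curve_in_charts[OF Ux Vy I c g_def J_def]
    have JI: "J \<subseteq> I" by (auto simp: J_def)
    have "induced_metric a b \<phi> V y ((y \<circ> g) t) (velocity (y \<circ> g) t) (velocity (y \<circ> g) t) = 1 \<and>
      cov_along (induced_metric a b \<phi> V y) (y \<circ> g) (velocity (y \<circ> g)) t = 0" if t: "t \<in> J" for t
    proof
      have tI: "t \<in> I" using t JI by auto
      show "induced_metric a b \<phi> V y ((y \<circ> g) t) (velocity (y \<circ> g) t) (velocity (y \<circ> g) t) = 1"
        unfolding induced_metric_def v.pullback_frame v.frame_velocity[OF cc(1-3) t, symmetric] cc(4)[OF t]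
          u.frame_velocity[OF I c tI] by (rule unit[OF tI])
      obtain k where "frame_cov a b (\<lambda>t. loc_rep \<phi> U x (c t))
         (\<lambda>t. coframe a b (loc_rep \<phi> U x (c t)) (velocity (\<lambda>t. loc_rep \<phi> U x (c t)) t)) t = k *\<^sub>R pe U x (c t)"
        using acc[OF tI] by blast
      then have k: "frame_cov a b (\<lambda>t. loc_rep \<phi> V y ((y \<circ> g) t)) (\<lambda>t. coframe a b (loc_rep \<phi> V y ((y \<circ> g) t))
         (velocity (\<lambda>t. loc_rep \<phi> V y ((y \<circ> g) t)) t)) t = k *\<^sub>R pe V y ((y \<circ> g) t)"
        using frame_cov_cong_curve[OF cc(1) t cc(5) cc(4)] cc(6)[OF t] by simp
      show "cov_along (induced_metric a b \<phi> V y) (y \<circ> g) (velocity (y \<circ> g)) t = 0"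
        unfolding induced_metric_def by (rule v.pullback_geodesicI[OF cc(1-3) t k])
    qed
    then show ?thesis using cc(2) by (auto simp: J_def)
  qed
  then show ?thesis
    unfolding unit_speed_geodesic_def Let_def g_def[symmetric] using cg by blast
qed

text \<open>The straight line through x p with velocity u serves as test curve; its velocity in the
  chart y at time 0 is the required \<open>u'\<close>.\<close>

lemma chart_change:
  assumes Ux: "(U, x) \<in> A" and Vy: "(V, y) \<in> A" and p: "p \<in> U" "p \<in> V"
  shows "\<exists>u'. pF V y (y p) u' = pF U x (x p) u \<and> pB V y (y p) u' = pB U x (x p) u"
proof -
  interpret u: surface_patch a b "x ` U" "loc_rep \<phi> U x" "loc_rep \<eta> U x" by (rule patch[OF Ux])
  interpret v: surface_patch a b "y ` V" "loc_rep \<phi> V y" "loc_rep \<eta> V y" by (rule patch[OF Vy])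
  define c where "c t = x p + t *\<^sub>R u" for t :: real
  define I where "I = c -` (x ` U)"
  have "continuous_on UNIV c" unfolding c_def by (intro continuous_intros)
  then have I: "open I" unfolding I_def using open_vimage[OF chart(2)[OF Ux]] by blast
  have sc: "smooth_on I c" unfolding c_def[abs_def]
    by (intro smooth_on_add smooth_on_scaleR smooth_on_const smooth_on_id I)
  have cI: "c ` I \<subseteq> x ` U" by (auto simp: I_def)
  define g where "g = (\<lambda>t. inv_into U x (c t))"
  define J where "J = I \<inter> g -` V"
  note cc = curve_in_charts[OF Ux Vy I sc cI g_def J_def]
  have g0: "g 0 = p" using chart(4)[OF Ux] p by (simp add: g_def c_def)
  have 0: "0 \<in> J" "0 \<in> I" using p g0 by (auto simp: J_def I_def c_def)
  have v0: "velocity c 0 = u" unfolding velocity_def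
    by (rule vector_derivative_at) (auto simp: c_def[abs_def] intro!: derivative_eq_intros)
  have c0: "c 0 = x p" by (simp add: c_def)
  have "pF V y (y p) (velocity (y \<circ> g) 0) = pF U x (x p) u"
    using v.frame_velocity[OF cc(1-3) 0(1)] cc(4)[OF 0(1)] u.frame_velocity[OF I sc cI 0(2)] g0 c0 v0 by simp
  moreover have "pB V y (y p) (velocity (y \<circ> g) 0) = pB U x (x p) u"
    using v.frame_cov_e[OF cc(1-3) 0(1)] frame_cov_cong_curve[OF cc(1) 0(1) cc(5) cc(6)]
      u.frame_cov_e[OF I sc cI 0(2)] g0 c0 v0 by simp
  ultimately show ?thesis by blast
qed

end

section \<open>Consequences of connectedness\<close>

locale totally_biharmonic_immersion = bcv_immersion +
  assumes generic: "4 * a \<noteq> b\<^sup>2"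
    and tot_biharmonic: "totally_biharmonic a b A \<phi>"
    and not_tot_geodesic: "\<not> totally_geodesic a b A \<phi> \<eta>"
begin

lemma bpatch:
  assumes Ux: "(U, x) \<in> A"
  shows "biharmonic_patch a b (x ` U) (loc_rep \<phi> U x) (loc_rep \<eta> U x)"
proof -
  interpret u: surface_patch a b "x ` U" "loc_rep \<phi> U x" "loc_rep \<eta> U x" by (rule patch[OF Ux])
  show ?thesis
  proof
    fix q u assume "q \<in> x ` U" "u.F q u \<bullet> u.F q u = 1"
    then obtain r c where r: "r > 0" and sc: "smooth_on {-r<..<r} c" and cP: "c ` {-r<..<r} \<subseteq> x ` U"
      and c0: "c 0 = q" and v0: "velocity c 0 = u"
      and acc: "\<And>t. t \<in> {-r<..<r} \<Longrightarrow> \<exists>k. frame_cov a b (\<lambda>t. loc_rep \<phi> U x (c t))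
         (\<lambda>t. coframe a b (loc_rep \<phi> U x (c t)) (velocity (\<lambda>t. loc_rep \<phi> U x (c t)) t)) t = k *\<^sub>R u.e (c t)"
      and un: "\<And>t. t \<in> {-r<..<r} \<Longrightarrow> u.F (c t) (velocity c t) \<bullet> u.F (c t) (velocity c t) = 1"
      by (rule u.geodesic_patch_exists) (rule that; assumption)
    have "unit_speed_geodesic a b A \<phi> {-r<..<r} (\<lambda>t. inv_into U x (c t))"
      by (rule unit_speed_geodesicI[OF Ux _ sc cP acc un]) auto
    moreover have "open {-r<..<r}" "is_interval {-r<..<r}" "{-r<..<r} \<noteq> {}"
      using r by (auto simp: is_interval_oo)
    ultimately have "biharmonic_curve (bcv_space a b) (bcv_metric a b) {-r<..<r} (\<phi> \<circ> (\<lambda>t. inv_into U x (c t)))"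
      using tot_biharmonic unfolding totally_biharmonic_def by blast
    then have "biharmonic_curve (bcv_space a b) (bcv_metric a b) {-r<..<r} (\<lambda>t. loc_rep \<phi> U x (c t))"
      by (simp add: loc_rep_def o_def)
    then show "\<exists>r c. r > 0 \<and> smooth_on {-r<..<r} c \<and> c ` {-r<..<r} \<subseteq> x ` U \<and> c 0 = q \<and> velocity c 0 = u \<and>
        (\<forall>t\<in>{-r<..<r}. \<exists>k. frame_cov a b (\<lambda>t. loc_rep \<phi> U x (c t))
           (\<lambda>t. coframe a b (loc_rep \<phi> U x (c t)) (velocity (\<lambda>t. loc_rep \<phi> U x (c t)) t)) t = k *\<^sub>R u.e (c t)) \<and>
        biharmonic_curve (bcv_space a b) (bcv_metric a b) {-r<..<r} (\<lambda>t. loc_rep \<phi> U x (c t))"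
      using r sc cP c0 v0 acc by blast
  qed (rule generic)
qed

abbreviation reg where "reg U x \<equiv> biharmonic_patch.regular a b (loc_rep \<phi> U x) (loc_rep \<eta> U x)"

lemma reg_def: "(U, x) \<in> A \<Longrightarrow> reg U x q \<longleftrightarrow> (\<exists>u. pB U x q u \<bullet> pF U x q u \<noteq> 0)"
  by (rule biharmonic_patch.regular_def[OF bpatch])

text \<open>Polarisation: if II(w, w) = 0 for all w at a point, then by symmetry II(u, v) = 0
  there.\<close>

lemma regular_somewhere: "\<exists>U x. (U, x) \<in> A \<and> (\<exists>q\<in>x ` U. reg U x q)"
proof -
  obtain U x p u v where Ux: "(U, x) \<in> A" "p \<in> U" "second_fundamental_form a b \<phi> \<eta> U x p u v \<noteq> 0"
    using not_tot_geodesic unfolding totally_geodesic_def by blast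
  interpret u: biharmonic_patch a b "x ` U" "loc_rep \<phi> U x" "loc_rep \<eta> U x" by (rule bpatch[OF Ux(1)])
  have q: "x p \<in> x ` U" using Ux by simp
  have ne: "u.second_form (x p) u v \<noteq> 0"
    using Ux(3) u.second_form_eq[OF q, of v u]
    by (simp add: second_fundamental_form_def loc_diff_def loc_rep_chart[OF Ux(1,2)])
  have "u.regular (x p)"
  proof (rule ccontr)
    assume "\<not> ?thesis"
    then have z: "u.F (x p) w \<bullet> u.B (x p) w = 0" for w
      unfolding u.regular_def by (metis inner_commute)
    have "u.F (x p) v \<bullet> u.B (x p) u + u.F (x p) u \<bullet> u.B (x p) v = 0"
      using z[of "u + v"] z[of u] z[of v]
      by (simp add: linear_add[OF u.linear_F[OF q]] linear_add[OF u.linear_B[OF q]] inner_add_left inner_add_right)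
    then show False
      using ne u.second_form_sym[OF q, of u v] unfolding u.second_form_B[OF q] by simp
  qed
  then show ?thesis using Ux(1) q by blast
qed

lemma b_zero: "b = 0" and a_pos: "a > 0"
proof -
  obtain U x q where Ux: "(U, x) \<in> A" "q \<in> x ` U" "reg U x q" using regular_somewhere by blast
  show b: "b = 0" using biharmonic_patch.regular_shape(1)[OF bpatch[OF Ux(1)] Ux(2,3)] .
  obtain k where "k\<^sup>2 = 4 * a" using biharmonic_patch.regular_shape(2)[OF bpatch[OF Ux(1)] Ux(2,3)] by blast
  then show "a > 0" using generic b zero_le_power2[of k] by (cases "a = 0") auto
qed

text \<open>Splits the regular points by the sign of <B u, F u>, with s = 1 or -1, into two open
  sets; \<open>chart_change\<close> makes the choice of the chart irrelevant.\<close>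

definition shape_sign_set where "shape_sign_set s = {p. \<exists>U x. (U, x) \<in> A \<and> p \<in> U \<and> (\<exists>u. 0 < s * (pB U x (x p) u \<bullet> pF U x (x p) u))}"

lemma shape_sign_set_chart:
  assumes "(V, y) \<in> A" "p \<in> V"
  shows "p \<in> shape_sign_set s \<longleftrightarrow> (\<exists>u. 0 < s * (pB V y (y p) u \<bullet> pF V y (y p) u))"
  unfolding shape_sign_set_def using assms chart_change[OF _ assms(1) _ assms(2)] by (auto, metis)

lemma open_chart_vimage:
  assumes "(U, x) \<in> A" "open Q" shows "open (U \<inter> x -` Q)"
  by (rule continuous_open_preimage[OF chart(5,1)[OF assms(1)] assms(2)])

lemma open_by_charts:
  assumes "\<And>U x. (U, x) \<in> A \<Longrightarrow> \<exists>Q. open Q \<and> (\<forall>p\<in>U. p \<in> S \<longleftrightarrow> x p \<in> Q)"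
  shows "open S"
proof (subst open_subopen, rule ballI)
  fix p assume p: "p \<in> S"
  obtain U x where Ux: "(U, x) \<in> A" "p \<in> U" using chart_ex by blast
  obtain Q where Q: "open Q" "\<And>p. p \<in> U \<Longrightarrow> p \<in> S \<longleftrightarrow> x p \<in> Q" using assms[OF Ux(1)] by blast
  show "\<exists>T. open T \<and> p \<in> T \<and> T \<subseteq> S"
    using open_chart_vimage[OF Ux(1) Q(1)] Q(2) Ux(2) p by (intro exI[of _ "U \<inter> x -` Q"]) auto
qed

lemma open_shape_sign_set: "open (shape_sign_set s)"
proof (rule open_by_charts)
  fix U x assume Ux: "(U, x) \<in> A"
  interpret u: surface_patch a b "x ` U" "loc_rep \<phi> U x" "loc_rep \<eta> U x" by (rule patch[OF Ux])
  show "\<exists>Q. open Q \<and> (\<forall>p\<in>U. p \<in> shape_sign_set s \<longleftrightarrow> x p \<in> Q)"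
    using u.open_shape_pos[of s] shape_sign_set_chart[OF Ux]
    by (intro exI[of _ "{q \<in> x ` U. \<exists>u. 0 < s * (u.B q u \<bullet> u.F q u)}"]) auto
qed

lemma shape_sign_set_regular:
  assumes "(U, x) \<in> A" "p \<in> U"
  shows "reg U x (x p) \<longleftrightarrow> p \<in> shape_sign_set 1 \<or> p \<in> shape_sign_set (-1)"
  unfolding reg_def[OF assms(1)] shape_sign_set_chart[OF assms] by (auto simp: neq_iff)

lemma open_nonregular: "open (- (shape_sign_set 1 \<union> shape_sign_set (-1)))"
proof (rule open_by_charts)
  fix U x assume Ux: "(U, x) \<in> A"
  obtain U' x' where U': "(U', x') \<in> A" "\<exists>q\<in>x' ` U'. reg U' x' q" using regular_somewhere by blast
  have "open {q \<in> x ` U. \<not> reg U x q}"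
    by (rule biharmonic_patch.regular_or_open_nonregular[OF bpatch[OF Ux] U'(2) bpatch[OF U'(1)]])
  then show "\<exists>Q. open Q \<and> (\<forall>p\<in>U. p \<in> - (shape_sign_set 1 \<union> shape_sign_set (-1)) \<longleftrightarrow> x p \<in> Q)"
    using shape_sign_set_regular[OF Ux] by (intro exI[of _ "{q \<in> x ` U. \<not> reg U x q}"]) auto
qed

lemma connected_M: "connected (UNIV :: 'a set)"
  using surface by (simp add: bcv_surface_def)

lemma clopen_M: "open T \<Longrightarrow> open (- T) \<Longrightarrow> T = {} \<or> T = UNIV" for T :: "'a set"
  using connected_M by (simp add: connected_clopen closed_def)

lemma all_regular: "(U, x) \<in> A \<Longrightarrow> p \<in> U \<Longrightarrow> reg U x (x p)"
proof -
  assume Ux: "(U, x) \<in> A" "p \<in> U"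
  let ?R = "shape_sign_set 1 \<union> shape_sign_set (-1)"
  have "?R \<noteq> {}" using regular_somewhere shape_sign_set_regular by fastforce
  moreover have "open ?R" by (intro open_Un open_shape_sign_set)
  ultimately have "?R = UNIV" using clopen_M open_nonregular by blast
  then show ?thesis using shape_sign_set_regular[OF Ux] by auto
qed

lemma shape_at:
  assumes Ux: "(U, x) \<in> A" "p \<in> U"
  shows "nrm p \<bullet> E0 = 0" "nrm p \<bullet> nrm p = 1"
    "\<exists>k. k\<^sup>2 = 4 * a \<and> (\<forall>u. pB U x (x p) u = (k * (pF U x (x p) u \<bullet> cross3 (nrm p) E0)) *\<^sub>R cross3 (nrm p) E0)"
proof -
  interpret u: biharmonic_patch a b "x ` U" "loc_rep \<phi> U x" "loc_rep \<eta> U x" by (rule bpatch[OF Ux(1)])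
  have q: "x p \<in> x ` U" using Ux by simp
  note e = pe_chart[OF Ux, symmetric]
  show "nrm p \<bullet> E0 = 0" "nrm p \<bullet> nrm p = 1" unfolding e
    using u.E3_tangent[OF q all_regular[OF Ux]] u.unit_e[OF q] by auto
  show "\<exists>k. k\<^sup>2 = 4 * a \<and> (\<forall>u. pB U x (x p) u = (k * (pF U x (x p) u \<bullet> cross3 (nrm p) E0)) *\<^sub>R cross3 (nrm p) E0)"
    unfolding e using u.regular_shape(2)[OF q all_regular[OF Ux]] .
qed

text \<open>At each point k is 2 sqrt a or -2 sqrt a, and <B u, F u> = k <F u, h>^2 has the sign of
  k. The two sign sets are therefore disjoint, open and cover the surface, so one of them is
  everything and a single k serves all points.\<close>

lemma curvature_sign: "\<exists>k. k\<^sup>2 = 4 * a \<and> (\<forall>U x p u. (U, x) \<in> A \<longrightarrow> p \<in> U \<longrightarrow>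
    pB U x (x p) u = (k * (pF U x (x p) u \<bullet> cross3 (nrm p) E0)) *\<^sub>R cross3 (nrm p) E0)"
proof -
  have k_sign: "0 < s * k" if Ux: "(U, x) \<in> A" "p \<in> U" "p \<in> shape_sign_set s" and
    k: "\<And>u. pB U x (x p) u = (k * (pF U x (x p) u \<bullet> cross3 (nrm p) E0)) *\<^sub>R cross3 (nrm p) E0" for U x p s k
  proof -
    obtain u where "0 < s * (pB U x (x p) u \<bullet> pF U x (x p) u)" using shape_sign_set_chart[OF Ux(1,2)] Ux(3) by blast
    then have "0 < (s * k) * (pF U x (x p) u \<bullet> cross3 (nrm p) E0)\<^sup>2"
      unfolding k by (simp add: power2_eq_square inner_commute[of "cross3 (nrm p) E0"] mult.assoc)
    then show ?thesis by (simp add: zero_less_mult_iff)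
  qed
  have "shape_sign_set 1 \<union> shape_sign_set (-1) = UNIV"
    using all_regular shape_sign_set_regular chart_ex by (metis UNIV_eq_I UnCI)
  moreover have "shape_sign_set 1 \<inter> shape_sign_set (-1) = {}"
  proof (rule ccontr)
    assume "\<not> ?thesis"
    then obtain p where p: "p \<in> shape_sign_set 1" "p \<in> shape_sign_set (-1)" by auto
    obtain U x where Ux: "(U, x) \<in> A" "p \<in> U" using chart_ex by blast
    obtain k where "\<And>u. pB U x (x p) u = (k * (pF U x (x p) u \<bullet> cross3 (nrm p) E0)) *\<^sub>R cross3 (nrm p) E0"
      using shape_at(3)[OF Ux] by blast
    then have "0 < 1 * k" "0 < (-1) * k" using k_sign[OF Ux] p by blast+
    then show False by simp
  qed
  ultimately have "- shape_sign_set 1 = shape_sign_set (-1)" by blast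
  then have "shape_sign_set 1 = UNIV \<or> shape_sign_set (-1) = UNIV"
    using clopen_M[OF open_shape_sign_set[of 1]] open_shape_sign_set[of "-1"] by auto
  then obtain s :: real where s: "shape_sign_set s = UNIV" "s = 1 \<or> s = -1" by blast
  have "k = s * (2 * sqrt a)" if "k\<^sup>2 = 4 * a" "0 < s * k" for k
  proof -
    have "(s * k)\<^sup>2 = (2 * sqrt a)\<^sup>2" using that(1) s(2) a_pos by (auto simp: power_mult_distrib)
    then have "s * k = 2 * sqrt a" using that(2) a_pos power2_eq_iff_nonneg by (metis less_imp_le mult_nonneg_nonneg real_sqrt_ge_zero zero_le_numeral)
    then show ?thesis using s(2) by auto
  qed
  then have "pB U x (x p) u = ((s * (2 * sqrt a)) * (pF U x (x p) u \<bullet> cross3 (nrm p) E0)) *\<^sub>R cross3 (nrm p) E0"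
    if Ux: "(U, x) \<in> A" "p \<in> U" for U x p u
    using shape_at(3)[OF Ux] k_sign[OF Ux, of s] s(1) by (metis UNIV_I)
  moreover have "(s * (2 * sqrt a))\<^sup>2 = 4 * a" using s(2) a_pos by (auto simp: power_mult_distrib)
  ultimately show ?thesis by blast
qed

end

text \<open>The surface projects to a curve of geodesic curvature \<open>\<plusminus>k\<close> in the sphere of curvature \<open>4 a\<close>, hence to a
  circle. With \<open>w = x + i y\<close> and the conormal \<open>\<zeta>\<close>, the Killing field \<open>\<beta> + i \<rho> w + a cnj(\<beta>) w\<^sup>2\<close> of the rotation
  about its centre, normalised to equal \<open>- i \<lambda> \<zeta>\<close> on the curve, has \<open>\<rho> = k - 2 g\<close> and \<open>\<beta>\<close> given by the last two entries.\<close>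

definition circle_data :: "real \<Rightarrow> real \<Rightarrow> real^3 \<Rightarrow> real^3 \<Rightarrow> real^3" where
  "circle_data a k p v = (let g = (2 * a * (p $ 1 * v $ 1 + p $ 2 * v $ 2) + k) / bcv_lambda a p in
     vector [g, v $ 2 - g * p $ 2, g * p $ 1 - v $ 1])"

lemma vector3_axis: "x *\<^sub>R axis 1 1 + y *\<^sub>R axis 2 1 + z *\<^sub>R axis 3 (1::real) = (vector [x, y, z] :: real^3)"
  by (intro real3_eqI) (auto simp: axis_def)

lemma has_derivative_vector3:
  assumes "(f has_derivative f') F" "(g has_derivative g') F" "(h has_derivative h') F"
  shows "((\<lambda>x. vector [f x, g x, h x] :: real^3) has_derivative (\<lambda>u. vector [f' u, g' u, h' u])) F"
proof -
  have "((\<lambda>x. f x *\<^sub>R axis 1 1 + g x *\<^sub>R axis 2 1 + h x *\<^sub>R axis 3 (1::real) :: real^3) has_derivative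
     (\<lambda>u. f' u *\<^sub>R axis 1 1 + g' u *\<^sub>R axis 2 1 + h' u *\<^sub>R axis 3 (1::real))) F"
    by (intro has_derivative_add bounded_linear.has_derivative[OF bounded_linear_scaleR_left] assms)
  then show ?thesis by (simp only: vector3_axis)
qed

lemma has_derivative_nth: "(f has_derivative f') F \<Longrightarrow> ((\<lambda>x. f x $ i) has_derivative (\<lambda>u. f' u $ i)) F"
  by (rule bounded_linear.has_derivative[OF bounded_linear_vec_nth])

context surface_patch
begin

text \<open>A Frenet computation: the horizontal parts of df and de are both multiples of the
  conormal, with factors \<lambda> \<sigma> and \<open>m\<close>, and g \<lambda> \<sigma> = m. This
  relation cancels every derivative.\<close>

lemma circle_data_derivative:
  assumes b: "b = 0" and q: "q \<in> P" and n: "e q \<bullet> E0 = 0"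
    and B: "\<And>u. B q u = (k * (F q u \<bullet> cross3 (e q) E0)) *\<^sub>R cross3 (e q) E0"
  shows "((\<lambda>q. circle_data a k (f q) (e q)) has_derivative (\<lambda>_. 0)) (at q)"
proof -
  define l where "l = bcv_lambda a (f q)"
  have l: "l > 0" using in_space[OF q] by (simp add: l_def bcv_space_def)
  define x y n1 n2 where "x = f q $ 1" "y = f q $ 2" "n1 = e q $ 1" "n2 = e q $ 2"
  note defs = x_y_n1_n2_def
  have lxy: "l = 1 + a * (x\<^sup>2 + y\<^sup>2)" by (simp add: l_def bcv_lambda_def defs)
  have nn: "n1\<^sup>2 + n2\<^sup>2 = 1"
    using unit_e[OF q] n by (simp add: inner_real3 axis_def defs power2_eq_square)
  define \<sigma> where "\<sigma> u = F q u \<bullet> cross3 (e q) E0" for u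
  define Df where "Df = frechet_derivative f (at q)"
  define De where "De = frechet_derivative e (at q)"
  \<comment> \<open>The factor of de along the conormal: the curvature term k \<sigma> plus the
    correction by the third component of the connection.\<close>
  define m where "m u = k * \<sigma> u + 2 * a * \<sigma> u * (x * n1 + y * n2)" for u
  have F12: "F q u $ 1 = \<sigma> u * n2" "F q u $ 2 = - (\<sigma> u * n1)" for u
  proof -
    have s: "\<sigma> u = F q u $ 1 * n2 - F q u $ 2 * n1" and o: "F q u $ 1 * n1 + F q u $ 2 * n2 = 0"
      using normal_F[OF q, of u] n by (simp_all add: \<sigma>_def inner_real3 cross3_nth axis_def defs)
    have "F q u $ 1 * (n1\<^sup>2 + n2\<^sup>2) = \<sigma> u * n2" "F q u $ 2 * (n1\<^sup>2 + n2\<^sup>2) = - (\<sigma> u * n1)"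
      using s o by algebra+
    then show "F q u $ 1 = \<sigma> u * n2" "F q u $ 2 = - (\<sigma> u * n1)" by (simp_all add: nn)
  qed
  have f12: "Df u $ 1 = l * \<sigma> u * n2" "Df u $ 2 = - (l * \<sigma> u * n1)" for u
    using F12[of u] l unfolding F_def Df_def by (simp_all add: l_def field_simps)
  have e12: "De u $ 1 = m u * n2" "De u $ 2 = - (m u * n1)" for u
  proof -
    have De: "De u $ i = ((k * \<sigma> u) *\<^sub>R cross3 (e q) E0) $ i - cross3 (W q u) (e q) $ i" for i
      unfolding \<sigma>_def B[symmetric] by (simp add: B_def De_def)
    have W3: "W q u $ 1 = 0" "W q u $ 2 = 0" "W q u $ 3 = 2 * a * \<sigma> u * (x * n1 + y * n2)"
      unfolding conn_vec_nth F12 defs[symmetric] using b by (simp_all add: algebra_simps)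
    have e3: "e q $ 3 = 0" using n by (simp add: inner_axis3)
    have h: "cross3 (e q) E0 $ 1 = n2" "cross3 (e q) E0 $ 2 = - n1"
      by (simp_all add: cross3_nth axis_def defs)
    show "De u $ 1 = m u * n2" "De u $ 2 = - (m u * n1)"
      unfolding De cross3_nth(1,2)[of "W q u"] W3 e3 m_def
      by (simp_all add: h defs[symmetric] algebra_simps)
  qed
  define g where "g = (\<lambda>q. (2 * a * (f q $ 1 * e q $ 1 + f q $ 2 * e q $ 2) + k) / bcv_lambda a (f q))"
  have f: "((\<lambda>q. f q $ i) has_derivative (\<lambda>u. Df u $ i)) (at q)" for i
    unfolding Df_def by (rule has_derivative_nth[OF smooth_on_has_derivative[OF smooth_f q]])
  have e: "((\<lambda>q. e q $ i) has_derivative (\<lambda>u. De u $ i)) (at q)" for i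
    unfolding De_def by (rule has_derivative_nth[OF smooth_on_has_derivative[OF smooth_e q]])
  have gl: "g q * l = 2 * a * (x * n1 + y * n2) + k"
    using l by (simp add: g_def defs l_def[symmetric])
  \<comment> \<open>By m = g \<lambda> \<sigma>, the derivative of the numerator is g times that of
    the denominator, so the quotient is stationary.\<close>
  have g: "(g has_derivative (\<lambda>_. 0)) (at q)"
  proof -
    have N: "((\<lambda>q. 2 * a * (f q $ 1 * e q $ 1 + f q $ 2 * e q $ 2) + k) has_derivative
       (\<lambda>u. 2 * a * m u * (x * n2 - y * n1))) (at q)"
      by (rule derivative_eq_intros f e refl)+
        (simp add: fun_eq_iff f12 e12 defs[symmetric] algebra_simps)
    have L: "((\<lambda>q. bcv_lambda a (f q)) has_derivative (\<lambda>u. 2 * a * l * \<sigma> u * (x * n2 - y * n1))) (at q)"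
      unfolding bcv_lambda_def power2_eq_square
      by (rule derivative_eq_intros f e refl)+
        (simp add: fun_eq_iff f12 e12 defs[symmetric] algebra_simps)
    show ?thesis
      unfolding g_def
      apply (rule has_derivative_eq_rhs[OF has_derivative_divide'[OF N L]])
      using l apply (simp add: l_def)
      using l apply (simp add: fun_eq_iff defs[symmetric] l_def[symmetric] m_def)
      apply (simp add: algebra_simps)
      done
  qed
  have "((\<lambda>q. vector [g q, e q $ 2 - g q * f q $ 2, g q * f q $ 1 - e q $ 1] :: real^3) has_derivative
      (\<lambda>u. vector [0, De u $ 2 - (g q * Df u $ 2 + 0 * f q $ 2), (g q * Df u $ 1 + 0 * f q $ 1) - De u $ 1])) (at q)"
    by (intro has_derivative_vector3 has_derivative_diff has_derivative_mult g e f)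
  moreover have "De u $ 2 - (g q * Df u $ 2 + 0 * f q $ 2) = 0" "(g q * Df u $ 1 + 0 * f q $ 1) - De u $ 1 = 0" for u
  proof -
    have 1: "g q * (l * \<sigma> u * z) = m u * z" for z
      using gl unfolding m_def by algebra
    show "De u $ 2 - (g q * Df u $ 2 + 0 * f q $ 2) = 0" "(g q * Df u $ 1 + 0 * f q $ 1) - De u $ 1 = 0"
      by (simp_all add: f12 e12 1)
  qed
  moreover have "vector [0, 0, 0] = (0 :: real^3)" by (intro real3_eqI) simp_all
  moreover have "(\<lambda>q. vector [g q, e q $ 2 - g q * f q $ 2, g q * f q $ 1 - e q $ 1] :: real^3) =
      (\<lambda>q. circle_data a k (f q) (e q))"
    by (simp add: circle_data_def g_def Let_def)
  ultimately show ?thesis by simp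
qed

end

section \<open>The rotation group and its conjugates for \<open>b = 0\<close>, \<open>a > 0\<close>\<close>

lemma bcv_space_UNIV: "a > 0 \<Longrightarrow> bcv_space a b = UNIV"
  by (auto simp: bcv_space_def bcv_lambda_def add_pos_nonneg)

lemma bcv_lambda_pos: "a > 0 \<Longrightarrow> bcv_lambda a p > 0"
  by (simp add: bcv_lambda_def add_pos_nonneg)

lemma bcv_metric_0: "bcv_metric a 0 p v w = (v $ 1 * w $ 1 + v $ 2 * w $ 2) / (bcv_lambda a p)\<^sup>2 + v $ 3 * w $ 3"
  by (simp add: bcv_metric_def bcv_form_def)

definition circle_field :: "real \<Rightarrow> real \<Rightarrow> real \<Rightarrow> real \<Rightarrow> real^3 \<Rightarrow> real^3" where
  "circle_field a \<rho> \<beta>1 \<beta>2 p = vector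
    [\<beta>1 - \<rho> * p $ 2 + a * (\<beta>1 * ((p $ 1)\<^sup>2 - (p $ 2)\<^sup>2) + 2 * \<beta>2 * p $ 1 * p $ 2),
     \<beta>2 + \<rho> * p $ 1 + a * (2 * \<beta>1 * p $ 1 * p $ 2 - \<beta>2 * ((p $ 1)\<^sup>2 - (p $ 2)\<^sup>2)), 0]"

text \<open>Infinitesimally the field is a rotation by \<open>r\<close> and a dilation by
  \<open>s\<close> of the plane; along it the conformal factor grows at the relative rate
  \<open>s\<close>, which compensates the dilation.\<close>

lemma killing_circle_field:
  assumes a: "a > 0"
  shows "killing_field (bcv_space a 0) (bcv_metric a 0) (circle_field a \<rho> \<beta>1 \<beta>2)"
  unfolding killing_field_def bcv_space_UNIV[OF a]
proof (intro conjI ballI allI)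
  show "smooth_on UNIV (circle_field a \<rho> \<beta>1 \<beta>2)"
    unfolding circle_field_def[abs_def]
    by (intro smooth_on_vector3 smooth_on_add smooth_on_diff smooth_on_mult smooth_on_power smooth_on_nth
        smooth_on_id smooth_on_const open_UNIV)
  fix p u v :: "real^3"
  define x y where "x = p $ 1" "y = p $ 2"
  note xy = x_y_def
  define l where "l = bcv_lambda a p"
  have l: "l > 0" unfolding l_def by (rule bcv_lambda_pos[OF a])
  have pN: "p \<in> bcv_space a 0" by (simp add: bcv_space_UNIV[OF a])
  \<comment> \<open>\<open>s\<close> and \<open>r\<close> are the real and imaginary parts of the
    complex derivative i \<rho> + 2 a cnj(\<beta>) w.\<close>
  define s where "s = 2 * a * (\<beta>1 * x + \<beta>2 * y)"
  define r where "r = \<rho> + 2 * a * (\<beta>1 * y - \<beta>2 * x)"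
  let ?X = "circle_field a \<rho> \<beta>1 \<beta>2"
  have nth: "((\<lambda>p. p $ i) has_derivative (\<lambda>u. u $ i)) (at p)" for i :: 3 and p :: "real^3"
    by (rule has_derivative_nth[OF has_derivative_ident])
  have "(?X has_derivative (\<lambda>u. vector [s * u $ 1 - r * u $ 2, r * u $ 1 + s * u $ 2, 0])) (at p)"
    unfolding circle_field_def[abs_def] power2_eq_square
    by (rule has_derivative_vector3; (rule derivative_eq_intros nth refl)+)
      (simp_all add: fun_eq_iff s_def r_def xy algebra_simps)
  from frechet_derivative_at[OF this, symmetric]
  have DX: "frechet_derivative ?X (at p) u = vector [s * u $ 1 - r * u $ 2, r * u $ 1 + s * u $ 2, 0]" for u by simp
  have lX: "2 * a * (x * ?X p $ 1 + y * ?X p $ 2) = s * l"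
    unfolding circle_field_def l_def bcv_lambda_def s_def xy
    by (simp add: power2_eq_square algebra_simps)
  have md: "metric_deriv (bcv_metric a 0) p (?X p) u v = - 2 * s * (u $ 1 * v $ 1 + u $ 2 * v $ 2) / l\<^sup>2"
    unfolding metric_deriv_bcv[OF pN] inner_real3 coframe_deriv_nth coframe_nth l_def[symmetric] xy[symmetric] lX
    using l by (simp add: field_simps power2_eq_square)
  show "metric_deriv (bcv_metric a 0) p (?X p) u v + bcv_metric a 0 p (frechet_derivative ?X (at p) u) v
      + bcv_metric a 0 p u (frechet_derivative ?X (at p) v) = 0"
    unfolding md DX bcv_metric_0 l_def[symmetric] using l
    by (simp add: field_simps)
qed

definition rot_field :: "real \<Rightarrow> real^3 \<Rightarrow> real^3" where
  "rot_field s p = vector [- (s * p $ 2), s * p $ 1, 0]"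

definition rot_map :: "real \<Rightarrow> real^3 \<Rightarrow> real^3" where
  "rot_map t p = vector [cos t * p $ 1 - sin t * p $ 2, sin t * p $ 1 + cos t * p $ 2, p $ 3]"

lemma bounded_linear_rot_map: "bounded_linear (rot_map t)"
  unfolding linear_conv_bounded_linear[symmetric]
  by (rule linearI; rule real3_eqI) (auto simp: rot_map_def algebra_simps)

lemma rot_map_add: "rot_map (s + t) p = rot_map s (rot_map t p)"
  by (rule real3_eqI) (simp_all add: rot_map_def cos_add sin_add algebra_simps)

lemma rot_map_0: "rot_map 0 p = p"
  by (rule real3_eqI) (simp_all add: rot_map_def)

lemma rot_map_norm: "(rot_map t p $ 1)\<^sup>2 + (rot_map t p $ 2)\<^sup>2 = (p $ 1)\<^sup>2 + (p $ 2)\<^sup>2"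
proof -
  have "(rot_map t p $ 1)\<^sup>2 + (rot_map t p $ 2)\<^sup>2 = ((cos t)\<^sup>2 + (sin t)\<^sup>2) * ((p $ 1)\<^sup>2 + (p $ 2)\<^sup>2)"
    unfolding rot_map_def vector_3 by algebra
  then show ?thesis by simp
qed

lemma generates_rot_field:
  assumes a: "a > 0" and s: "s > 0"
  shows "generates_SO2_action (bcv_space a 0) (bcv_metric a 0) (rot_field s)"
  unfolding generates_SO2_action_def bcv_space_UNIV[OF a]
proof (intro exI conjI allI ballI)
  let ?\<psi> = "\<lambda>t. rot_map (s * t)"
  show "0 < 2 * pi / s" using s by simp
  show "bij_betw (?\<psi> t) UNIV UNIV" for t
    by (rule bij_betw_byWitness[where f'="?\<psi> (- t)"]) (auto simp: rot_map_add[symmetric] rot_map_0)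
  show "local_isometry UNIV (bcv_metric a 0) UNIV (?\<psi> t)" for t
    unfolding local_isometry_def
  proof (intro conjI ballI allI)
    show "smooth_on UNIV (?\<psi> t)" by (intro smooth_on_linear bounded_linear_rot_map) simp
    fix p u v :: "real^3"
    have fd: "frechet_derivative (?\<psi> t) (at p) = ?\<psi> t"
      by (rule frechet_derivative_at[symmetric]) (rule bounded_linear_imp_has_derivative[OF bounded_linear_rot_map])
    have lam: "bcv_lambda a (?\<psi> t p) = bcv_lambda a p" unfolding bcv_lambda_def rot_map_norm ..
    have "?\<psi> t u $ 1 * ?\<psi> t v $ 1 + ?\<psi> t u $ 2 * ?\<psi> t v $ 2 =
        ((cos (s * t))\<^sup>2 + (sin (s * t))\<^sup>2) * (u $ 1 * v $ 1 + u $ 2 * v $ 2)"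
      unfolding rot_map_def vector_3 by algebra
    then show "pullback (?\<psi> t) (bcv_metric a 0) p u v = bcv_metric a 0 p u v"
      unfolding pullback_def fd bcv_metric_0 lam by (simp add: rot_map_def)
  qed auto
  show "?\<psi> (r + t) p = ?\<psi> r (?\<psi> t p)" for r t p by (simp add: rot_map_add distrib_left)
  show "(\<forall>p\<in>UNIV. ?\<psi> t p = p) \<longleftrightarrow> (\<exists>k::int. t = of_int k * (2 * pi / s))" for t
  proof
    assume "\<forall>p\<in>UNIV. ?\<psi> t p = p"
    \<comment> \<open>A horizontal test vector detects the rotation angle, which must be a multiple
      of 2 \<pi>.\<close>
    then have "?\<psi> t (axis 1 1) $ 1 = (axis 1 1 :: real^3) $ 1" by simp
    then have "cos (s * t) = 1" by (simp add: rot_map_def axis_def)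
    then obtain n :: int where "s * t = of_int n * 2 * pi" using cos_one_2pi_int by auto
    then show "\<exists>k::int. t = of_int k * (2 * pi / s)" using s by (auto simp: field_simps)
  next
    assume "\<exists>k::int. t = of_int k * (2 * pi / s)"
    then obtain k :: int where "t = of_int k * (2 * pi / s)" by blast
    then have "s * t = of_int k * 2 * pi" using s by simp
    then have c: "cos (s * t) = 1" using cos_one_2pi_int by auto
    then have "sin (s * t) = 0" using sin_cos_squared_add[of "s * t"] by simp
    with c show "\<forall>p\<in>UNIV. ?\<psi> t p = p" by (auto simp: rot_map_def intro!: real3_eqI)
  qed
  show "((\<lambda>r. ?\<psi> r p) has_vector_derivative rot_field s (?\<psi> t p)) (at t)" for t p
  proof -
    have "((\<lambda>r. vector [cos (s * r) * p $ 1 - sin (s * r) * p $ 2, sin (s * r) * p $ 1 + cos (s * r) * p $ 2, p $ 3] :: real^3)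
        has_derivative (\<lambda>h. vector [(h * s * - sin (s * t)) * p $ 1 - (h * s * cos (s * t)) * p $ 2,
          (h * s * cos (s * t)) * p $ 1 + (h * s * - sin (s * t)) * p $ 2, 0])) (at t)"
      by (rule has_derivative_vector3) (auto intro!: derivative_eq_intros simp: fun_eq_iff algebra_simps)
    then show ?thesis
      unfolding has_vector_derivative_def rot_map_def[symmetric]
      by (rule has_derivative_eq_rhs) (intro ext real3_eqI; simp add: rot_field_def rot_map_def algebra_simps)
  qed
qed

definition cpart :: "real^3 \<Rightarrow> complex" where "cpart p = Complex (p $ 1) (p $ 2)"

lemma cpart_simps [simp]: "Re (cpart p) = p $ 1" "Im (cpart p) = p $ 2"
  by (simp_all add: cpart_def)

lemma bounded_linear_cpart: "bounded_linear cpart"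
  unfolding linear_conv_bounded_linear[symmetric]
  by (rule linearI) (simp_all add: cpart_def complex_eq_iff)

lemma bcv_lambda_cpart: "bcv_lambda a p = 1 + a * (cmod (cpart p))\<^sup>2"
  by (simp add: bcv_lambda_def cmod_power2)

lemma bcv_metric_cpart: "bcv_metric a 0 p u v = Re (cpart u * cnj (cpart v)) / (bcv_lambda a p)\<^sup>2 + u $ 3 * v $ 3"
  by (simp add: bcv_metric_0)

text \<open>In a stereographic coordinate, the rotation of the sphere of curvature 4 a that takes c
  to 0 and its antipode -1 / (a cnj c) to infinity.\<close>

definition mobius :: "real \<Rightarrow> complex \<Rightarrow> complex \<Rightarrow> complex" where
  "mobius a c w = (w - c) / (1 + a * cnj c * w)"

definition mobius_map :: "real \<Rightarrow> complex \<Rightarrow> real^3 \<Rightarrow> real^3" where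
  "mobius_map a c p = vector [Re (mobius a c (cpart p)), Im (mobius a c (cpart p)), p $ 3]"

lemma cpart_mobius_map [simp]: "cpart (mobius_map a c p) = mobius a c (cpart p)"
  by (simp add: mobius_map_def cpart_def)

text \<open>Rests on |1 + a cnj(c) w|^2 + a |w - c|^2 = (1 + a |c|^2) (1 + a |w|^2). It gives the
  conformal factor at the image point.\<close>

lemma mobius_norm:
  assumes "1 + a * cnj c * w \<noteq> 0"
  shows "1 + a * (cmod (mobius a c w))\<^sup>2 = (1 + a * (cmod c)\<^sup>2) * (1 + a * (cmod w)\<^sup>2) / (cmod (1 + a * cnj c * w))\<^sup>2"
proof -
  have "(cmod (1 + a * cnj c * w))\<^sup>2 + a * (cmod (w - c))\<^sup>2 = (1 + a * (cmod c)\<^sup>2) * (1 + a * (cmod w)\<^sup>2)"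
    unfolding cmod_power2 by (simp add: power2_eq_square algebra_simps)
  then show ?thesis
    using assms by (simp add: mobius_def norm_divide power_divide divide_simps)
qed

lemma mobius_deriv:
  assumes "1 + a * cnj c * w \<noteq> 0"
  shows "(mobius a c has_field_derivative of_real (1 + a * (cmod c)\<^sup>2) / (1 + a * cnj c * w)\<^sup>2) (at w)"
proof -
  have "of_real (1 + a * (cmod c)\<^sup>2) = 1 + a * (c * cnj c)"
    unfolding of_real_add of_real_mult complex_norm_square by simp
  then show ?thesis
    unfolding mobius_def[abs_def] using assms
    by (auto intro!: derivative_eq_intros simp: power2_eq_square algebra_simps)
qed

lemma mobius_map_has_derivative:
  assumes "1 + a * cnj c * cpart p \<noteq> 0"
  defines "m \<equiv> of_real (1 + a * (cmod c)\<^sup>2) / (1 + a * cnj c * cpart p)\<^sup>2"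
  shows "(mobius_map a c has_derivative (\<lambda>u. vector [Re (m * cpart u), Im (m * cpart u), u $ 3])) (at p)"
proof -
  have "((\<lambda>p. mobius a c (cpart p)) has_derivative (\<lambda>u. m * cpart u)) (at p)"
    using diff_chain_at[OF bounded_linear_imp_has_derivative[OF bounded_linear_cpart]
       mobius_deriv[OF assms(1), unfolded has_field_derivative_def]]
    by (simp add: o_def m_def)
  then show ?thesis
    unfolding mobius_map_def[abs_def]
    by (intro has_derivative_vector3 has_derivative_nth has_derivative_ident
        bounded_linear.has_derivative[OF bounded_linear_Re] bounded_linear.has_derivative[OF bounded_linear_Im])
qed

text \<open>The modulus of the complex derivative equals the ratio of the conformal factors at image
  and source. The domain leaves out the fibre over the antipode of c.\<close>

lemma mobius_map_local_isometry:
  assumes a: "a > 0"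
  shows "local_isometry (bcv_space a 0) (bcv_metric a 0) {p. 1 + a * cnj c * cpart p \<noteq> 0} (mobius_map a c)"
  unfolding local_isometry_def bcv_space_UNIV[OF a]
proof (intro conjI ballI allI)
  let ?U = "{p. 1 + a * cnj c * cpart p \<noteq> 0}"
  have cc: "continuous_on UNIV cpart" by (rule linear_continuous_on[OF bounded_linear_cpart])
  show oU: "open ?U"
    by (intro open_Collect_neq continuous_intros cc)
  have "smooth_on ?U (\<lambda>p. mobius a c (cpart p))"
    unfolding mobius_def
    by (intro smooth_on_divide smooth_on_diff smooth_on_add smooth_on_mult smooth_on_const oU
        smooth_on_linear[OF _ bounded_linear_cpart]) auto
  then show "smooth_on ?U (mobius_map a c)"
    unfolding mobius_map_def[abs_def]
    by (intro smooth_on_vector3 smooth_on_nth smooth_on_id oU smooth_on_linear_comp[OF _ bounded_linear_Re]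
        smooth_on_linear_comp[OF _ bounded_linear_Im])
  fix p u v assume p: "p \<in> ?U"
  define d where "d = 1 + a * cnj c * cpart p"
  define \<kappa> where "\<kappa> = 1 + a * (cmod c)\<^sup>2"
  define m where "m = of_real \<kappa> / d\<^sup>2"
  have d: "d \<noteq> 0" and \<kappa>: "\<kappa> > 0" using p a by (auto simp: d_def \<kappa>_def add_pos_nonneg)
  have fd: "frechet_derivative (mobius_map a c) (at p) u = vector [Re (m * cpart u), Im (m * cpart u), u $ 3]" for u
    using frechet_derivative_at[OF mobius_map_has_derivative[of a c p], symmetric] p by (simp add: m_def \<kappa>_def d_def)
  have cp: "cpart (vector [Re z, Im z, r]) = z" for z r by (simp add: cpart_def)
  have "(m * cpart u) * cnj (m * cpart v) = of_real ((cmod m)\<^sup>2) * (cpart u * cnj (cpart v))"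
    by (simp add: complex_norm_square algebra_simps del: of_real_power)
  moreover have "Re (of_real r * z) = r * Re z" for r z by simp
  ultimately have 1: "Re ((m * cpart u) * cnj (m * cpart v)) = (cmod m)\<^sup>2 * Re (cpart u * cnj (cpart v))"
    by (simp only:)
  have 2: "bcv_lambda a (mobius_map a c p) = \<kappa> * bcv_lambda a p / (cmod d)\<^sup>2"
    using mobius_norm[of a c "cpart p"] d by (simp add: bcv_lambda_cpart \<kappa>_def d_def)
  have 3: "cmod m = \<kappa> / (cmod d)\<^sup>2" using \<kappa> by (simp add: m_def norm_divide norm_power)
  show "pullback (mobius_map a c) (bcv_metric a 0) p u v = bcv_metric a 0 p u v"
    unfolding pullback_def fd bcv_metric_cpart cp 1 2 3 using \<kappa> d bcv_lambda_pos[OF a, of p]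
    by (simp add: power_divide power_mult_distrib divide_simps)
qed auto


text \<open>The rotation about the centre \<open>c\<close> becomes the rotation about \<open>0\<close> under the Moebius transformation.\<close>

lemma mobius_map_circle_field:
  assumes a: "a > 0" and s: "s > 0" and \<rho>: "\<rho> \<ge> 0" and norm: "s\<^sup>2 = \<rho>\<^sup>2 + 4 * a * (\<beta>1\<^sup>2 + \<beta>2\<^sup>2)"
  defines "c \<equiv> of_real (2 / (s + \<rho>)) * \<i> * Complex \<beta>1 \<beta>2"
  shows "cpart (circle_field a \<rho> \<beta>1 \<beta>2 p) \<noteq> 0 \<Longrightarrow> 1 + a * cnj c * cpart p \<noteq> 0"
    and "1 + a * cnj c * cpart p \<noteq> 0 \<Longrightarrow>
      frechet_derivative (mobius_map a c) (at p) (circle_field a \<rho> \<beta>1 \<beta>2 p) = rot_field s (mobius_map a c p)"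
proof -
  define \<beta> where "\<beta> = Complex \<beta>1 \<beta>2"
  define w where "w = cpart p"
  define d where "d = 1 + a * cnj c * w"
  define \<kappa> where "\<kappa> = 1 + a * (cmod c)\<^sup>2"
  define X where "X = cpart (circle_field a \<rho> \<beta>1 \<beta>2 p)"
  have X: "X = \<beta> + \<i> * \<rho> * w + a * cnj \<beta> * w\<^sup>2"
    by (simp add: X_def \<beta>_def w_def complex_eq_iff circle_field_def power2_eq_square algebra_simps)
  have sr: "s + \<rho> > 0" using s \<rho> by simp
  have c: "c = of_real (2 / (s + \<rho>)) * \<i> * \<beta>" by (simp add: c_def \<beta>_def)
  have "(cmod c)\<^sup>2 = 4 * (\<beta>1\<^sup>2 + \<beta>2\<^sup>2) / (s + \<rho>)\<^sup>2"
    using sr unfolding c norm_mult by (simp add: power_mult_distrib power_divide \<beta>_def cmod_power2 norm_divide)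
  then have "(cmod c)\<^sup>2 * (s + \<rho>)\<^sup>2 = 4 * (\<beta>1\<^sup>2 + \<beta>2\<^sup>2)"
    using sr by simp
  then have "a * (cmod c)\<^sup>2 * (s + \<rho>)\<^sup>2 = (s - \<rho>) * (s + \<rho>)"
    using norm by algebra
  then have ac: "a * (cmod c)\<^sup>2 = (s - \<rho>) / (s + \<rho>)"
    using sr by (simp add: eq_divide_eq power2_eq_square flip: mult.assoc)
  have \<kappa>: "\<kappa> = 2 * s / (s + \<rho>)" "1 - a * (cmod c)\<^sup>2 = 2 * \<rho> / (s + \<rho>)"
    using sr unfolding \<kappa>_def ac by (simp_all add: field_simps)
  have \<kappa>0: "\<kappa> > 0" using s sr by (simp add: \<kappa>)
  have k\<rho>: "\<kappa> * \<rho> = s * (1 - a * (cmod c)\<^sup>2)" unfolding \<kappa> by simp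
  have k\<beta>: "of_real \<kappa> * \<beta> = - (\<i> * s * c)" "of_real \<kappa> * cnj \<beta> = \<i> * s * cnj c"
    unfolding \<kappa> c by (simp_all add: complex_eq_iff)
  \<comment> \<open>The quadratic field factors over its zeros, the centre c and its antipode, where
    d = 0. So a point at which the field does not vanish lies in the domain of the Moebius
    map.\<close>
  have key: "of_real \<kappa> * X = \<i> * s * ((w - c) * d)"
  proof -
    define A where "A = (cmod c)\<^sup>2"
    have AA: "complex_of_real A = c * cnj c" unfolding A_def by (rule complex_norm_square)
    have "of_real \<kappa> * X = of_real \<kappa> * \<beta> + \<i> * of_real (\<kappa> * \<rho>) * w + a * (of_real \<kappa> * cnj \<beta>) * w\<^sup>2"
      by (simp add: X algebra_simps)
    also have "\<dots> = \<i> * s * (- c + of_real (1 - a * A) * w + a * cnj c * w\<^sup>2)"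
      unfolding k\<beta> k\<rho> A_def[symmetric] by (simp add: algebra_simps)
    also have "- c + of_real (1 - a * A) * w + a * cnj c * w\<^sup>2 = (w - c) * d"
      by (simp add: AA d_def power2_eq_square algebra_simps)
    finally show ?thesis .
  qed
  show "1 + a * cnj c * cpart p \<noteq> 0" if "cpart (circle_field a \<rho> \<beta>1 \<beta>2 p) \<noteq> 0"
    using key that \<kappa>0 unfolding X_def[symmetric] d_def[symmetric] w_def[symmetric] by auto
  assume "1 + a * cnj c * cpart p \<noteq> 0"
  then have d: "d \<noteq> 0" by (simp add: d_def w_def)
  have "mobius a c w = (w - c) / d" by (simp add: mobius_def d_def)
  moreover have "of_real \<kappa> / d\<^sup>2 * X = (of_real \<kappa> * X) / d\<^sup>2" by simp
  ultimately have "of_real \<kappa> / d\<^sup>2 * X = \<i> * s * mobius a c w"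
    unfolding key using d by (simp add: power2_eq_square)
  then have mX: "of_real (1 + a * (cmod c)\<^sup>2) / (1 + a * cnj c * cpart p)\<^sup>2 * cpart (circle_field a \<rho> \<beta>1 \<beta>2 p)
      = \<i> * s * mobius a c (cpart p)"
    unfolding \<kappa>_def X_def d_def w_def .
  show "frechet_derivative (mobius_map a c) (at p) (circle_field a \<rho> \<beta>1 \<beta>2 p) = rot_field s (mobius_map a c p)"
    unfolding frechet_derivative_at[OF mobius_map_has_derivative[OF d[unfolded d_def w_def]], symmetric] mX
    by (intro real3_eqI) (simp_all add: rot_field_def mobius_map_def circle_field_def)
qed

context totally_biharmonic_immersion
begin

lemma rotational_hopf_cylinder_immersion: "rotational_hopf_cylinder a b A \<phi>"
proof -
  note b = b_zero and a = a_pos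
  obtain k where k: "k\<^sup>2 = 4 * a" and B: "\<And>U x p u. (U, x) \<in> A \<Longrightarrow> p \<in> U \<Longrightarrow>
     pB U x (x p) u = (k * (pF U x (x p) u \<bullet> cross3 (nrm p) E0)) *\<^sub>R cross3 (nrm p) E0"
    using curvature_sign by blast
  have nrm: "nrm p \<bullet> E0 = 0" "nrm p \<bullet> nrm p = 1" for p
    using shape_at(1,2) chart_ex by metis+
  have tangent: "X \<in> range (loc_diff \<phi> U x p)"
    if Ux: "(U, x) \<in> A" "p \<in> U" and X: "coframe a b (\<phi> p) X \<bullet> nrm p = 0" for U x p X
  proof -
    interpret u: surface_patch a b "x ` U" "loc_rep \<phi> U x" "loc_rep \<eta> U x" by (rule patch[OF Ux(1)])
    have "x p \<in> x ` U" using Ux by simp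
    then show ?thesis unfolding loc_diff_def
      by (rule u.tangent_range) (simp add: pe_chart[OF Ux] loc_rep_chart[OF Ux] X)
  qed
  define C where "C p = circle_data a k (\<phi> p) (nrm p)" for p
  \<comment> \<open>In a chart the data have zero derivative, hence are constant on a ball;
    connectedness then makes them globally constant.\<close>
  have "\<forall>\<^sub>F q in at p within UNIV. C p = C q" for p
  proof -
    obtain U x where Ux: "(U, x) \<in> A" "p \<in> U" using chart_ex by blast
    interpret u: surface_patch a b "x ` U" "loc_rep \<phi> U x" "loc_rep \<eta> U x" by (rule patch[OF Ux(1)])
    obtain r where r: "r > 0" "ball (x p) r \<subseteq> x ` U"
      using Ux u.open_P open_contains_ball by blast
    define g where "g q = circle_data a k (loc_rep \<phi> U x q) (u.e q)" for q
    have gC: "g (x q) = C q" if "q \<in> U" for q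
      using that by (simp add: g_def C_def pe_chart[OF Ux(1)] loc_rep_chart[OF Ux(1)])
    have "(g has_derivative (\<lambda>_. 0)) (at z within ball (x p) r)" if z: "z \<in> ball (x p) r" for z
    proof (rule has_derivative_at_withinI)
      obtain q where q: "q \<in> U" "z = x q" using r z by auto
      have zP: "z \<in> x ` U" using q by simp
      note ez = pe_chart[OF Ux(1) q(1), folded q(2)]
      show "(g has_derivative (\<lambda>_. 0)) (at z)"
        unfolding g_def[abs_def]
        by (rule u.circle_data_derivative[OF b zP]; unfold ez)
          (use nrm B[OF Ux(1) q(1)] q(2) in auto)
    qed
    then obtain y where y: "\<And>z. z \<in> ball (x p) r \<Longrightarrow> g z = y"
      using has_derivative_zero_constant[of "ball (x p) r" g] by auto
    have "open (U \<inter> x -` ball (x p) r)" by (rule open_chart_vimage[OF Ux(1)]) simp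
    moreover have "p \<in> U \<inter> x -` ball (x p) r" using Ux r by simp
    moreover have "C p = C q" if "q \<in> U \<inter> x -` ball (x p) r" for q
      using that y gC Ux(2) r(1) by (metis IntE centre_in_ball vimageE)
    ultimately show ?thesis unfolding eventually_at_topological by blast
  qed
  then have Cc: "C p = C q" for p q
    using connected_local_const[OF connected_M UNIV_I UNIV_I, of C p q] by blast
  obtain p0 :: 'a where True by blast
  define g \<beta>1 \<beta>2 where "g = C p0 $ 1" "\<beta>1 = C p0 $ 2" "\<beta>2 = C p0 $ 3"
  \<comment> \<open>Reversing the field if necessary makes its \<rho> nonnegative; then s + \<rho> >
    0, and one formula gives the centre, also when \<beta> = 0.\<close>
  define \<sigma> where "\<sigma> = (if k - 2 * g \<ge> 0 then 1 else - 1 :: real)"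
  have \<sigma>: "\<sigma>\<^sup>2 = 1" "\<sigma> * (k - 2 * g) \<ge> 0" "\<sigma> \<noteq> 0" by (auto simp: \<sigma>_def)
  define X where "X = circle_field a (\<sigma> * (k - 2 * g)) (\<sigma> * \<beta>1) (\<sigma> * \<beta>2)"
  \<comment> \<open>Angular velocity of the unit-speed rotation along the circle: geodesic curvature
    2 sqrt a on the sphere of radius 1 / (2 sqrt a) means angular radius 45 degrees, so Euclidean
    radius 1 / sqrt (8 a).\<close>
  define s where "s = sqrt (8 * a)"
  have s: "s > 0" "s\<^sup>2 = 8 * a" using a by (simp_all add: s_def)
  have data: "bcv_lambda a (\<phi> p) * g = 2 * a * (\<phi> p $ 1 * nrm p $ 1 + \<phi> p $ 2 * nrm p $ 2) + k"
    "\<beta>1 = nrm p $ 2 - g * \<phi> p $ 2" "\<beta>2 = g * \<phi> p $ 1 - nrm p $ 1" "nrm p $ 1 ^ 2 + nrm p $ 2 ^ 2 = 1" "nrm p $ 3 = 0" for p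
  proof -
    have "g = C p $ 1" "\<beta>1 = C p $ 2" "\<beta>2 = C p $ 3" by (simp_all add: g_\<beta>1_\<beta>2_def Cc[of p0 p])
    then show "bcv_lambda a (\<phi> p) * g = 2 * a * (\<phi> p $ 1 * nrm p $ 1 + \<phi> p $ 2 * nrm p $ 2) + k"
      "\<beta>1 = nrm p $ 2 - g * \<phi> p $ 2" "\<beta>2 = g * \<phi> p $ 1 - nrm p $ 1"
      using bcv_lambda_pos[OF a, of "\<phi> p"] by (simp_all add: C_def circle_data_def Let_def)
    show "nrm p $ 3 = 0" using nrm(1)[of p] by (simp add: inner_axis3)
    then show "nrm p $ 1 ^ 2 + nrm p $ 2 ^ 2 = 1" using nrm(2)[of p] by (simp add: inner_real3 power2_eq_square)
  qed
  have norm: "s\<^sup>2 = (\<sigma> * (k - 2 * g))\<^sup>2 + 4 * a * ((\<sigma> * \<beta>1)\<^sup>2 + (\<sigma> * \<beta>2)\<^sup>2)"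
  proof -
    have "(k - 2 * g)\<^sup>2 + 4 * a * (\<beta>1\<^sup>2 + \<beta>2\<^sup>2) = 8 * a"
      using data[of p0] k unfolding bcv_lambda_def by algebra
    then show ?thesis using \<sigma>(1) s(2) by (simp add: power_mult_distrib)
  qed
  \<comment> \<open>Along the surface the field is plus or minus the unit horizontal vector
    orthogonal to the normal: it is tangent and has no zero there.\<close>
  have X12: "X (\<phi> p) $ 1 = \<sigma> * bcv_lambda a (\<phi> p) * nrm p $ 2"
    "X (\<phi> p) $ 2 = - (\<sigma> * bcv_lambda a (\<phi> p) * nrm p $ 1)" for p
    unfolding X_def circle_field_def vector_3
    using data[of p] unfolding bcv_lambda_def by algebra+
  have X3: "X (\<phi> p) $ 3 = 0" for p by (simp add: X_def circle_field_def)
  define c where "c = of_real (2 / (s + \<sigma> * (k - 2 * g))) * \<i> * Complex (\<sigma> * \<beta>1) (\<sigma> * \<beta>2)"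
  let ?U = "{p. 1 + a * cnj c * cpart p \<noteq> 0}"
  note mob = mobius_map_circle_field[OF a s(1) \<sigma>(2) norm, folded c_def X_def]
  have "\<phi> p \<in> ?U" for p
  proof -
    have "cpart (X (\<phi> p)) \<noteq> 0"
    proof
      assume "cpart (X (\<phi> p)) = 0"
      then have "X (\<phi> p) $ 1 = 0" "X (\<phi> p) $ 2 = 0" by (simp_all add: complex_eq_iff)
      then have "nrm p $ 1 = 0" "nrm p $ 2 = 0"
        using X12[of p] \<sigma>(3) bcv_lambda_pos[OF a, of "\<phi> p"] by simp_all
      then show False using data(4)[of p] by simp
    qed
    then show ?thesis using mob(1) by simp
  qed
  moreover have "killing_field (bcv_space a b) (bcv_metric a b) X"
    unfolding X_def b by (rule killing_circle_field[OF a])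
  moreover have "tangent_to_surface A \<phi> X"
    unfolding tangent_to_surface_def
  proof clarify
    fix U x p assume Ux: "(U, x) \<in> A" "p \<in> U"
    show "X (\<phi> p) \<in> range (loc_diff \<phi> U x p)"
      by (rule tangent[OF Ux]) (simp add: inner_real3 X12 data(5))
  qed
  moreover have "generates_SO2_action (bcv_space a b) (bcv_metric a b) (rot_field s)"
    unfolding b by (rule generates_rot_field[OF a s(1)])
  moreover have "local_isometry (bcv_space a b) (bcv_metric a b) ?U (mobius_map a c)"
    unfolding b by (rule mobius_map_local_isometry[OF a])
  moreover have "\<forall>q\<in>?U. frechet_derivative (mobius_map a c) (at q) (X q) = rot_field s (mobius_map a c q)"
    using mob(2) by simp
  ultimately have "rotational_surface a b A \<phi>"
    unfolding rotational_surface_def by blast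
  moreover have "hopf_cylinder A \<phi>"
    unfolding hopf_cylinder_def tangent_to_surface_def
  proof clarify
    fix U x p assume Ux: "(U, x) \<in> A" "p \<in> U"
    show "E3 (\<phi> p) \<in> range (loc_diff \<phi> U x p)"
      by (rule tangent[OF Ux]) (simp add: inner_real3 E3_def axis_def bcv_form_def data(5))
  qed
  ultimately show ?thesis by (simp add: rotational_hopf_cylinder_def)
qed

end

theorem theorem4p1:
  fixes a b :: real
    and A :: "'m::{t2_space,second_countable_topology} atlas"
    and \<phi> \<eta> :: "'m \<Rightarrow> real^3"
  assumes "4 * a \<noteq> b\<^sup>2"
    and "bcv_surface a b A \<phi> \<eta>"
    and "\<not> totally_geodesic a b A \<phi> \<eta>"
    and "totally_biharmonic a b A \<phi>"
  shows "a > 0 \<and> rotational_hopf_cylinder a b A \<phi>"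
proof -
  interpret totally_biharmonic_immersion a b A \<phi> \<eta>
    by unfold_locales (use assms in auto)
  show ?thesis using a_pos rotational_hopf_cylinder_immersion by simp
qed

end
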